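(* Let $q$ be a fixed power of an odd prime and $\gamma$ a fixed generator of $\mathbb{F}_q^\times$. As $g\to\infty$, $$\sum_{P\in\mathcal{P}_{2g+2}}L(\tfrac12,\chi_P)^2=\frac{1}{24\zeta_A(2)}|P|(\log_q|P|)^2+O(|P|\log_q|P|)$$ and $$\sum_{P\in\mathcal{P}_{2g+2}}L(\tfrac12,\chi_{\gamma P})^2=\frac{1}{24\zeta_A(2)}|P|(\log_q|P|)^2+O(|P|\log_q|P|),$$ where $|P|=q^{2g+2}$.
   Context: $A=\mathbb{F}_q[T]$ with $q$ odd. For nonzero $f\in A$, $|f|=q^{\deg f}$. $\mathcal{P}_n$ is the set of monic irreducible polynomials of degree $n$. For nonzero square-free $D\in A$, $\chi_D(f)=\left(\frac{D}{f}\right)$ is the Kronecker (Jacobi) symbol for monic $f$, and $L(s,\chi_D)=\sum_{f\text{ monic}}\chi_D(f)|f|^{-s}$ (a polynomial in $q^{-s}$). $\zeta_A(s)=\frac{1}{1-q^{1-s}}$. Implied constants may depend on $q$. *)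

theory Defs
  imports
    "HOL-Analysis.Analysis"
    "HOL-Computational_Algebra.Computational_Algebra"
    "HOL-Number_Theory.Cong"
    "HOL-Number_Theory.Prime_Powers"
    "HOL-Library.Landau_Symbols"
begin

text \<open>
  The ring \<open>A\<close> of polynomials over the field with \<open>q\<close> elements is \<^typ>\<open>'a poly\<close> with
  \<open>'a :: finite_field\<close>; thus \<open>q = CARD('a)\<close>.
\<close>

definition poly_abs :: "'a::finite_field poly \<Rightarrow> real"  (\<open>\<bar>_\<bar>\<^sub>A\<close>) where
  "\<bar>f\<bar>\<^sub>A = (if f = 0 then 0 else real CARD('a) ^ degree f)"

definition monic_polys :: "nat \<Rightarrow> 'a::finite_field poly set" where
  "monic_polys n = {f. lead_coeff f = 1 \<and> degree f = n}"

definition monic_irreducibles :: "nat \<Rightarrow> 'a::finite_field poly set" where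
  "monic_irreducibles n = {P \<in> monic_polys n. irreducible P}"

text \<open>Both sets are finite, so finite sums over them are not the default value \<open>0\<close>.\<close>

lemma finite_monic_polys [simp]: "finite (monic_polys n)"
proof (rule finite_subset)
  show "monic_polys n \<subseteq> Poly ` {xs :: 'a list. set xs \<subseteq> UNIV \<and> length xs \<le> Suc n}"
  proof
    fix f :: "'a poly" assume "f \<in> monic_polys n"
    hence "length (coeffs f) \<le> Suc n"
      by (cases "f = 0") (auto simp: monic_polys_def length_coeffs_degree)
    thus "f \<in> Poly ` {xs :: 'a list. set xs \<subseteq> UNIV \<and> length xs \<le> Suc n}"
      by (intro image_eqI[of _ _ "coeffs f"]) auto
  qed
qed (intro finite_imageI finite_lists_length_le, simp)

lemma finite_monic_irreducibles [simp]: "finite (monic_irreducibles n)"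
  by (rule finite_subset[OF _ finite_monic_polys[of n]]) (auto simp: monic_irreducibles_def)

definition legendre_poly :: "'a::finite_field poly \<Rightarrow> 'a poly \<Rightarrow> int" where
  "legendre_poly D P =
     (if P dvd D then 0 else if \<exists>h. [h ^ 2 = D] (mod P) then 1 else -1)"

text \<open>
  The product runs over the distinct monic irreducible divisors of \<open>f\<close>, each occurring with its
  exponent in the factorisation of \<open>f\<close>; this exponent is spelled out because
  \<^const>\<open>multiplicity\<close> needs a type class that \<^typ>\<open>'a poly\<close> is not an instance of
  here. The symbol is meant for monic (in any case nonzero) \<open>f\<close>.
\<close>

definition jacobi_poly :: "'a::finite_field poly \<Rightarrow> 'a poly \<Rightarrow> int" where
  "jacobi_poly D f =
     (\<Prod>P | lead_coeff P = 1 \<and> irreducible P \<and> P dvd f.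
        legendre_poly D P ^ Max {k. P ^ k dvd f})"

text \<open>
  The Dirichlet series \<open>\<Sum>f monic. \<chi>\<^sub>D(f) |f|\<^sup>-\<^sup>s\<close>, summed in order of increasing degree. For
  \<open>D\<close> not a constant times a square the inner sums vanish for \<open>n \<ge> degree D\<close>, so this is the
  polynomial in \<open>q\<^sup>-\<^sup>s\<close> that gives the value at every complex \<open>s\<close>, including \<open>s = 1/2\<close>, where the
  series over all monic \<open>f\<close> does not converge absolutely.
\<close>

definition dirichlet_L :: "complex \<Rightarrow> 'a::finite_field poly \<Rightarrow> complex" where
  "dirichlet_L s D =
     (\<Sum>n. \<Sum>f\<in>monic_polys n. of_int (jacobi_poly D f) * of_real \<bar>f\<bar>\<^sub>A powr (-s))"

definition zeta_A :: "nat \<Rightarrow> complex \<Rightarrow> complex" where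
  "zeta_A q s = 1 / (1 - of_nat q powr (1 - s))"

end

theory Submission
  imports "HOL-Algebra.Algebraic_Closure_Type" Defs
begin

text \<open>
  For even \<open>deg P\<close>, quadratic reciprocity turns \<open>\<chi>\<^sub>P(f)\<close> into the Legendre symbol \<open>(f/P)\<close>, an even
  character modulo \<open>P\<close>, and \<open>\<chi>\<^sub>\<gamma>\<^sub>P(f)\<close> into \<open>(-1)\<^bsup>deg f\<^esup> (f/P)\<close>. The functional equation, obtained from
  the Gauss sum of this character, expresses \<open>L(1/2)\<^sup>2\<close> by sums of \<open>(f\<^sub>1 f\<^sub>2/P)\<close> over pairs of monic
  polynomials with \<open>deg f\<^sub>1 + deg f\<^sub>2 \<le> 2g\<close>. Averaging over \<open>P\<close>, the pairs with square product give the
  main term, and the other pairs are controlled by a bound \<open>O(q\<^bsup>g+1\<^esup>)\<close>, uniform in \<open>f\<close> of degree at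
  most \<open>2g\<close>, for the sum of \<open>(f/P)\<close> over \<open>P\<close>. This consequence of the Riemann hypothesis for
  hyperelliptic curves is proved directly by Stepanov's method, which gives a bound linear in \<open>deg f\<close>.
\<close>

section \<open>Polynomials over a finite field\<close>

text \<open>The character sum is bounded by counting points: every irreducible \<open>P\<close> of
  degree \<open>N = 2 * g + 2\<close> has \<open>N\<close> roots in the field with
  \<open>q ^ N\<close> elements. Stepanov's method bounds how many points carry a given value of the
  quadratic character by half of all points plus O(\<open>m * q ^ (g + 1)\<close>), where
  \<open>m\<close> is the degree of \<open>f\<close>. Since \<open>m < N\<close>, dividing by
  \<open>N\<close> leaves a bound uniform in \<open>f\<close>; this is why linear dependence on the
  degree suffices. There are \<open>(n + 1) * q ^ n\<close> pairs of total degree \<open>n\<close>,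
  each weighted by about q^(-n/2), so for n \<le> 2g the nonsquare pairs cost O(g q^(2g)) in total,
  which is the size of the permitted error. The truncation at 2g also keeps every product of lower
  degree than \<open>P\<close>, hence prime to it. In degree 2i the square products number about q^i
  (1 - 1/q) i^2 / 2, where 1 - 1/q = 1/zeta_A(2) is the density of squarefree polynomials. The
  weight cancels q^i, and two sums over i up to about N/2 give (1 - 1/q) (N/2)^3 / 3. Multiplying by
  the number q^N / N of irreducibles produces N^2 / 24.\<close>

definition coeffs_in :: "'b::zero set \<Rightarrow> nat \<Rightarrow> 'b poly set" where
  "coeffs_in C n = {p. (\<forall>i. coeff p i \<in> C) \<and> (\<forall>i\<ge>n. coeff p i = 0)}"

abbreviation small :: "nat \<Rightarrow> 'b::zero poly set" where
  "small n \<equiv> coeffs_in UNIV n"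

lemma small_iff: "p \<in> small n \<longleftrightarrow> p = 0 \<or> degree p < n"
  unfolding coeffs_in_def
  by (auto simp: coeff_eq_0) (metis leading_coeff_0_iff linorder_not_le)

lemma coeffs_in_Suc:
  assumes "0 \<in> C"
  shows "coeffs_in C (Suc n) = (\<lambda>(c, p). pCons c p) ` (C \<times> coeffs_in C n)"
proof
  show "coeffs_in C (Suc n) \<subseteq> (\<lambda>(c, p). pCons c p) ` (C \<times> coeffs_in C n)"
  proof
    fix r assume r: "r \<in> coeffs_in C (Suc n)"
    obtain c p where rp: "r = pCons c p" by (cases r)
    have "coeff p i = coeff r (Suc i)" for i by (simp add: rp)
    moreover have "c = coeff r 0" by (simp add: rp)
    ultimately have "c \<in> C" "p \<in> coeffs_in C n"
      using r by (auto simp: coeffs_in_def)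
    with rp show "r \<in> (\<lambda>(c, p). pCons c p) ` (C \<times> coeffs_in C n)" by auto
  qed
  show "(\<lambda>(c, p). pCons c p) ` (C \<times> coeffs_in C n) \<subseteq> coeffs_in C (Suc n)"
    by (auto simp: coeffs_in_def coeff_pCons split: nat.splits)
qed

text \<open>The coefficient set is kept general for two uses: all of the field gives the polynomials
  of degree below \<open>n\<close>, and \<open>small d\<close> gives the bivariate polynomials
  counted in Stepanov's method.\<close>

lemma card_coeffs_in:
  assumes "finite C" "0 \<in> C"
  shows "finite (coeffs_in C n) \<and> card (coeffs_in C n) = card C ^ n"
proof (induction n)
  case 0
  have "coeffs_in C 0 = {0}" using assms by (auto simp: coeffs_in_def poly_eq_iff)
  thus ?case by simp
next
  case (Suc n)
  have "inj_on (\<lambda>(c, p). pCons c p) (C \<times> coeffs_in C n)" by (auto simp: inj_on_def)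
  thus ?case using Suc assms by (simp add: coeffs_in_Suc card_image card_cartesian_product)
qed

lemma finite_small [simp]: "finite (small n :: 'a::finite_field poly set)"
  and card_small: "card (small n :: 'a::finite_field poly set) = CARD('a) ^ n"
  using card_coeffs_in[of "UNIV :: 'a set" n] by auto

lemma small_0 [simp]: "small 0 = {0}"
  by (auto simp: small_iff)

lemma zero_in_small [simp]: "0 \<in> small n"
  by (simp add: small_iff)

lemma small_mono: "p \<in> small m \<Longrightarrow> m \<le> n \<Longrightarrow> p \<in> small n"
  by (auto simp: small_iff)

lemma small_add: "p \<in> small n \<Longrightarrow> r \<in> small n \<Longrightarrow> p + r \<in> small n" for p :: "'b::ab_group_add poly"
  by (auto simp: coeffs_in_def)

lemma small_diff: "p \<in> small n \<Longrightarrow> r \<in> small n \<Longrightarrow> p - r \<in> small n" for p :: "'b::ab_group_add poly"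
  by (auto simp: coeffs_in_def)

lemma small_smult: "p \<in> small n \<Longrightarrow> smult c p \<in> small n" for p :: "'b::comm_ring_1 poly"
  by (auto simp: coeffs_in_def)

lemma small_sum: "(\<And>x. x \<in> A \<Longrightarrow> f x \<in> small n) \<Longrightarrow> (\<Sum>x\<in>A. f x) \<in> small n"
  for f :: "'c \<Rightarrow> 'b::ab_group_add poly"
  by (induction A rule: infinite_finite_induct) (auto intro: small_add)

lemma small_mult: "p \<in> small m \<Longrightarrow> r \<in> small n \<Longrightarrow> p * r \<in> small (m + n - 1)"
  for p :: "'b::idom poly"
  by (cases "p = 0"; cases "r = 0") (auto simp: small_iff degree_mult_eq)

lemma in_small_degree: "p \<in> small (Suc (degree p))"
  by (simp add: small_iff)

section \<open>Coefficientwise images of polynomials under ring homomorphisms\<close>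

lemma map_poly_hom_sum:
  fixes f :: "'b::comm_ring_1 \<Rightarrow> 'c::comm_ring_1"
  assumes "f 0 = 0" "\<And>x y. f (x + y) = f x + f y"
  shows "f (\<Sum>x\<in>A. g x) = (\<Sum>x\<in>A. f (g x))"
  by (induction A rule: infinite_finite_induct) (auto simp: assms)

lemma map_poly_hom_add:
  fixes f :: "'b::comm_ring_1 \<Rightarrow> 'c::comm_ring_1"
  assumes "f 0 = 0" "\<And>x y. f (x + y) = f x + f y"
  shows "map_poly f (p + r) = map_poly f p + map_poly f r"
  by (rule poly_eqI) (simp add: coeff_map_poly assms)

lemma map_poly_hom_mult:
  fixes f :: "'b::comm_ring_1 \<Rightarrow> 'c::comm_ring_1"
  assumes "f 0 = 0" "\<And>x y. f (x + y) = f x + f y" "\<And>x y. f (x * y) = f x * f y"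
  shows "map_poly f (p * r) = map_poly f p * map_poly f r"
  by (rule poly_eqI) (simp add: coeff_map_poly coeff_mult assms map_poly_hom_sum[of f])

lemma map_poly_hom_prod:
  fixes f :: "'b::comm_ring_1 \<Rightarrow> 'c::comm_ring_1"
  assumes "f 0 = 0" "f 1 = 1" "\<And>x y. f (x + y) = f x + f y" "\<And>x y. f (x * y) = f x * f y"
  shows "map_poly f (\<Prod>x\<in>A. g x) = (\<Prod>x\<in>A. map_poly f (g x))"
  by (induction A rule: infinite_finite_induct) (auto simp: assms map_poly_hom_mult[of f])

section \<open>Evaluation in the algebraic closure\<close>

definition ev :: "'a::field poly \<Rightarrow> 'a alg_closure \<Rightarrow> 'a alg_closure" where
  "ev p x = poly (map_poly to_ac p) x"

lemma ev_0 [simp]: "ev 0 x = 0" and ev_1 [simp]: "ev 1 x = 1"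
  by (simp_all add: ev_def)

lemma ev_pCons [simp]: "ev (pCons a p) x = to_ac a + x * ev p x"
  by (simp add: ev_def map_poly_pCons)

lemma ev_add [simp]: "ev (p + r) x = ev p x + ev r x"
  by (simp add: ev_def map_poly_hom_add)

lemma ev_mult [simp]: "ev (p * r) x = ev p x * ev r x"
  by (simp add: ev_def map_poly_hom_mult)

lemma ev_minus [simp]: "ev (- p) x = - ev p x"
  using ev_add[of "-p" p x] by (simp add: eq_neg_iff_add_eq_0)

lemma ev_diff [simp]: "ev (p - r) x = ev p x - ev r x"
  using ev_add[of p "-r" x] by simp

lemma ev_power [simp]: "ev (p ^ n) x = ev p x ^ n"
  by (induction n) simp_all

lemma ev_smult [simp]: "ev (smult c p) x = to_ac c * ev p x"
  using ev_mult[of "[:c:]" p x] by simp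

lemma ev_monom [simp]: "ev (monom c n) x = to_ac c * x ^ n"
  by (simp add: ev_def map_poly_monom poly_monom)

lemma ev_sum: "ev (\<Sum>i\<in>A. f i) x = (\<Sum>i\<in>A. ev (f i) x)"
  by (induction A rule: infinite_finite_induct) simp_all

lemma degree_map_to_ac [simp]: "degree (map_poly to_ac p) = degree p"
  by (rule degree_map_poly) simp

lemma map_to_ac_eq_0_iff [simp]: "map_poly to_ac p = 0 \<longleftrightarrow> p = 0"
  by (simp add: poly_eq_iff coeff_map_poly)

lemma ev_root_exists:
  assumes "degree p > 0"
  obtains x where "ev p x = 0"
  using alg_closed_imp_poly_has_root[of "map_poly to_ac p"] assms by (auto simp: ev_def)

lemma finite_ev_roots:
  assumes "p \<noteq> 0"
  shows "finite {x. ev p x = 0}" "card {x. ev p x = 0} \<le> degree p"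
  using poly_roots_finite[of "map_poly to_ac p"] card_poly_roots_bound[of "map_poly to_ac p"] assms
  by (auto simp: ev_def)

lemma card_roots_of_unity:
  assumes "c > 0"
  shows "finite {t :: 'b::field. t ^ c = 1}" "card {t :: 'b. t ^ c = 1} \<le> c"
proof -
  let ?p = "monom 1 c - 1 :: 'b poly"
  have "coeff ?p c = 1" using assms by (auto simp: coeff_monom)
  hence nz: "?p \<noteq> 0" by (metis coeff_0 zero_neq_one)
  have "degree ?p \<le> c" using assms by (intro degree_le) (auto simp: coeff_monom)
  moreover have "{x. poly ?p x = 0} = {t. t ^ c = 1}" by (auto simp: poly_monom)
  ultimately show "finite {t :: 'b. t ^ c = 1}" "card {t :: 'b. t ^ c = 1} \<le> c"
    using card_poly_roots_bound[OF nz] poly_roots_finite[OF nz] by auto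
qed

lemma monic_dvd_degree_eq:
  fixes p r :: "'a::field poly"
  assumes "p dvd r" "degree p = degree r" "lead_coeff p = 1" "lead_coeff r = 1"
  shows "p = r"
proof -
  obtain s where s: "r = p * s" using assms(1) by auto
  have "p \<noteq> 0" "r \<noteq> 0" using assms by auto
  hence "degree s = 0" using assms(2) s by (auto simp: degree_mult_eq)
  then obtain c where "s = [:c:]" by (auto elim: degree_eq_zeroE)
  with s assms have "c = 1" by simp
  with s \<open>s = [:c:]\<close> show ?thesis by simp
qed

lemma minimal_ev_divides:
  fixes p :: "'a::field poly"
  assumes "p \<noteq> 0" "ev p x = 0" "\<And>r. r \<noteq> 0 \<Longrightarrow> ev r x = 0 \<Longrightarrow> degree p \<le> degree r" "ev g x = 0"
  shows "p dvd g"
proof -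
  have "ev (g mod p) x = 0"
    using assms(2,4) ev_add[of "p * (g div p)" "g mod p" x] by simp
  hence "g mod p = 0"
    using assms(1) assms(3)[of "g mod p"] degree_mod_less[of p g] by force
  thus ?thesis by auto
qed

text \<open>The nonzero polynomial of least degree vanishing at \<open>x\<close> divides everything
  that vanishes at \<open>x\<close>, and dividing the irreducible \<open>P\<close> it is an
  associate of \<open>P\<close>. This turns congruences modulo \<open>P\<close> into equations in
  the algebraic closure.\<close>

lemma ev_irreducible_eq_0_iff:
  fixes P :: "'a::field poly"
  assumes "irreducible P" "ev P x = 0"
  shows "ev f x = 0 \<longleftrightarrow> P dvd f"
proof
  assume f: "ev f x = 0"
  have P0: "P \<noteq> 0" using assms(1) by auto
  obtain p where p: "p \<noteq> 0" "ev p x = 0" "\<And>r. r \<noteq> 0 \<Longrightarrow> ev r x = 0 \<Longrightarrow> degree p \<le> degree r"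
    using ex_has_least_nat[of "\<lambda>r. r \<noteq> 0 \<and> ev r x = 0" P degree] P0 assms(2) by blast
  have "p dvd P" "p dvd f"
    using minimal_ev_divides[OF p] assms(2) f by blast+
  then obtain r where r: "P = p * r" by auto
  have "\<not> p dvd 1"
  proof
    assume "p dvd 1"
    then obtain c where "p * c = 1" by (metis dvdE)
    hence "ev p x * ev c x = 1" using ev_mult[of p c x] by simp
    thus False using p(2) by simp
  qed
  hence "r dvd 1" using assms(1) r by (auto simp: irreducible_def)
  hence "P dvd p" using r by (simp add: mult_unit_dvd_iff)
  thus "P dvd f" using \<open>p dvd f\<close> by (rule dvd_trans)
next
  assume "P dvd f"
  thus "ev f x = 0" using assms(2) by auto
qed

lemma ex_irreducible_root:
  fixes x :: "'a::field alg_closure"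
  obtains P where "irreducible P" "lead_coeff P = 1" "ev P x = 0"
proof -
  obtain P0 where P0: "P0 \<noteq> 0" "ev P0 x = 0"
    using alg_closure_algebraic[of x] by (auto simp: ev_def)
  obtain p where p: "p \<noteq> 0" "ev p x = 0" "\<And>r. r \<noteq> 0 \<Longrightarrow> ev r x = 0 \<Longrightarrow> degree p \<le> degree r"
    using ex_has_least_nat[of "\<lambda>r. r \<noteq> 0 \<and> ev r x = 0" P0 degree] P0 by blast
  define P where "P = smult (inverse (lead_coeff p)) p"
  have P: "P \<noteq> 0" "ev P x = 0" "lead_coeff P = 1" "degree P = degree p"
    using p by (auto simp: P_def)
  have "\<not> P dvd 1"
  proof
    assume "P dvd 1"
    then obtain c where "P * c = 1" by (metis dvdE)
    hence "ev P x * ev c x = 1" using ev_mult[of P c x] by simp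
    thus False using P(2) by simp
  qed
  moreover have "a dvd 1 \<or> b dvd 1" if ab: "P = a * b" for a b
  proof -
    have nz: "a \<noteq> 0" "b \<noteq> 0" using P(1) ab by auto
    have "ev a x = 0 \<or> ev b x = 0" using P(2) ab by simp
    hence "degree p \<le> degree a \<or> degree p \<le> degree b" using p(3) nz by blast
    hence "degree b = 0 \<or> degree a = 0" using P(4) ab nz by (auto simp: degree_mult_eq)
    thus ?thesis using nz by (auto simp: is_unit_iff_degree)
  qed
  ultimately have "irreducible P" using P(1) by (intro irreducibleI) auto
  thus ?thesis using that P by blast
qed

lemma irreducible_degree_pos: "irreducible P \<Longrightarrow> degree P > 0" for P :: "'a::field poly"
  using is_unit_iff_degree[of P] by (auto simp: irreducible_def)

section \<open>Frobenius orbits\<close>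

locale odd_finite_field =
  fixes field_type :: "'a::finite_field itself" and q :: nat
  assumes q_def: "q = CARD('a)" and primepow_q: "primepow q" and odd_q: "odd q"
begin

lemma q_ge_3: "q \<ge> 3"
  using primepow_gt_Suc_0[OF primepow_q] odd_q by (cases "q = 2") auto

text \<open>Adding 1 permutes the field, so it leaves the sum of all elements unchanged.\<close>

lemma of_nat_q_eq_0: "of_nat q = (0 :: 'a)"
proof -
  have "(\<Sum>x\<in>(UNIV :: 'a set). x + 1) = (\<Sum>x\<in>UNIV. x)"
    by (rule sum.reindex_bij_witness[of _ "\<lambda>x. x - 1" "\<lambda>x. x + 1"]) auto
  thus ?thesis by (simp add: sum.distrib q_def)
qed

lemma q_CHAR: "\<exists>r. q = CHAR('a) ^ r"
proof -
  obtain p k where p: "prime p" "k > 0" "q = p ^ k"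
    using primepow_q by (auto simp: primepow_def)
  have "CHAR('a) dvd q" using of_nat_q_eq_0 by (simp add: of_nat_eq_0_iff_char_dvd)
  hence "CHAR('a) dvd p" using p prime_dvd_power[of "CHAR('a)" p k] by auto
  hence "CHAR('a) = p" using p(1) by (metis CHAR_prime primes_dvd_imp_eq)
  thus ?thesis using p by auto
qed

lemma frobenius_add:
  fixes x y :: "'b::comm_semiring_1"
  assumes "CHAR('b) = CHAR('a)"
  shows "(x + y) ^ (q ^ k) = x ^ (q ^ k) + y ^ (q ^ k)"
proof -
  obtain r where "q = CHAR('a) ^ r" using q_CHAR by auto
  hence "q ^ k = CHAR('b) ^ (r * k)" using assms by (simp add: power_mult)
  thus ?thesis using freshmans_dream'[where 'a='b, of "q ^ k" "r * k" x y] assms by simp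
qed

lemma frobenius_diff:
  fixes x y :: "'b::comm_ring_1"
  assumes "CHAR('b) = CHAR('a)"
  shows "(x - y) ^ (q ^ k) = x ^ (q ^ k) - y ^ (q ^ k)"
  using frobenius_add[OF assms, of "x - y" y k] by (simp add: algebra_simps)

lemma frobenius_inj:
  fixes x y :: "'a alg_closure"
  assumes "x ^ (q ^ k) = y ^ (q ^ k)"
  shows "x = y"
  using frobenius_diff[of x y k] assms q_ge_3 by simp

lemma power_q_eq: "x ^ (q ^ k) = x" for x :: 'a
  using finite_field_power_card_power_eq_same[where x = x and n = k] by (simp add: q_def)

lemma ev_frobenius: "ev (p :: 'a poly) (x ^ (q ^ k)) = ev p x ^ (q ^ k)"
proof (induction p)
  case 0
  thus ?case using q_ge_3 by simp
next
  case (pCons a p)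
  have "to_ac a ^ (q ^ k) = to_ac a" using power_q_eq[of a k] by (metis to_ac_power)
  thus ?case using pCons by (simp add: frobenius_add power_mult_distrib)
qed

lemma poly_X_q: 
  fixes x :: "'a alg_closure"
  assumes "N > 0"
  shows "finite {x :: 'a alg_closure. x ^ (q ^ N) = x}"
    and "card {x :: 'a alg_closure. x ^ (q ^ N) = x} \<le> q ^ N"
proof -
  let ?p = "monom 1 (q ^ N) - monom 1 1 :: 'a alg_closure poly"
  have q1: "q ^ N > 1" using q_ge_3 assms by (intro one_less_power) auto
  have c: "coeff ?p (q ^ N) = 1" using q1 by (auto simp: coeff_monom)
  hence nz: "?p \<noteq> 0" by (metis coeff_0 zero_neq_one)
  have "degree ?p \<le> q ^ N" using q1 by (intro degree_le) (auto simp: coeff_monom)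
  moreover have "{x. poly ?p x = 0} = {x. x ^ (q ^ N) = x}" by (auto simp: poly_monom)
  ultimately show "finite {x :: 'a alg_closure. x ^ (q ^ N) = x}"
    and "card {x :: 'a alg_closure. x ^ (q ^ N) = x} \<le> q ^ N"
    using card_poly_roots_bound[OF nz] poly_roots_finite[OF nz] by auto
qed

lemma frobenius_fixed: "{x :: 'a alg_closure. x ^ q = x} = range to_ac"
proof (rule sym, rule card_seteq)
  show "finite {x :: 'a alg_closure. x ^ q = x}" using poly_X_q(1)[of 1] by simp
  show "range to_ac \<subseteq> {x :: 'a alg_closure. x ^ q = x}"
    using power_q_eq[of _ 1] by (auto simp flip: to_ac_power)
  have "card (range (to_ac :: 'a \<Rightarrow> _)) = q" by (simp add: q_def card_image inj_to_ac)
  thus "card {x :: 'a alg_closure. x ^ q = x} \<le> card (range (to_ac :: 'a \<Rightarrow> _))"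
    using poly_X_q(2)[of 1] by simp
qed

text \<open>Galois descent: coefficients fixed by the \<open>q\<close>-th power map lie in the base
  field.\<close>

lemma fixed_coeffs_descend:
  fixes p :: "'a alg_closure poly"
  assumes "map_poly (\<lambda>x. x ^ q) p = p"
  obtains r where "p = map_poly to_ac r"
proof -
  have "coeff p i ^ q = coeff p i" for i
    using arg_cong[OF assms, of "\<lambda>r. coeff r i"] q_ge_3 by (simp add: coeff_map_poly)
  hence "coeff p i \<in> range to_ac" for i using frobenius_fixed by blast
  hence "p = map_poly to_ac (map_poly of_ac p)"
    by (intro poly_eqI) (simp add: coeff_map_poly to_ac_of_ac)
  thus ?thesis using that by blast
qed

lemma power_power_add: "x ^ (q ^ (i + j)) = (x ^ (q ^ i)) ^ (q ^ j)" for x :: "'b::comm_ring_1"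
  by (simp add: power_add power_mult)

text \<open>The roots of \<open>P\<close> are the Frobenius conjugates of one root. All conjugates
  are roots, so the orbit has length at most \<open>degree P\<close>. Conversely, the product over
  the orbit is fixed by Frobenius, descends to the base field and vanishes at \<open>x\<close>, so
  \<open>P\<close> divides it.\<close>

lemma frobenius_period:
  fixes P :: "'a poly"
  assumes P: "irreducible P" "lead_coeff P = 1" "ev P x = 0"
  shows irreducible_splits: "map_poly to_ac P = (\<Prod>i<degree P. [:- (x ^ (q ^ i)), 1:])"
    and frobenius_inj_on: "inj_on (\<lambda>i. x ^ (q ^ i)) {..<degree P}"
    and frobenius_degree: "x ^ (q ^ degree P) = x"
proof -
  define s where "s i = x ^ (q ^ i)" for i
  have P0: "P \<noteq> 0" using P by auto
  have root: "ev P (s i) = 0" for i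
    using P(3) q_ge_3 by (simp add: s_def ev_frobenius)
  have "finite (range s)"
    by (rule finite_subset[OF _ finite_ev_roots(1)[OF P0]]) (use root in auto)
  hence "\<not> inj s" using finite_imageD by auto
  then obtain i j where ij: "i < j" "s i = s j"
    by (metis injI linorder_neq_iff)
  have "s (j - i) ^ (q ^ i) = s 0 ^ (q ^ i)"
    using ij power_power_add[of x "j - i" i] by (simp add: s_def)
  hence "s (j - i) = s 0" by (rule frobenius_inj)
  hence ex: "j - i > 0 \<and> s (j - i) = x" using ij by (simp add: s_def)
  \<comment> \<open>The orbit length. As Frobenius is injective, the first repetition in the orbit
    is a return to \<open>x\<close> itself.\<close>
  define e where "e = (LEAST e. e > 0 \<and> s e = x)"
  have e: "e > 0" "s e = x" using LeastI[of "\<lambda>e. e > 0 \<and> s e = x", OF ex] by (auto simp: e_def)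
  have e_least: "s k \<noteq> x" if "0 < k" "k < e" for k
    using not_less_Least[of k "\<lambda>e. e > 0 \<and> s e = x"] that by (auto simp: e_def)
  have neq: "s i \<noteq> s j" if "i < j" "j < e" for i j
  proof
    assume "s i = s j"
    hence "s (j - i) ^ (q ^ i) = s 0 ^ (q ^ i)"
      using that power_power_add[of x "j - i" i] by (simp add: s_def)
    hence "s (j - i) = s 0" by (rule frobenius_inj)
    thus False using e_least[of "j - i"] that by (simp add: s_def less_imp_diff_less)
  qed
  have inj: "inj_on s {..<e}"
    by (rule inj_onI) (metis lessThan_iff linorder_neq_iff neq)
  have e_le: "e \<le> degree P"
  proof -
    have "card (s ` {..<e}) \<le> card {x. ev P x = 0}"
      using root by (intro card_mono finite_ev_roots P0) auto
    thus ?thesis using finite_ev_roots(2)[OF P0] by (simp add: card_image inj)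
  qed
  define p where "p = (\<Prod>i<e. [:- s i, 1:])"
  have s_Suc: "s i ^ q = s (Suc i)" for i
    using power_power_add[of x i 1] by (simp add: s_def)
  have "map_poly (\<lambda>x. x ^ q) p = (\<Prod>i<e. map_poly (\<lambda>x. x ^ q) [:- s i, 1:])"
    unfolding p_def using q_ge_3
    by (intro map_poly_hom_prod) (auto simp: frobenius_add[where k = 1, simplified] power_mult_distrib)
  also have "\<dots> = (\<Prod>i<e. [:- s (Suc i), 1:])"
    using q_ge_3 odd_q by (intro prod.cong) (auto simp: map_poly_pCons s_Suc)
  also have "\<dots> = p"
  proof -
    obtain e' where e': "e = Suc e'" using e(1) by (cases e) auto
    have "(\<Prod>i<e. [:- s (Suc i), 1:]) = (\<Prod>i<e'. [:- s (Suc i), 1:]) * [:- s e, 1:]"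
      by (simp add: e')
    also have "s e = s 0" using e(2) by (simp add: s_def)
    also have "(\<Prod>i<e'. [:- s (Suc i), 1:]) * [:- s 0, 1:] = p"
      unfolding p_def e' by (simp only: prod.lessThan_Suc_shift mult.commute)
    finally show ?thesis .
  qed
  finally obtain r where r: "p = map_poly to_ac r" by (rule fixed_coeffs_descend)
  have "lead_coeff p = 1" unfolding p_def by (simp add: lead_coeff_prod)
  hence lr: "lead_coeff r = 1" unfolding r by (simp add: coeff_map_poly)
  have "degree p = e" unfolding p_def by (subst degree_prod_sum_eq) auto
  hence dr: "degree r = e" unfolding r by simp
  have "ev r x = 0"
    using e(1) unfolding ev_def r[symmetric] p_def
    by (auto simp: poly_prod s_def prod_zero_iff intro!: bexI[of _ 0])
  hence "P dvd r" using ev_irreducible_eq_0_iff[OF P(1,3)] by blast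
  moreover have "r \<noteq> 0" using lr by auto
  ultimately have "degree P \<le> e" using dr dvd_imp_degree_le by blast
  hence deg: "degree P = e" using e_le by simp
  hence "P = r" using monic_dvd_degree_eq[OF \<open>P dvd r\<close>] dr lr P by simp
  thus "map_poly to_ac P = (\<Prod>i<degree P. [:- (x ^ (q ^ i)), 1:])"
    using r deg by (simp add: p_def s_def)
  show "inj_on (\<lambda>i. x ^ (q ^ i)) {..<degree P}"
    using inj deg by (simp add: s_def inj_on_def)
  show "x ^ (q ^ degree P) = x" using e deg by (simp add: s_def)
qed

text \<open>The orbit of \<open>x\<close> has exact length \<open>degree P\<close>, so
  \<open>N\<close> matters only modulo \<open>degree P\<close>.\<close>

lemma frobenius_degree_mult:
  fixes P :: "'a poly"
  assumes P: "irreducible P" "lead_coeff P = 1" "ev P x = 0"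
  shows "x ^ (q ^ N) = x \<longleftrightarrow> degree P dvd N"
proof -
  let ?n = "degree P"
  have per: "x ^ (q ^ (?n * k)) = x" for k
  proof (induction k)
    case (Suc k)
    have "x ^ (q ^ (?n * Suc k)) = (x ^ (q ^ ?n)) ^ (q ^ (?n * k))"
      using power_power_add[of x ?n "?n * k"] by simp
    thus ?case using Suc frobenius_degree[OF P] by simp
  qed simp
  have "x ^ (q ^ N) = (x ^ (q ^ (?n * (N div ?n)))) ^ (q ^ (N mod ?n))"
    using power_power_add[of x "?n * (N div ?n)" "N mod ?n"] by simp
  hence eq: "x ^ (q ^ N) = x ^ (q ^ (N mod ?n))" using per by simp
  have n: "?n > 0" using P(1) by (rule irreducible_degree_pos)
  have "x ^ (q ^ N) = x \<longleftrightarrow> x ^ (q ^ (N mod ?n)) = x ^ (q ^ 0)" using eq by simp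
  also have "\<dots> \<longleftrightarrow> N mod ?n = 0"
    using inj_on_eq_iff[OF frobenius_inj_on[OF P], of "N mod ?n" 0] n by simp
  finally show ?thesis by auto
qed

end

section \<open>The residue field of \<open>P\<close>, Euler's criterion and quadratic
  reciprocity\<close>

lemma poly_mod_eq_iff: "a mod p = b mod p \<longleftrightarrow> p dvd a - b" for p :: "'a::field poly"
  by (metis dvd_eq_mod_eq_0 eq_iff_diff_eq_0 poly_mod_diff_left)

lemma legendre_poly_alt:
  "legendre_poly D P = (if P dvd D then 0 else if \<exists>h. P dvd h\<^sup>2 - D then 1 else -1)"
  unfolding legendre_poly_def cong_def poly_mod_eq_iff ..

context odd_finite_field
begin

text \<open>For positive \<open>n\<close> this is the subfield with \<open>q ^ n\<close> elements of
  the algebraic closure.\<close>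

definition fixed :: "nat \<Rightarrow> 'a alg_closure set" where
  "fixed n = {x. x ^ (q ^ n) = x}"

lemma finite_fixed: "n > 0 \<Longrightarrow> finite (fixed n)"
  and card_fixed_le: "n > 0 \<Longrightarrow> card (fixed n) \<le> q ^ n"
  unfolding fixed_def by (rule poly_X_q; assumption)+

lemma one_neq_minus_one: "(1::'a) \<noteq> - 1"
proof
  assume "(1::'a) = - 1"
  hence "(1::'a) + 1 = 0" by (metis add.right_inverse)
  hence "of_nat 2 = (0::'a)" by simp
  hence "CHAR('a) dvd 2" by (simp only: of_nat_eq_0_iff_char_dvd)
  hence c: "CHAR('a) = 2" by (metis CHAR_prime primes_dvd_imp_eq two_is_prime_nat)
  obtain r where "q = CHAR('a) ^ r" using q_CHAR by auto
  with c odd_q have "q = 1" by (cases r) auto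
  thus False using q_ge_3 by simp
qed

text \<open>In odd characteristic -1, 0 and 1 stay distinct, so identities between Legendre symbols
  can be verified in the algebraic closure.\<close>

lemma sign_of_int_inj:
  assumes "a \<in> {-1, 0, 1}" "b \<in> {-1, 0, 1}" "of_int a = (of_int b :: 'a alg_closure)"
  shows "a = b"
proof -
  have "(1 :: 'a alg_closure) \<noteq> - 1"
    using one_neq_minus_one by (metis to_ac_1 to_ac_eq_iff to_ac_minus)
  moreover from this have "(- 1 :: 'a alg_closure) \<noteq> 1" by metis
  ultimately show ?thesis using assms by auto
qed

text \<open>Evaluation at a root of \<open>P\<close> realises the residue field. It is injective on
  remainders because \<open>P\<close> divides no nonzero polynomial of smaller degree, and its
  \<open>q ^ degree P\<close> values then exhaust a set of at most that size.\<close>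

lemma residue_field:
  fixes P :: "'a poly"
  assumes P: "irreducible P" "lead_coeff P = 1" "ev P x = 0"
  shows "inj_on (\<lambda>f. ev f x) (small (degree P))"
    and "(\<lambda>f. ev f x) ` small (degree P) = fixed (degree P)"
    and "card (fixed (degree P)) = q ^ degree P"
proof -
  have n: "degree P > 0" using P(1) by (rule irreducible_degree_pos)
  show inj: "inj_on (\<lambda>f. ev f x) (small (degree P))"
  proof (rule inj_onI)
    fix f g :: "'a poly" assume fg: "f \<in> small (degree P)" "g \<in> small (degree P)" "ev f x = ev g x"
    hence "ev (f - g) x = 0" by simp
    hence "P dvd f - g" using ev_irreducible_eq_0_iff[OF P(1,3)] by blast
    moreover have "f - g \<in> small (degree P)" using fg small_diff by blast
    ultimately have "f - g = 0"
      using dvd_imp_degree_le[of P "f - g"] by (cases "f - g = 0") (auto simp: small_iff)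
    thus "f = g" by simp
  qed
  have card: "card ((\<lambda>f. ev f x) ` small (degree P)) = q ^ degree P"
    by (simp add: card_image inj card_small q_def)
  have "(\<lambda>f. ev f x) ` small (degree P) \<subseteq> fixed (degree P)"
    using frobenius_degree[OF P] by (auto simp: fixed_def simp flip: ev_frobenius)
  thus *: "(\<lambda>f. ev f x) ` small (degree P) = fixed (degree P)"
    using card card_fixed_le[OF n] finite_fixed[OF n] by (intro card_seteq) auto
  show "card (fixed (degree P)) = q ^ degree P" using card * by simp
qed

lemma q_geom: "q ^ n = 1 + (q - 1) * (\<Sum>i<n. q ^ i)"
proof (induction n)
  case (Suc n)
  obtain r where "q = Suc r" using q_ge_3 by (cases q) auto
  with Suc show ?case by (simp add: algebra_simps)
qed simp

text \<open>Raising to the power 1 + q + ... + q^(n-1) is the norm to the base field; what remains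
  is the quadratic character of the base field.\<close>

lemma half_exponent: "(q ^ n - 1) div 2 = (\<Sum>i<n. q ^ i) * ((q - 1) div 2)"
  and two_half_q: "2 * ((q - 1) div 2) = q - 1"
  and two_half_exponent: "2 * ((q ^ n - 1) div 2) = q ^ n - 1"
proof -
  show h: "2 * ((q - 1) div 2) = q - 1" using odd_q by (intro dvd_mult_div_cancel) simp
  have "q ^ n - 1 = 2 * ((\<Sum>i<n. q ^ i) * ((q - 1) div 2))"
    using q_geom[of n] h by (metis add_diff_cancel_left' mult.assoc mult.commute)
  thus "(q ^ n - 1) div 2 = (\<Sum>i<n. q ^ i) * ((q - 1) div 2)" by simp
  show "2 * ((q ^ n - 1) div 2) = q ^ n - 1" using odd_q by simp
qed

lemma half_exponent_pos: "n > 0 \<Longrightarrow> (q ^ n - 1) div 2 > 0"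
proof -
  assume "n > 0"
  hence "q ^ 1 \<le> q ^ n" using q_ge_3 by (intro power_increasing) auto
  thus ?thesis using q_ge_3 by simp
qed

text \<open>With \<open>2 * c\<close> nonzero residues and at most two square roots each, there are
  at least \<open>c\<close> nonzero squares. All of them satisfy \<open>t ^ c = 1\<close>, which has
  at most \<open>c\<close> solutions, so these solutions are exactly the squares.\<close>

theorem euler_criterion:
  fixes P :: "'a poly"
  assumes P: "irreducible P" "lead_coeff P = 1" "ev P x = 0"
  shows "ev f x ^ ((q ^ degree P - 1) div 2) = of_int (legendre_poly f P)"
proof -
  define n where "n = degree P"
  define c where "c = (q ^ n - 1) div 2"
  have n: "n > 0" using irreducible_degree_pos[OF P(1)] by (simp add: n_def)
  have c: "c > 0" "2 * c = q ^ n - 1"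
    using half_exponent_pos[OF n] two_half_exponent[of n] by (simp_all add: c_def)
  define K where "K = fixed n - {0}"
  have fin: "finite K" using finite_fixed[OF n] by (simp add: K_def)
  have "0 \<in> fixed n" using q_ge_3 by (simp add: fixed_def)
  hence cardK: "card K = 2 * c"
    using residue_field(3)[OF P] c finite_fixed[OF n] by (simp add: K_def n_def)
  have unit: "y ^ (2 * c) = 1" if "y \<in> K" for y
  proof -
    have "y ^ (2 * c) * y = y ^ (q ^ n)" using c q_ge_3 by (simp flip: power_Suc2)
    also have "\<dots> = y" using that by (simp add: K_def fixed_def)
    finally show ?thesis using that by (simp add: K_def)
  qed
  define S where "S = (\<lambda>y. y\<^sup>2) ` K"
  define T where "T = {t :: 'a alg_closure. t ^ c = 1}"
  have T: "finite T" "card T \<le> c"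
    unfolding T_def by (rule card_roots_of_unity[OF c(1)])+
  have "S \<subseteq> T" using unit by (auto simp: S_def T_def simp flip: power_mult)
  have "2 * c \<le> (\<Sum>s\<in>S. card {y. y\<^sup>2 = s})"
  proof -
    have fin2: "finite {y :: 'a alg_closure. y\<^sup>2 = s} \<and> card {y :: 'a alg_closure. y\<^sup>2 = s} \<le> 2" for s
    proof (cases "\<exists>z. z\<^sup>2 = s")
      case True
      then obtain z where z: "z\<^sup>2 = s" by auto
      hence "{y. y\<^sup>2 = s} \<subseteq> {z, - z}" by (auto simp: power2_eq_iff)
      moreover have "card {z, - z} \<le> 2" by (simp add: card_insert_if)
      ultimately show ?thesis by (meson card_mono finite.emptyI finite_insert finite_subset le_trans)
    qed auto
    have "K \<subseteq> (\<Union>s\<in>S. {y. y\<^sup>2 = s})" by (auto simp: S_def)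
    hence "card K \<le> card (\<Union>s\<in>S. {y. y\<^sup>2 = s})"
      using fin fin2 by (intro card_mono) (auto simp: S_def)
    also have "\<dots> \<le> (\<Sum>s\<in>S. card {y. y\<^sup>2 = s})" using fin by (intro card_UN_le) (simp add: S_def)
    finally show ?thesis using cardK by simp
  qed
  also have "\<dots> \<le> (\<Sum>s\<in>S. 2)"
  proof (rule sum_mono)
    fix s :: "'a alg_closure" assume "s \<in> S"
    then obtain z where z: "z\<^sup>2 = s" by (auto simp: S_def)
    hence "{y. y\<^sup>2 = s} \<subseteq> {z, - z}" by (auto simp: power2_eq_iff)
    hence "card {y. y\<^sup>2 = s} \<le> card {z, - z}" by (intro card_mono) auto
    also have "\<dots> \<le> 2" by (simp add: card_insert_if)
    finally show "card {y. y\<^sup>2 = s} \<le> 2" .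
  qed
  finally have "c \<le> card S" by simp
  hence ST: "S = T" using T \<open>S \<subseteq> T\<close> by (intro card_seteq) auto
  show ?thesis
  proof (cases "P dvd f")
    case True
    hence "ev f x = 0" using ev_irreducible_eq_0_iff[OF P(1,3)] by blast
    thus ?thesis using True c by (simp add: legendre_poly_alt c_def n_def)
  next
    case False
    hence f0: "ev f x \<noteq> 0" using ev_irreducible_eq_0_iff[OF P(1,3)] by blast
    have mem: "ev g x \<in> fixed n" for g
      using frobenius_degree[OF P] by (simp add: fixed_def n_def flip: ev_frobenius)
    hence fK: "ev f x \<in> K" using f0 by (simp add: K_def)
    have sq: "(\<exists>h. P dvd h\<^sup>2 - f) \<longleftrightarrow> ev f x \<in> S"
    proof
      assume "\<exists>h. P dvd h\<^sup>2 - f"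
      then obtain h where "ev (h\<^sup>2 - f) x = 0" using ev_irreducible_eq_0_iff[OF P(1,3)] by blast
      hence h: "ev h x ^ 2 = ev f x" by simp
      hence "ev h x \<in> K" using f0 mem by (auto simp: K_def)
      thus "ev f x \<in> S" using h by (force simp: S_def)
    next
      assume "ev f x \<in> S"
      then obtain y where y: "y \<in> fixed n" "ev f x = y\<^sup>2" unfolding S_def K_def by blast
      then obtain h where "y = ev h x" using residue_field(2)[OF P] by (auto simp: n_def)
      hence "ev (h\<^sup>2 - f) x = 0" using y by simp
      thus "\<exists>h. P dvd h\<^sup>2 - f" using ev_irreducible_eq_0_iff[OF P(1,3)] by blast
    qed
    have "(ev f x ^ c)\<^sup>2 = 1" using unit[OF fK] by (simp add: mult.commute flip: power_mult)
    hence "ev f x ^ c = 1 \<or> ev f x ^ c = -1" by (simp add: power2_eq_1_iff)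
    thus ?thesis using sq False ST
      by (auto simp: legendre_poly_alt T_def c_def n_def)
  qed
qed

lemma legendre_range: "legendre_poly f P \<in> {-1, 0, 1}"
  by (auto simp: legendre_poly_def)

lemma legendre_eq_0_iff: "legendre_poly f P = 0 \<longleftrightarrow> P dvd f"
  by (auto simp: legendre_poly_def)

lemma legendre_mult:
  fixes P :: "'a poly"
  assumes "irreducible P" "lead_coeff P = 1"
  shows "legendre_poly (f * g) P = legendre_poly f P * legendre_poly g P"
proof -
  obtain x where x: "ev P x = 0" using irreducible_degree_pos[OF assms(1)] ev_root_exists by blast
  note E = euler_criterion[OF assms x]
  show ?thesis
  proof (rule sign_of_int_inj)
    show "of_int (legendre_poly (f * g) P) = (of_int (legendre_poly f P * legendre_poly g P) :: 'a alg_closure)"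
      by (simp flip: E add: power_mult_distrib)
  qed (use legendre_range[of f P] legendre_range[of g P] legendre_range[of "f * g" P] in auto)
qed

lemma legendre_1: "irreducible (P :: 'a poly) \<Longrightarrow> legendre_poly 1 P = 1"
  unfolding legendre_poly_alt by (auto simp: irreducible_def intro!: exI[of _ 1])

lemma legendre_cong: "P dvd f - g \<Longrightarrow> legendre_poly f P = legendre_poly g (P :: 'a poly)"
  unfolding legendre_poly_def cong_def dvd_eq_mod_eq_0[of P f] dvd_eq_mod_eq_0[of P g]
  by (subst (asm) poly_mod_eq_iff[symmetric]) simp

lemma legendre_mod: "legendre_poly (f mod P) P = legendre_poly f (P :: 'a poly)"
  by (rule legendre_cong) (simp flip: poly_mod_eq_iff)

lemma geom_even: "even (\<Sum>i<n. q ^ i) \<longleftrightarrow> even n"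
  using odd_q by (induction n) auto

text \<open>For even degree the norm exponent is even, so Euler's exponent is a multiple of
  \<open>q - 1\<close>, which kills nonzero constants. This is the evenness of the
  character.\<close>

lemma legendre_const:
  fixes P :: "'a poly"
  assumes P: "irreducible P" "lead_coeff P = 1" and "even (degree P)" "c \<noteq> 0"
  shows "legendre_poly [:c:] P = 1"
proof -
  obtain x where x: "ev P x = 0" using irreducible_degree_pos[OF P(1)] ev_root_exists by blast
  obtain k where k: "(\<Sum>i<degree P. q ^ i) = 2 * k" using geom_even assms(3) by (metis evenE)
  have "c ^ q = c" using power_q_eq[of c 1] by simp
  hence "c * c ^ (q - 1) = c" using q_ge_3 by (simp flip: power_Suc)
  hence c1: "c ^ (q - 1) = 1" using assms(4) by simp
  have "(q ^ degree P - 1) div 2 = 2 * ((q - 1) div 2) * k"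
    unfolding half_exponent k by (simp only: ac_simps)
  also have "\<dots> = (q - 1) * k" by (simp only: two_half_q)
  finally have "(q ^ degree P - 1) div 2 = (q - 1) * k" .
  hence "ev [:c:] x ^ ((q ^ degree P - 1) div 2) = to_ac (c ^ (q - 1)) ^ k"
    by (simp add: power_mult)
  also have "\<dots> = of_int 1" using c1 by simp
  finally show ?thesis
    using euler_criterion[OF P x, of "[:c:]"] legendre_range[of "[:c:]" P]
    by (intro sign_of_int_inj) auto
qed

text \<open>A generator satisfies \<open>\<gamma> ^ ((q - 1) div 2) = -1\<close>, for otherwise its
  powers would give at most half of the nonzero constants. The norm exponent then has the parity of
  \<open>degree P\<close>.\<close>

lemma legendre_generator:
  fixes P :: "'a poly"
  assumes P: "irreducible P" "lead_coeff P = 1"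
    and \<gamma>: "{\<gamma> ^ k | k :: nat. True} = UNIV - {0 :: 'a}"
  shows "legendre_poly [:\<gamma>:] P = (-1) ^ degree P"
proof -
  define c where "c = (q - 1) div 2"
  have c: "2 * c = q - 1" using two_half_q by (simp add: c_def)
  hence c0: "c > 0" using q_ge_3 by simp
  have \<gamma>0: "\<gamma> \<noteq> 0" using \<gamma> by (metis (mono_tags, lifting) DiffD2 insertI1 mem_Collect_eq power_one_right)
  have "\<gamma> ^ q = \<gamma>" using power_q_eq[of \<gamma> 1] by simp
  hence "\<gamma> * \<gamma> ^ (q - 1) = \<gamma>" using q_ge_3 by (simp flip: power_Suc)
  hence "\<gamma> ^ (2 * c) = 1" using \<gamma>0 c by simp
  hence "(\<gamma> ^ c)\<^sup>2 = 1" by (simp add: mult.commute flip: power_mult)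
  hence cases: "\<gamma> ^ c = 1 \<or> \<gamma> ^ c = -1" by (simp add: power2_eq_1_iff)
  have "\<gamma> ^ c \<noteq> 1"
  proof
    assume 1: "\<gamma> ^ c = 1"
    have "\<gamma> ^ k \<in> (\<lambda>i. \<gamma> ^ i) ` {..<c}" for k
    proof -
      have "\<gamma> ^ k = (\<gamma> ^ c) ^ (k div c) * \<gamma> ^ (k mod c)"
        by (simp flip: power_mult power_add)
      thus ?thesis using 1 c0 by auto
    qed
    hence "UNIV - {0} \<subseteq> (\<lambda>i. \<gamma> ^ i) ` {..<c}" unfolding \<gamma>[symmetric] by auto
    hence "card (UNIV - {0 :: 'a}) \<le> card ((\<lambda>i. \<gamma> ^ i) ` {..<c})" by (intro card_mono) auto
    also have "\<dots> \<le> c" using card_image_le[of "{..<c}" "\<lambda>i. \<gamma> ^ i"] by simp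
    finally have "q - 1 \<le> c" by (simp add: q_def)
    thus False using c c0 by simp
  qed
  hence m1: "\<gamma> ^ c = -1" using cases by blast
  obtain x where x: "ev P x = 0" using irreducible_degree_pos[OF P(1)] ev_root_exists by blast
  have "ev [:\<gamma>:] x ^ ((q ^ degree P - 1) div 2) = to_ac (\<gamma> ^ c) ^ (\<Sum>i<degree P. q ^ i)"
    unfolding half_exponent c_def[symmetric] by (simp add: mult.commute flip: power_mult)
  also have "\<dots> = (- 1) ^ (\<Sum>i<degree P. q ^ i)" by (simp add: m1)
  also have "\<dots> = (- 1) ^ degree P"
    using geom_even[of "degree P"] by (simp add: minus_one_power_iff)
  finally have "of_int (legendre_poly [:\<gamma>:] P) = (of_int ((-1) ^ degree P) :: 'a alg_closure)"
    using euler_criterion[OF P x, of "[:\<gamma>:]"] by simp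
  thus ?thesis
    using legendre_range[of "[:\<gamma>:]" P]
    by (intro sign_of_int_inj) (auto simp: minus_one_power_iff)
qed

text \<open>
  By Euler's criterion both symbols are the \<open>(q - 1) / 2\<close>-th power of the resultant, a product
  over pairs of conjugates, and exchanging the arguments of the resultant only changes its sign.
\<close>

theorem quadratic_reciprocity:
  fixes P R :: "'a poly"
  assumes P: "irreducible P" "lead_coeff P = 1" and R: "irreducible R" "lead_coeff R = 1"
    and "even (degree P)"
  shows "legendre_poly P R = legendre_poly R P"
proof -
  obtain x where x: "ev P x = 0" using irreducible_degree_pos[OF P(1)] ev_root_exists by blast
  obtain y where y: "ev R y = 0" using irreducible_degree_pos[OF R(1)] ev_root_exists by blast
  have res: "ev A b ^ ((q ^ degree B - 1) div 2) =
      (\<Prod>i<degree B. \<Prod>j<degree A. b ^ (q ^ i) - a ^ (q ^ j)) ^ ((q - 1) div 2)"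
    if A: "irreducible A" "lead_coeff A = 1" "ev A a = 0"
      and B: "irreducible B" "lead_coeff B = 1" "ev B b = 0" for A B :: "'a poly" and a b
  proof -
    have "ev A b ^ (\<Sum>i<degree B. q ^ i) = (\<Prod>i<degree B. ev A (b ^ (q ^ i)))"
      by (simp add: power_sum ev_frobenius)
    also have "\<dots> = (\<Prod>i<degree B. \<Prod>j<degree A. b ^ (q ^ i) - a ^ (q ^ j))"
      by (simp add: ev_def irreducible_splits[OF A] poly_prod)
    finally show ?thesis unfolding half_exponent power_mult by simp
  qed
  have "(\<Prod>i<degree R. \<Prod>j<degree P. y ^ (q ^ i) - x ^ (q ^ j)) =
      (\<Prod>i<degree R. \<Prod>j<degree P. (-1) * (x ^ (q ^ j) - y ^ (q ^ i)))" by simp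
  \<comment> \<open>The sign is raised to \<open>degree P * degree R\<close>, an even
    number.\<close>
  also have "\<dots> = (\<Prod>i<degree R. \<Prod>j<degree P. x ^ (q ^ j) - y ^ (q ^ i))"
    using assms(5) by (simp only: prod.distrib) simp
  also have "\<dots> = (\<Prod>j<degree P. \<Prod>i<degree R. x ^ (q ^ j) - y ^ (q ^ i))"
    by (rule prod.swap)
  finally have "of_int (legendre_poly P R) = (of_int (legendre_poly R P) :: 'a alg_closure)"
    using res[OF P x R y] res[OF R y P x] euler_criterion[OF R y, of P] euler_criterion[OF P x, of R]
    by simp
  thus ?thesis using legendre_range by (intro sign_of_int_inj) 
qed

end

section \<open>The Jacobi symbol\<close>

definition expo :: "'a::finite_field poly \<Rightarrow> 'a poly \<Rightarrow> nat" where
  "expo R f = Max {k. R ^ k dvd f}"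

definition prime_divisors :: "'a::finite_field poly \<Rightarrow> 'a poly set" where
  "prime_divisors f = {R. lead_coeff R = 1 \<and> irreducible R \<and> R dvd f}"

lemma jacobi_poly_alt: "jacobi_poly D f = (\<Prod>R\<in>prime_divisors f. legendre_poly D R ^ expo R f)"
  unfolding jacobi_poly_def expo_def prime_divisors_def ..

lemma finite_prime_divisors: "f \<noteq> 0 \<Longrightarrow> finite (prime_divisors f)"
proof (rule finite_subset)
  assume "f \<noteq> 0"
  show "prime_divisors f \<subseteq> (\<Union>n\<le>degree f. monic_polys n)"
    using dvd_imp_degree_le[OF _ \<open>f \<noteq> 0\<close>] by (auto simp: prime_divisors_def monic_polys_def)
qed auto

text \<open>Degrees bound the exponents when \<open>f\<close> is nonzero, so the \<open>Max\<close>
  ranges over a finite nonempty set and is attained.\<close>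

lemma expo_iff:
  fixes R :: "'a::finite_field poly"
  assumes "f \<noteq> 0" "irreducible R"
  shows "R ^ k dvd f \<longleftrightarrow> k \<le> expo R f"
proof -
  have R: "degree R > 0" "R \<noteq> 0" using assms(2) irreducible_degree_pos by auto
  have "{k. R ^ k dvd f} \<subseteq> {..degree f}"
  proof
    fix k assume "k \<in> {k. R ^ k dvd f}"
    hence "degree (R ^ k) \<le> degree f" using dvd_imp_degree_le assms(1) by blast
    hence "degree R * k \<le> degree f" using R by (simp add: degree_power_eq mult.commute)
    moreover have "1 * k \<le> degree R * k" using R(1) by (intro mult_right_mono) auto
    ultimately have "k \<le> degree f" by linarith
    thus "k \<in> {..degree f}" by simp
  qed
  hence fin: "finite {k. R ^ k dvd f}" using finite_subset by blast
  have "0 \<in> {k. R ^ k dvd f}" by simp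
  hence "expo R f \<in> {k. R ^ k dvd f}" unfolding expo_def using Max_in[OF fin] by blast
  hence "R ^ k dvd f" if "k \<le> expo R f" using that le_imp_power_dvd dvd_trans by blast
  moreover have "k \<le> expo R f" if "R ^ k dvd f" unfolding expo_def using Max_ge[OF fin] that by blast
  ultimately show ?thesis by blast
qed

lemma expo_eqI:
  fixes R :: "'a::finite_field poly"
  assumes "f \<noteq> 0" "irreducible R" "\<And>k. R ^ k dvd f \<longleftrightarrow> k \<le> e"
  shows "expo R f = e"
  using expo_iff[OF assms(1,2)] assms(3) by (metis order.antisym order.refl)

lemma monic_irreducible_dvd:
  fixes R S :: "'a::finite_field poly"
  assumes "irreducible R" "irreducible S" "lead_coeff R = 1" "lead_coeff S = 1" "S dvd R"
  shows "S = R"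
proof -
  obtain T where T: "R = S * T" using assms(5) by auto
  have "\<not> S dvd 1" using assms(2) by (auto simp: irreducible_def)
  hence "T dvd 1" using assms(1) T by (auto simp: irreducible_def)
  moreover have "S \<noteq> 0" "T \<noteq> 0" using T assms(1) by auto
  moreover from calculation have "degree T = 0" by (simp add: is_unit_iff_degree)
  ultimately have "degree S = degree R" using T by (simp add: degree_mult_eq)
  thus ?thesis using monic_dvd_degree_eq assms by blast
qed

lemma expo_mult:
  fixes R S :: "'a::finite_field poly"
  assumes "f \<noteq> 0" "irreducible R" "irreducible S" "lead_coeff R = 1" "lead_coeff S = 1"
  shows "expo S (R * f) = expo S f + (if S = R then 1 else 0)"
proof (cases "S = R")
  case True
  show ?thesis
  proof (rule expo_eqI)
    fix k show "S ^ k dvd R * f \<longleftrightarrow> k \<le> expo S f + (if S = R then 1 else 0)"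
    proof (cases k)
      case (Suc j)
      have "R \<noteq> 0" using assms by auto
      hence "R ^ Suc j dvd R * f \<longleftrightarrow> R ^ j dvd f" by simp
      thus ?thesis using expo_iff[OF assms(1,2), of j] True Suc by simp
    qed simp
  qed (use assms in auto)
next
  case False
  have "\<not> S dvd R" using monic_irreducible_dvd[of R S] assms False by blast
  hence "S ^ k dvd R * f \<Longrightarrow> S ^ k dvd f" for k
    using prime_power_dvd_multD[OF field_poly_irreducible_imp_prime[OF assms(3)], of k R f]
    by (cases k) auto
  hence "S ^ k dvd R * f \<longleftrightarrow> S ^ k dvd f" for k by auto
  thus ?thesis using False assms by (intro expo_eqI) (auto simp: expo_iff)
qed

text \<open>Multiplying by \<open>R\<close> raises only the exponent at \<open>R\<close>; if
  \<open>R\<close> did not divide \<open>f\<close>, its factor in the product for \<open>f\<close>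
  is neutral with exponent 0. With \<open>monic_induct\<close> this recursion determines the symbol
  on all monic polynomials.\<close>

lemma jacobi_mult_irreducible:
  fixes R f :: "'a::finite_field poly"
  assumes "f \<noteq> 0" "irreducible R" "lead_coeff R = 1"
  shows "jacobi_poly D (R * f) = legendre_poly D R * jacobi_poly D f"
proof -
  let ?A = "prime_divisors (R * f)"
  have "R \<noteq> 0" using assms by auto
  hence fin: "finite ?A" using assms by (intro finite_prime_divisors) auto
  have RA: "R \<in> ?A" using assms by (auto simp: prime_divisors_def)
  have "jacobi_poly D (R * f) =
      (\<Prod>S\<in>?A. legendre_poly D S ^ expo S f * (if S = R then legendre_poly D S else 1))"
    unfolding jacobi_poly_alt using assms
    by (intro prod.cong) (auto simp: prime_divisors_def expo_mult)
  also have "\<dots> = (\<Prod>S\<in>?A. legendre_poly D S ^ expo S f) * legendre_poly D R"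
    using RA fin by (simp add: prod.distrib)
  also have "(\<Prod>S\<in>?A. legendre_poly D S ^ expo S f) = jacobi_poly D f"
    unfolding jacobi_poly_alt
  proof (rule prod.mono_neutral_right[OF fin])
    show "prime_divisors f \<subseteq> ?A" by (auto simp: prime_divisors_def)
    show "\<forall>S\<in>?A - prime_divisors f. legendre_poly D S ^ expo S f = 1"
    proof
      fix S assume "S \<in> ?A - prime_divisors f"
      hence "irreducible S" "\<not> S dvd f" by (auto simp: prime_divisors_def)
      hence "expo S f = 0" using expo_iff[of f S 1] assms(1) by simp
      thus "legendre_poly D S ^ expo S f = 1" by simp
    qed
  qed
  finally show ?thesis by (simp add: mult.commute)
qed

lemma jacobi_1: "jacobi_poly D (1 :: 'a::finite_field poly) = 1"
proof -
  have "prime_divisors (1 :: 'a poly) = {}" by (auto simp: prime_divisors_def irreducible_def)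
  thus ?thesis by (simp add: jacobi_poly_alt)
qed

lemma ex_monic_irreducible_dvd:
  fixes f :: "'a::field poly"
  assumes "degree f > 0"
  obtains R where "irreducible R" "lead_coeff R = 1" "R dvd f"
proof -
  obtain x where "ev f x = 0" using ev_root_exists assms by blast
  moreover obtain R where "irreducible R" "lead_coeff R = 1" "ev R x = 0" using ex_irreducible_root by blast
  ultimately show ?thesis using that ev_irreducible_eq_0_iff by blast
qed

lemma monic_induct [consumes 1, case_names one mult]:
  fixes f :: "'a::field poly"
  assumes "lead_coeff f = 1" and "Q 1"
    and step: "\<And>R f. irreducible R \<Longrightarrow> lead_coeff R = 1 \<Longrightarrow> lead_coeff f = 1 \<Longrightarrow> Q f \<Longrightarrow> Q (R * f)"
  shows "Q f"
  using assms(1)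
proof (induction "degree f" arbitrary: f rule: less_induct)
  case less
  show ?case
  proof (cases "degree f = 0")
    case True
    then obtain c where "f = [:c:]" by (auto elim: degree_eq_zeroE)
    with less.prems have "f = 1" by simp
    thus ?thesis using assms(2) by simp
  next
    case False
    then obtain R where R: "irreducible R" "lead_coeff R = 1" "R dvd f"
      using ex_monic_irreducible_dvd[of f] by blast
    then obtain g where g: "f = R * g" by auto
    have "f \<noteq> 0" using less.prems by auto
    hence "R \<noteq> 0" "g \<noteq> 0" using g by auto
    hence "degree g < degree f" using g irreducible_degree_pos[OF R(1)] by (simp add: degree_mult_eq)
    moreover have "lead_coeff g = 1" using less.prems g R by (simp add: lead_coeff_mult)
    ultimately show ?thesis using less.hyps step[OF R(1,2)] g by blast
  qed
qed

context odd_finite_field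
begin

lemma jacobi_irreducible:
  fixes P :: "'a poly"
  assumes P: "irreducible P" "lead_coeff P = 1" "even (degree P)" and "lead_coeff f = 1"
  shows "jacobi_poly P f = legendre_poly f P"
  using assms(4)
proof (induction f rule: monic_induct)
  case one
  show ?case using P by (simp add: jacobi_1 legendre_1)
next
  case (mult R f)
  hence "f \<noteq> 0" by auto
  moreover have "legendre_poly P R = legendre_poly R P"
    using quadratic_reciprocity[OF P(1,2) mult(1,2) P(3)] .
  ultimately show ?case
    using mult P by (simp add: jacobi_mult_irreducible legendre_mult)
qed

text \<open>Each irreducible factor \<open>R\<close> contributes the sign
  \<open>(-1) ^ degree R\<close>. Hence the L-function for \<gamma>P is the one for \<open>P\<close>
  with u = q^(-s) replaced by -u.\<close>

lemma jacobi_generator_irreducible: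
  fixes P :: "'a poly"
  assumes P: "irreducible P" "lead_coeff P = 1" "even (degree P)" and "lead_coeff f = 1"
    and \<gamma>: "{\<gamma> ^ k | k :: nat. True} = UNIV - {0 :: 'a}"
  shows "jacobi_poly (smult \<gamma> P) f = (-1) ^ degree f * legendre_poly f P"
  using assms(4)
proof (induction f rule: monic_induct)
  case one
  show ?case using P by (simp add: jacobi_1 legendre_1)
next
  case (mult R f)
  hence nz: "f \<noteq> 0" "R \<noteq> 0" by auto
  have "legendre_poly (smult \<gamma> P) R = legendre_poly [:\<gamma>:] R * legendre_poly P R"
    using legendre_mult[OF mult(1,2), of "[:\<gamma>:]" P] by simp
  also have "\<dots> = (-1) ^ degree R * legendre_poly R P"
    using legendre_generator[OF mult(1,2) \<gamma>] quadratic_reciprocity[OF P(1,2) mult(1,2) P(3)] by simp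
  finally show ?case
    using nz mult P by (simp add: jacobi_mult_irreducible legendre_mult degree_mult_eq power_add)
qed

section \<open>Counting irreducible polynomials\<close>

lemma monic_irreduciblesD:
  assumes "P \<in> monic_irreducibles n"
  shows "irreducible P" "lead_coeff P = 1" "degree P = n" "n > 0"
  using assms irreducible_degree_pos by (auto simp: monic_irreducibles_def monic_polys_def)

lemma card_ev_roots_irreducible:
  fixes P :: "'a poly"
  assumes "P \<in> monic_irreducibles n"
  shows "card {x. ev P x = 0} = n" "{x. ev P x = 0} \<subseteq> fixed n"
proof -
  note P = monic_irreduciblesD[OF assms]
  obtain x where x: "ev P x = 0" using P ev_root_exists by blast
  have "n = card ((\<lambda>i. x ^ (q ^ i)) ` {..<n})"
    using frobenius_inj_on[OF P(1,2) x] P(3) by (simp add: card_image)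
  also have "\<dots> \<le> card {x. ev P x = 0}"
    using P x q_ge_3 by (intro card_mono finite_ev_roots) (auto simp: ev_frobenius)
  finally show "card {x. ev P x = 0} = n" using finite_ev_roots(2)[of P] P by force
  show "{x. ev P x = 0} \<subseteq> fixed n"
    using frobenius_degree[OF P(1,2)] P(3) by (auto simp: fixed_def)
qed

text \<open>Distinct monic irreducibles have no common root, and each of degree \<open>n\<close> has
  exactly \<open>n\<close>. This converts counts of irreducibles into counts of points.\<close>

lemma card_ev_roots_UN:
  fixes A :: "'a poly set"
  assumes "A \<subseteq> monic_irreducibles n"
  shows "card (\<Union>P\<in>A. {x. ev P x = 0}) = n * card A"
proof -
  have fin: "finite A" using assms finite_subset finite_monic_irreducibles by blast
  have "card (\<Union>P\<in>A. {x. ev P x = 0}) = (\<Sum>P\<in>A. card {x. ev P x = 0})"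
  proof (rule card_UN_disjoint[OF fin])
    show "\<forall>P\<in>A. finite {x. ev P x = 0}"
    proof
      fix P assume "P \<in> A"
      hence "irreducible P" using assms monic_irreduciblesD by blast
      thus "finite {x. ev P x = 0}" by (intro finite_ev_roots) auto
    qed
    show "\<forall>P\<in>A. \<forall>R\<in>A. P \<noteq> R \<longrightarrow> {x. ev P x = 0} \<inter> {x. ev R x = 0} = {}"
    proof (intro ballI impI, rule ccontr)
      fix P R assume PR: "P \<in> A" "R \<in> A" "P \<noteq> R" "{x. ev P x = 0} \<inter> {x. ev R x = 0} \<noteq> {}"
      then obtain x where x: "ev P x = 0" "ev R x = 0" by auto
      have P: "irreducible P" "lead_coeff P = 1" and R: "irreducible R" "lead_coeff R = 1"
        using PR assms monic_irreduciblesD by blast+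
      have "P dvd R" using ev_irreducible_eq_0_iff[OF P(1) x(1)] x(2) by blast
      thus False using monic_irreducible_dvd[OF R(1) P(1) R(2) P(2)] PR(3) by blast
    qed
  qed
  also have "\<dots> = (\<Sum>P\<in>A. n)"
    using card_ev_roots_irreducible(1) assms by (intro sum.cong) auto
  finally show ?thesis by simp
qed

lemma card_monic_irreducibles_le:
  assumes "n > 0"
  shows "n * card (monic_irreducibles n :: 'a poly set) \<le> q ^ n"
proof -
  have "(\<Union>P\<in>(monic_irreducibles n :: 'a poly set). {x. ev P x = 0}) \<subseteq> fixed n"
    using card_ev_roots_irreducible(2) by blast
  hence "card (\<Union>P\<in>(monic_irreducibles n :: 'a poly set). {x. ev P x = 0}) \<le> card (fixed n)"
    by (rule card_mono[OF finite_fixed[OF assms]])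
  hence "n * card (monic_irreducibles n :: 'a poly set) \<le> card (fixed n)"
    unfolding card_ev_roots_UN[OF order.refl] .
  thus ?thesis using card_fixed_le[OF assms] by simp
qed

text \<open>The polynomial \<open>X\<^sup>Q - X\<close> with \<open>Q = q\<^sup>N\<close> has no double root because its derivative is \<open>-1\<close>.\<close>

lemma card_fixed:
  assumes "N > 0"
  shows "card (fixed N) = q ^ N"
proof -
  define Q where "Q = q ^ N"
  have Q1: "Q > 1" unfolding Q_def using q_ge_3 assms by (intro one_less_power) auto
  let ?p = "monom 1 Q - monom 1 1 :: 'a alg_closure poly"
  have c: "coeff ?p Q = 1" using Q1 by (auto simp: coeff_monom)
  hence nz: "?p \<noteq> 0" by (metis coeff_0 zero_neq_one)
  have "degree ?p \<le> Q" using Q1 by (intro degree_le) (auto simp: coeff_monom)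
  moreover have "Q \<le> degree ?p" using c by (intro le_degree) auto
  ultimately have deg: "degree ?p = Q" by simp
  have roots: "{x. poly ?p x = 0} = fixed N" by (auto simp: poly_monom fixed_def Q_def)
  have "of_nat Q = (0 :: 'a)" using assms of_nat_q_eq_0 by (simp add: Q_def)
  hence Q0: "of_nat Q = (0 :: 'a alg_closure)" by (metis to_ac_0 to_ac_of_nat)
  obtain A where A: "size A = degree ?p" "?p = smult (lead_coeff ?p) (\<Prod>x\<in>#A. [:-x, 1:])"
    using alg_closed_imp_factorization[OF nz] by blast
  have p: "?p = (\<Prod>x\<in>#A. [:-x, 1:])"
    using A(2) c deg by simp
  have "count A x = 1" if "x \<in># A" for x
  proof (rule ccontr)
    assume "count A x \<noteq> 1"
    moreover have "count A x > 0" using that by simp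
    ultimately have "2 \<le> count A x" by linarith
    hence "{#x, x#} \<subseteq># A" by (simp add: subseteq_mset_def)
    then obtain B where B: "A = {#x, x#} + B" by (metis mset_subset_eq_exists_conv)
    have "poly (pderiv ?p) x = 0"
    proof -
      have *: "poly (pderiv (L * (L * C))) x = 0" if "poly L x = 0" for L C
        by (simp add: pderiv_mult that)
      have "?p = [:-x, 1:] * ([:-x, 1:] * (\<Prod>x\<in>#B. [:-x, 1:]))" unfolding p B by simp
      thus ?thesis using *[of "[:-x, 1:]"] by simp
    qed
    moreover have "pderiv ?p = - 1"
      using Q0 by (simp add: pderiv_diff pderiv_monom monom_0 one_pCons)
    ultimately show False by simp
  qed
  hence "size A = card (set_mset A)" by (simp add: size_multiset_overloaded_eq)
  moreover have "set_mset A = fixed N"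
  proof -
    have "poly (\<Prod>x\<in>#A. [:-x, 1:]) y = 0 \<longleftrightarrow> y \<in># A" for y
      by (induction A) auto
    hence "{y. poly ?p y = 0} = set_mset A" unfolding p by blast
    thus ?thesis using roots by simp
  qed
  ultimately show ?thesis using A(1) deg Q_def by simp
qed

lemma sum_powers_le: "(\<Sum>d=1..m. q ^ d) \<le> 2 * q ^ m"
proof (induction m)
  case (Suc m)
  have "(\<Sum>d=1..Suc m. q ^ d) \<le> 2 * q ^ m + q ^ Suc m" using Suc by simp
  also have "\<dots> \<le> q * q ^ m + q ^ Suc m" using q_ge_3 by (intro add_right_mono mult_right_mono) auto
  finally show ?case by simp
qed simp

text \<open>A point of \<open>fixed N\<close> that is not a root of an irreducible of degree
  \<open>N\<close> has a minimal polynomial whose degree properly divides \<open>N\<close>, so it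
  lies in a subfield \<open>fixed d\<close> with d at most N/2.\<close>

lemma card_monic_irreducibles_ge:
  assumes "N > 0"
  shows "q ^ N \<le> N * card (monic_irreducibles N :: 'a poly set) + 2 * q ^ (N div 2)"
proof -
  let ?I = "monic_irreducibles N :: 'a poly set"
  let ?R = "\<Union>P\<in>?I. {x. ev P x = 0}"
  have "fixed N \<subseteq> ?R \<union> (\<Union>d\<in>{1..N div 2}. fixed d)"
  proof
    fix x assume x: "x \<in> fixed N"
    obtain P :: "'a poly" where P: "irreducible P" "lead_coeff P = 1" "ev P x = 0"
      using ex_irreducible_root by blast
    have d: "degree P dvd N" using x frobenius_degree_mult[OF P] by (simp add: fixed_def)
    show "x \<in> ?R \<union> (\<Union>d\<in>{1..N div 2}. fixed d)"
    proof (cases "degree P = N")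
      case True
      thus ?thesis using P by (auto simp: monic_irreducibles_def monic_polys_def)
    next
      case False
      then obtain k where k: "N = degree P * k" "k \<noteq> 1" using d by auto
      hence "k \<ge> 2" using assms by (cases k) auto
      hence "degree P * 2 \<le> N" unfolding k(1) by (intro mult_left_mono) auto
      moreover have "x \<in> fixed (degree P)" using frobenius_degree[OF P] by (simp add: fixed_def)
      ultimately show ?thesis using irreducible_degree_pos[OF P(1)] by (force intro!: bexI[of _ "degree P"])
    qed
  qed
  moreover have "finite ?R"
    using monic_irreduciblesD by (intro finite_UN_I finite_ev_roots) force+
  moreover have "finite (\<Union>d\<in>{1..N div 2}. fixed d)" using finite_fixed by auto
  ultimately have "card (fixed N) \<le> card (?R \<union> (\<Union>d\<in>{1..N div 2}. fixed d))"
    by (intro card_mono) auto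
  also have "\<dots> \<le> card ?R + card (\<Union>d\<in>{1..N div 2}. fixed d)" by (rule card_Un_le)
  also have "card ?R = N * card ?I" by (rule card_ev_roots_UN) simp
  also have "card (\<Union>d\<in>{1..N div 2}. fixed d) \<le> (\<Sum>d=1..N div 2. card (fixed d))"
    by (intro card_UN_le) simp
  also have "\<dots> \<le> (\<Sum>d=1..N div 2. q ^ d)" by (intro sum_mono card_fixed_le) auto
  also have "\<dots> \<le> 2 * q ^ (N div 2)" by (rule sum_powers_le)
  finally show ?thesis using card_fixed[OF assms] by simp
qed

end

section \<open>Hasse derivatives\<close>

text \<open>This is h(X + Y) as a polynomial in the outer variable Y, with coefficients in X;
  \<open>[:[:0, 1:], 1:]\<close> is X + Y.\<close>

definition taylor :: "'a::comm_ring_1 poly \<Rightarrow> 'a poly poly" where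
  "taylor h = pcompose (map_poly (\<lambda>a. [:a:]) h) [:[:0, 1:], 1:]"

text \<open>Hasse derivatives detect multiplicities beyond the characteristic, where iterated formal
  derivatives vanish identically. Stepanov's method needs multiplicity \<open>q ^ t\<close>.\<close>

definition hasse :: "nat \<Rightarrow> 'a::comm_ring_1 poly \<Rightarrow> 'a poly" where
  "hasse k h = coeff (taylor h) k"

lemma taylor_0 [simp]: "taylor 0 = 0"
  by (simp add: taylor_def)

lemma taylor_pCons: "taylor (pCons a p) = [:[:a:]:] + [:[:0, 1:], 1:] * taylor p"
  by (simp add: taylor_def map_poly_pCons pcompose_pCons)

lemma taylor_add: "taylor (p + r) = taylor p + taylor r"
  by (simp add: taylor_def map_poly_hom_add pcompose_add)

lemma taylor_mult: "taylor (p * r) = taylor p * taylor r"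
  by (simp add: taylor_def map_poly_hom_mult pcompose_mult)

lemma taylor_1 [simp]: "taylor 1 = 1"
  by (simp add: one_pCons taylor_pCons)

lemma taylor_power: "taylor (p ^ n) = taylor p ^ n"
  by (induction n) (simp_all add: taylor_mult)

lemma hasse_0 [simp]: "hasse k 0 = 0"
  by (simp add: hasse_def)

lemma hasse_add: "hasse k (p + r) = hasse k p + hasse k r"
  by (simp add: hasse_def taylor_add)

lemma hasse_diff: "hasse k (p - r) = hasse k p - hasse k r"
  using hasse_add[of k "p - r" r] by (simp add: algebra_simps)

lemma hasse_sum: "hasse k (\<Sum>i\<in>A. f i) = (\<Sum>i\<in>A. hasse k (f i))"
  by (induction A rule: infinite_finite_induct) (simp_all add: hasse_add)

lemma hasse_mult: "hasse k (p * r) = (\<Sum>i\<le>k. hasse i p * hasse (k - i) r)"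
  by (simp add: hasse_def taylor_mult coeff_mult)

lemma hasse_zeroth [simp]: "hasse 0 p = p"
  by (induction p) (simp_all add: hasse_def taylor_pCons)

lemma hasse_Suc_pCons: "hasse (Suc k) (pCons a p) = pCons 0 (hasse (Suc k) p) + hasse k p"
  by (simp add: hasse_def taylor_pCons)

lemma hasse_small:
  fixes p :: "'a::comm_ring_1 poly"
  assumes "p \<in> small n"
  shows "hasse k p \<in> small (n - k)"
  using assms
proof (induction p arbitrary: n k)
  case (pCons a p)
  show ?case
  proof (cases k)
    case (Suc l)
    obtain n' where n': "n = Suc n'" using pCons by (cases n) auto
    have p: "p \<in> small n'" using pCons.prems n' by (auto simp: small_iff split: if_splits)
    have "hasse (Suc l) p \<in> small (n' - Suc l)" "hasse l p \<in> small (n' - l)"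
      using pCons.IH[OF p] by blast+
    moreover from this have "pCons 0 (hasse (Suc l) p) \<in> small (n' - l)"
      by (auto simp: small_iff split: if_splits)
    ultimately show ?thesis using Suc n' by (simp add: hasse_Suc_pCons small_add)
  qed (use pCons in simp)
qed simp

text \<open>By the Leibniz rule each derivative costs at most one factor \<open>f\<close>. For
  \<open>k\<close> beyond \<open>e\<close> the truncated difference makes the claim trivial.\<close>

lemma power_dvd_hasse_power:
  fixes f :: "'a::idom poly"
  shows "f ^ (e - k) dvd hasse k (f ^ e)"
proof (induction e arbitrary: k)
  case (Suc e)
  show ?case unfolding power_Suc hasse_mult
  proof (rule dvd_sum)
    fix i assume i: "i \<in> {..k}"
    show "f ^ (Suc e - k) dvd hasse i f * hasse (k - i) (f ^ e)"
    proof (cases "i = 0")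
      case True
      have "f ^ (Suc e - k) dvd f * f ^ (e - k)"
        unfolding power_Suc[symmetric] by (intro le_imp_power_dvd) auto
      also have "\<dots> dvd f * hasse k (f ^ e)" using Suc by (intro mult_dvd_mono) auto
      finally show ?thesis using True by simp
    next
      case False
      hence "f ^ (Suc e - k) dvd f ^ (e - (k - i))" using i by (intro le_imp_power_dvd) auto
      also have "\<dots> dvd hasse (k - i) (f ^ e)" by (rule Suc.IH)
      finally show ?thesis by simp
    qed
  qed
qed simp

lemma power_dvd_hasse:
  fixes f :: "'a::idom poly"
  shows "f ^ (e - k) dvd hasse k (f ^ e * r)"
  unfolding hasse_mult
proof (rule dvd_sum)
  fix i assume i: "i \<in> {..k}"
  have "f ^ (e - k) dvd f ^ (e - i)" using i by (intro le_imp_power_dvd) auto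
  also have "\<dots> dvd hasse i (f ^ e)" by (rule power_dvd_hasse_power)
  finally show "f ^ (e - k) dvd hasse i (f ^ e) * hasse (k - i) r" by simp
qed

text \<open>Each derivative lowers the degree by 1 and removes one factor \<open>f\<close> fewer,
  for a net gain of \<open>m'\<close> per derivative. The bound is independent of \<open>e\<close>,
  so the multipliers \<open>f ^ M\<close> and \<open>f ^ (M + c)\<close> are treated alike.\<close>

lemma hasse_quotient_small:
  fixes f :: "'a::field poly"
  assumes "f \<noteq> 0" "degree f = Suc m'" "r \<in> small d" "k \<le> e"
  shows "hasse k (f ^ e * r) div f ^ (e - k) \<in> small (d + k * m')"
proof -
  obtain B where B: "hasse k (f ^ e * r) = f ^ (e - k) * B" using power_dvd_hasse by blast
  obtain e' where e': "e = k + e'" using assms(4) le_Suc_ex by blast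
  have "f ^ e \<in> small (Suc (e * Suc m'))" using assms by (simp add: small_iff degree_power_eq)
  hence "f ^ e * r \<in> small (e * Suc m' + d)" using small_mult[OF _ assms(3), of "f ^ e"] by force
  hence "hasse k (f ^ e * r) \<in> small (e * Suc m' + d - k)" by (rule hasse_small)
  hence "B \<in> small (d + k * m')"
    using assms e' unfolding B by (cases "B = 0") (auto simp: small_iff degree_mult_eq degree_power_eq algebra_simps)
  thus ?thesis using B assms(1) by simp
qed

lemma taylor_ev:
  fixes h :: "'a::field poly"
  shows "pcompose (map_poly to_ac h) [:\<theta>, 1:] = map_poly (\<lambda>u. ev u \<theta>) (taylor h)"
proof (induction h)
  case (pCons a p)
  have "map_poly (\<lambda>u. ev u \<theta>) (taylor (pCons a p)) = [:to_ac a:] + [:\<theta>, 1:] * map_poly (\<lambda>u. ev u \<theta>) (taylor p)"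
    unfolding taylor_pCons
    by (subst map_poly_hom_add, simp, simp, subst map_poly_hom_mult) (simp_all add: map_poly_pCons)
  thus ?case using pCons by (simp add: map_poly_pCons pcompose_pCons)
qed simp

lemma pcompose_power_left: "pcompose (p ^ n) r = pcompose p r ^ n" for p :: "'a::comm_ring_1 poly"
  by (induction n) (simp_all add: pcompose_mult pcompose_1)

text \<open>The values of the Hasse derivatives at \<theta> are the Taylor coefficients there.
  Shifting \<theta> to the origin reduces divisibility to the vanishing of the lowest
  coefficients.\<close>

lemma order_ge_of_hasse:
  fixes h :: "'a::field poly"
  assumes "\<And>k. k < M \<Longrightarrow> ev (hasse k h) \<theta> = 0"
  shows "[:- \<theta>, 1:] ^ M dvd map_poly to_ac h"
proof -
  let ?H = "map_poly to_ac h"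
  have "coeff (pcompose ?H [:\<theta>, 1:]) k = 0" if "k < M" for k
    using assms[OF that] by (simp add: taylor_ev coeff_map_poly hasse_def)
  hence "monom 1 M dvd pcompose ?H [:\<theta>, 1:]" by (simp add: monom_1_dvd_iff')
  then obtain G where G: "pcompose ?H [:\<theta>, 1:] = monom 1 M * G" by auto
  have "?H = pcompose (pcompose ?H [:\<theta>, 1:]) [:- \<theta>, 1:]"
    by (simp add: pcompose_pCons pcompose_idR flip: pcompose_assoc)
  also have "\<dots> = [:- \<theta>, 1:] ^ M * pcompose G [:- \<theta>, 1:]"
    by (simp add: G pcompose_mult monom_altdef pcompose_power_left pcompose_pCons)
  finally show ?thesis by simp
qed

lemma card_multiple_roots:
  fixes H :: "'b::field poly"
  assumes "finite \<Theta>" "H \<noteq> 0" "M > 0" "\<And>\<theta>. \<theta> \<in> \<Theta> \<Longrightarrow> [:- \<theta>, 1:] ^ M dvd H"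
  shows "M * card \<Theta> \<le> degree H"
proof -
  have "(\<Prod>\<theta>\<in>\<Theta>. [:- \<theta>, 1:] ^ M) dvd H"
    using assms(1,4)
  proof (induction \<Theta> rule: finite_induct)
    case (insert \<theta> \<Theta>)
    then obtain u where u: "H = (\<Prod>\<theta>\<in>\<Theta>. [:- \<theta>, 1:] ^ M) * u" by auto
    have "poly (\<Prod>\<theta>\<in>\<Theta>. [:- \<theta>, 1:] ^ M) \<theta> \<noteq> 0"
      using insert by (auto simp: poly_prod)
    hence "\<not> [:- \<theta>, 1:] dvd (\<Prod>\<theta>\<in>\<Theta>. [:- \<theta>, 1:] ^ M)" by (simp add: poly_eq_0_iff_dvd)
    moreover have "[:- \<theta>, 1:] ^ M dvd (\<Prod>\<theta>\<in>\<Theta>. [:- \<theta>, 1:] ^ M) * u"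
      using insert.prems[of \<theta>] u by simp
    moreover have "prime_elem [:- \<theta>, 1:]" by (rule prime_elem_linear_field_poly) simp
    ultimately have "[:- \<theta>, 1:] ^ M dvd u"
      using prime_power_dvd_multD assms(3) by blast
    thus ?case using insert u by (simp add: mult.commute mult_dvd_mono)
  qed simp
  hence "degree (\<Prod>\<theta>\<in>\<Theta>. [:- \<theta>, 1:] ^ M) \<le> degree H" using assms(2) dvd_imp_degree_le by blast
  moreover have "degree (\<Prod>\<theta>\<in>\<Theta>. [:- \<theta>, 1:] ^ M) = (\<Sum>\<theta>\<in>\<Theta>. M)"
    by (subst degree_prod_sum_eq) (auto simp: degree_power_eq)
  ultimately show ?thesis by (simp add: mult.commute)
qed

section \<open>Stepanov's method\<close>

text \<open>The polynomial ring is integrally closed: irreducible factors of the denominator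
  \<open>r\<close> also divide \<open>s\<close> and cancel, until \<open>r\<close> is
  constant.\<close>

lemma monic_square_of_ratio:
  fixes f r s :: "'a::field poly"
  assumes "lead_coeff f = 1" "f * r\<^sup>2 = s\<^sup>2" "r \<noteq> 0"
  shows "\<exists>h. f = h\<^sup>2"
  using assms(2,3)
proof (induction "degree r" arbitrary: r s rule: less_induct)
  case less
  show ?case
  proof (cases "degree r = 0")
    case True
    then obtain c where c: "r = [:c:]" by (auto elim: degree_eq_zeroE)
    hence c0: "c \<noteq> 0" using less by auto
    have "(smult (inverse c) s)\<^sup>2 = smult ((inverse c)\<^sup>2) (f * r\<^sup>2)"
      unfolding less.prems(1) by (simp add: power2_eq_square)
    also have "\<dots> = f" using c c0 by (simp add: power2_eq_square field_simps)
    finally show ?thesis by metis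
  next
    case False
    then obtain P where P: "irreducible P" "P dvd r" using ex_monic_irreducible_dvd[of r] by blast
    have pr: "prime_elem P" using P(1) by (rule field_poly_irreducible_imp_prime)
    obtain r' where r': "r = P * r'" using P(2) by auto
    have "P dvd s\<^sup>2" using less.prems(1) P(2) by (metis dvd_mult dvd_power dvd_trans pos2)
    hence "P dvd s" using pr by (simp add: prime_elem_dvd_power)
    then obtain s' where s': "s = P * s'" by auto
    have nz: "P \<noteq> 0" "r' \<noteq> 0" using less.prems(2) r' by auto
    have "P\<^sup>2 * (f * r'\<^sup>2) = P\<^sup>2 * s'\<^sup>2"
      using less.prems(1) unfolding r' s' by (simp add: power_mult_distrib ac_simps)
    hence "f * r'\<^sup>2 = s'\<^sup>2" using nz by simp
    moreover have "degree r' < degree r"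
      using nz r' irreducible_degree_pos[OF P(1)] by (simp add: degree_mult_eq)
    ultimately show ?thesis using less.hyps nz by blast
  qed
qed

text \<open>Coefficients of degree below \<open>n\<close> are digits in base X^n, and the expansion
  of 0 in this base is unique.\<close>

lemma poly_small_eq_0:
  fixes W :: "'a::field poly poly"
  assumes "\<And>i. coeff W i \<in> small n" "poly W (monom 1 n) = 0"
  shows "W = 0"
  using assms
proof (induction W)
  case (pCons w W)
  have w: "w \<in> small n" using pCons.prems(1)[of 0] by simp
  have eq: "w + monom 1 n * poly W (monom 1 n) = 0" using pCons.prems(2) by simp
  have "w = 0"
  proof (rule ccontr)
    assume "w \<noteq> 0"
    moreover have "monom 1 n dvd w"
      using eq by (metis add.commute add_eq_0_iff dvd_minus_iff dvd_triv_left minus_minus)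
    ultimately have "n \<le> degree w" using dvd_imp_degree_le by (force simp: degree_monom_eq)
    thus False using w \<open>w \<noteq> 0\<close> by (simp add: small_iff)
  qed
  moreover from this eq have "poly W (monom 1 n) = 0" by simp
  moreover have "coeff W i \<in> small n" for i using pCons.prems(1)[of "Suc i"] by simp
  ultimately show ?case using pCons.IH by simp
qed simp

lemma coeff_mult_small:
  fixes R S :: "'a::field poly poly"
  assumes "\<And>i. coeff R i \<in> small m" "\<And>i. coeff S i \<in> small n"
  shows "coeff (R * S) i \<in> small (m + n - 1)"
  unfolding coeff_mult using assms by (intro small_sum small_mult) auto

context odd_finite_field
begin

lemma poly_frobenius:
  fixes f :: "'a poly"
  shows "f ^ (q ^ N) = poly (map_poly (\<lambda>a. [:a:]) f) (monom 1 (q ^ N))"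
proof (induction f)
  case 0
  thus ?case using q_ge_3 by simp
next
  case (pCons a f)
  have "pCons a f ^ (q ^ N) = ([:a:] + [:0, 1:] * f) ^ (q ^ N)" by simp
  also have "\<dots> = [:a:] ^ (q ^ N) + [:0, 1:] ^ (q ^ N) * f ^ (q ^ N)"
    by (subst frobenius_add) (simp_all add: power_mult_distrib del: mult_pCons_left)
  also have "[:a:] ^ (q ^ N) = [:a:]" by (simp add: poly_const_pow power_q_eq)
  finally show ?case using pCons by (simp add: map_poly_pCons monom_altdef)
qed

text \<open>
  The nonvanishing step: since \<open>f(X)\<^sup>Q = f(X\<^sup>Q)\<close>, squaring the relation gives an identity between
  polynomials in \<open>X\<close> and \<open>Y = X\<^sup>Q\<close> of \<open>X\<close>-degree below \<open>Q\<close>, which therefore holds in two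
  independent variables. Comparing leading coefficients in \<open>Y\<close> shows that \<open>f\<close> is a square.
\<close>

lemma stepanov_nonzero:
  fixes f :: "'a poly" and R S :: "'a poly poly"
  assumes f: "lead_coeff f = 1" "\<nexists>h. f = h\<^sup>2"
    and Q: "Q = q ^ N" "2 * c + 1 = Q" and d: "degree f + 2 * d \<le> Q + 1" "d > 0"
    and RS: "\<And>i. coeff R i \<in> small d" "\<And>i. coeff S i \<in> small d" "R \<noteq> 0 \<or> S \<noteq> 0"
  shows "poly R (monom 1 Q) + f ^ c * poly S (monom 1 Q) \<noteq> 0"
proof
  assume "poly R (monom 1 Q) + f ^ c * poly S (monom 1 Q) = 0"
  hence "poly R (monom 1 Q) = - (f ^ c * poly S (monom 1 Q))" by (simp add: eq_neg_iff_add_eq_0)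
  hence "f * (poly R (monom 1 Q))\<^sup>2 = f ^ (2 * c + 1) * (poly S (monom 1 Q))\<^sup>2"
    by (simp add: power2_eq_square power_mult ac_simps)
  also have "\<dots> = poly (map_poly (\<lambda>a. [:a:]) f) (monom 1 Q) * (poly S (monom 1 Q))\<^sup>2"
    unfolding Q(2) using poly_frobenius[of f N] Q(1) by simp
  finally have eq: "f * (poly R (monom 1 Q))\<^sup>2 =
      poly (map_poly (\<lambda>a. [:a:]) f) (monom 1 Q) * (poly S (monom 1 Q))\<^sup>2" .
  define F where "F = map_poly (\<lambda>a. [:a:]) f"
  have F: "lead_coeff F = 1" using f(1) by (simp add: F_def coeff_map_poly degree_map_poly one_pCons)
  define W where "W = [:f:] * R\<^sup>2 - F * S\<^sup>2"
  have "poly W (monom 1 Q) = 0" using eq by (simp add: W_def F_def)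
  moreover have "coeff W i \<in> small Q" for i
  proof -
    have "coeff (R\<^sup>2) i \<in> small (2 * d - 1)" "coeff (S\<^sup>2) i \<in> small (2 * d - 1)" for i
      using coeff_mult_small[OF RS(1) RS(1), of i] coeff_mult_small[OF RS(2) RS(2), of i]
      by (simp_all add: power2_eq_square mult_2)
    moreover have "coeff [:f:] i \<in> small (Suc (degree f))" for i
      by (cases i) (simp_all add: in_small_degree)
    moreover have "coeff F i \<in> small 1" for i by (simp add: F_def coeff_map_poly small_iff)
    \<comment> \<open>The larger bound equals \<open>degree f + 2 * d - 1\<close>, which the
      hypothesis on \<open>d\<close> keeps at most \<open>Q\<close>.\<close>
    ultimately have "coeff ([:f:] * R\<^sup>2) i \<in> small (Suc (degree f) + (2 * d - 1) - 1)"
      and "coeff (F * S\<^sup>2) i \<in> small (1 + (2 * d - 1) - 1)"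
      by (intro coeff_mult_small; blast)+
    hence "coeff ([:f:] * R\<^sup>2) i \<in> small Q" "coeff (F * S\<^sup>2) i \<in> small Q"
      using d by (auto elim!: small_mono)
    thus ?thesis unfolding W_def coeff_diff by (rule small_diff)
  qed
  ultimately have "W = 0" by (intro poly_small_eq_0[of W Q])
  hence eq2: "[:f:] * R\<^sup>2 = F * S\<^sup>2" by (simp add: W_def)
  hence lc: "f * (lead_coeff R)\<^sup>2 = (lead_coeff S)\<^sup>2"
  proof -
    have "lead_coeff ([:f:] * R\<^sup>2) = lead_coeff (F * S\<^sup>2)" by (simp only: eq2)
    hence "lead_coeff [:f:] * (lead_coeff R)\<^sup>2 = lead_coeff F * (lead_coeff S)\<^sup>2"
      by (simp only: lead_coeff_mult lead_coeff_power)
    thus ?thesis using F by simp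
  qed
  have "R \<noteq> 0"
  proof
    assume "R = 0"
    hence "S = 0" using eq2 F by auto
    thus False using RS(3) \<open>R = 0\<close> by simp
  qed
  hence "lead_coeff R \<noteq> 0" by simp
  thus False using monic_square_of_ratio[OF f(1) lc] f(2) by blast
qed

text \<open>With Q = q^N one has (X + Y)^Q = X^Q + Y^Q, so below order Q the power X^Q behaves like
  a constant under Hasse derivatives.\<close>

lemma hasse_mult_monom_power:
  fixes u :: "'a poly"
  assumes "k < q ^ N"
  shows "hasse k (u * monom 1 (q ^ N) ^ j) = hasse k u * monom 1 (q ^ N) ^ j"
proof (induction j)
  case (Suc j)
  let ?Q = "q ^ N"
  have "taylor [:0, 1 :: 'a:] = [:[:0, 1:]:] + monom 1 1"
    by (simp add: taylor_pCons one_pCons monom_altdef)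
  hence "taylor (monom 1 ?Q :: 'a poly) = ([:[:0, 1:]:] + monom 1 1) ^ ?Q"
    by (simp add: monom_altdef taylor_power)
  also have "\<dots> = [:monom 1 ?Q:] + monom 1 ?Q"
    by (subst frobenius_add) (simp_all add: monom_power poly_const_pow monom_altdef)
  finally have t: "taylor (monom 1 ?Q :: 'a poly) = [:monom 1 ?Q:] + monom 1 ?Q" .
  have "hasse k (v * monom 1 ?Q) = hasse k v * monom 1 ?Q" for v :: "'a poly"
  proof -
    have "coeff (taylor v * monom 1 ?Q) k = 0"
      using assms by (simp add: mult.commute[of _ "monom _ _"] coeff_monom_mult)
    thus ?thesis by (simp add: hasse_def taylor_mult t distrib_left)
  qed
  from this[of "u * monom 1 ?Q ^ j"] Suc show ?case by (simp add: ac_simps)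
qed simp

lemma poly_comp_sum:
  fixes R :: "'a poly poly"
  assumes "R \<in> coeffs_in C J"
  shows "poly R z = (\<Sum>j<J. coeff R j * z ^ j)"
proof -
  have "poly R z = (\<Sum>j\<le>degree R. coeff R j * z ^ j)" by (rule poly_altdef)
  also have "\<dots> = (\<Sum>j\<in>{j. coeff R j \<noteq> 0}. coeff R j * z ^ j)"
    by (rule sum.mono_neutral_right) (auto intro: le_degree)
  also have "\<dots> = (\<Sum>j<J. coeff R j * z ^ j)"
    using assms by (intro sum.mono_neutral_left) (auto simp: coeffs_in_def not_less[symmetric])
  finally show ?thesis .
qed

text \<open>The left side counts the coefficients of all \<open>T k\<close>, the right side those of
  the pair (R, S). About \<open>M * d\<close> conditions against \<open>2 * d * J\<close> unknowns
  force \<open>J\<close> slightly above M/2, and the extra m + 2 in \<open>J\<close> pays for the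
  lower terms. Doubling both sides, the terms 2dM cancel, and the surplus is at least (m + 3) M^2 -
  (m + 4) M - m (2m + 3), positive for m \<le> M and M \<ge> 9.\<close>

lemma stepanov_parameters:
  fixes M m d h J :: nat
  assumes "M = 2 * h + 1" "J = h + Suc m' + 2" "m = Suc m'" "m \<le> M" "M \<ge> 9" "M\<^sup>2 \<le> 2 * d + m"
  shows "(\<Sum>k<M. d + k * m' + J) < 2 * (d * J)"
proof -
  have s: "2 * (\<Sum>k<n. d + k * m' + J) + n * m' = n * (2 * d + 2 * J) + m' * n\<^sup>2" for n
    by (induction n) (simp_all add: algebra_simps power2_eq_square)
  have "2 * int (\<Sum>k<M. d + k * m' + J) + int M * int m' = int M * (2 * int d + 2 * int J) + int m' * (int M)\<^sup>2"
    using arg_cong[OF s[of M], of int] by (simp only: of_nat_add of_nat_mult of_nat_power of_nat_numeral)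
  moreover have J: "2 * int J = int M + 2 * int m + 3" using assms by simp
  moreover have m': "int m' = int m - 1" using assms by simp
  moreover have "2 * int d * (2 * int m + 3) \<ge> ((int M)\<^sup>2 - int m) * (2 * int m + 3)"
  proof (rule mult_right_mono)
    have "int (M\<^sup>2) \<le> int (2 * d + m)" using assms(6) by (simp only: of_nat_le_iff)
    thus "(int M)\<^sup>2 - int m \<le> 2 * int d" by simp
  qed simp
  moreover have "int M * int M * (int m + 3) > (int m + 4) * int M + int m * (2 * int m + 3)"
  proof -
    have "int m * (2 * int m + 3) \<le> int M * (2 * int m + 3)" using assms by (intro mult_right_mono) auto
    hence "(int m + 4) * int M + int m * (2 * int m + 3) \<le> int M * (3 * int m + 7)"
      by (simp add: algebra_simps)
    also have "\<dots> < int M * (9 * (int m + 3))" using assms by (intro mult_strict_left_mono) auto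
    also have "\<dots> \<le> int M * (int M * (int m + 3))" using assms by (intro mult_left_mono mult_right_mono) auto
    finally show ?thesis by (simp add: mult.assoc)
  qed
  ultimately have "2 * int (\<Sum>k<M. d + k * m' + J) < 2 * (2 * int d * int J)"
  proof -
    assume A: "2 * int (\<Sum>k<M. d + k * m' + J) + int M * int m' = int M * (2 * int d + 2 * int J) + int m' * (int M)\<^sup>2"
      and B: "2 * int d * (2 * int m + 3) \<ge> ((int M)\<^sup>2 - int m) * (2 * int m + 3)"
      and C: "int M * int M * (int m + 3) > (int m + 4) * int M + int m * (2 * int m + 3)"
    have "2 * (2 * int d * int J) = 2 * int d * (int M + 2 * int m + 3)" using J by simp
    also have "\<dots> = 2 * int d * int M + 2 * int d * (2 * int m + 3)" by (simp add: algebra_simps)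
    finally have 1: "2 * (2 * int d * int J) = 2 * int d * int M + 2 * int d * (2 * int m + 3)" .
    have "2 * int (\<Sum>k<M. d + k * m' + J) = int M * (2 * int d + (int M + 2 * int m + 3)) + (int m - 1) * (int M)\<^sup>2
        - int M * (int m - 1)" using A J m' by simp
    thus ?thesis using 1 B C by (simp add: algebra_simps power2_eq_square)
  qed
  hence "int (\<Sum>k<M. d + k * m' + J) < int (2 * (d * J))"
    by (simp add: ac_simps del: of_nat_sum of_nat_add)
  thus ?thesis by (simp only: of_nat_less_iff)
qed

text \<open>
  At a point \<open>\<theta>\<close> with \<open>\<theta>\<^sup>Q = \<theta>\<close> and \<open>f(\<theta>)\<^sup>c = \<alpha>\<close>, the \<open>k\<close>-th Hasse derivative of
  \<open>f\<^sup>M (R(X, X\<^sup>Q) + f\<^sup>c S(X, X\<^sup>Q))\<close> takes the value \<open>f(\<theta>)\<^bsup>M-k\<^esup> T\<^sub>k(\<theta>)\<close>, where \<open>T\<^sub>k\<close> has low degree and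
  is linear in \<open>(R, S)\<close>. There are more pairs \<open>(R, S)\<close> than tuples \<open>(T\<^sub>k)\<close>, so the difference of two
  pairs with the same tuple makes all \<open>T\<^sub>k\<close> vanish.
\<close>

lemma stepanov_polynomial:
  fixes f :: "'a poly" and \<alpha> :: 'a
  assumes f: "lead_coeff f = 1" "\<nexists>h. f = h\<^sup>2" "degree f = m" "1 \<le> m" "m \<le> M"
    and M: "M = q ^ t" "t > 0" "M \<ge> 9" and \<alpha>: "\<alpha>\<^sup>2 = 1"
    and Q: "Q = M\<^sup>2" "Q = 2 * c + 1"
    and d: "m + 2 * d \<le> Q + 1" "Q \<le> 2 * d + m" and h: "M = 2 * h + 1"
  shows "\<exists>H. H \<noteq> 0 \<and> degree H < (M + c) * m + d + (h + m + 1) * Q \<and>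
           (\<forall>\<theta>. \<theta> \<in> fixed (2 * t) \<longrightarrow> ev f \<theta> = 0 \<or> ev f \<theta> ^ c = to_ac \<alpha> \<longrightarrow>
              (\<forall>k<M. ev (hasse k H) \<theta> = 0))"
proof -
  obtain m' where m': "m = Suc m'" using f(4) by (cases m) auto
  define J where "J = h + Suc m' + 2"
  define \<theta>0 where "\<theta>0 = (monom 1 Q :: 'a poly)"
  have f0: "f \<noteq> 0" using f(1) by auto
  have QN: "Q = q ^ (2 * t)" using Q(1) M(1) by (simp add: power_mult mult.commute)
  have "9 * M \<le> Q" unfolding Q(1) power2_eq_square using M(3) by (intro mult_right_mono) auto
  hence MQ: "M \<le> Q" "m + 2 \<le> Q" using M(3) f(5) by linarith+
  hence d0: "d > 0" using d(2) by (cases d) auto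
  define quo where "quo e k r = hasse k (f ^ e * r) div f ^ (e - k)" for e k and r :: "'a poly"
  have quo: "hasse k (f ^ e * r) = f ^ (e - k) * quo e k r" for e k r
    using power_dvd_hasse[of f e k r] unfolding quo_def by simp
  have quo_diff: "quo e k (r - s) = quo e k r - quo e k s" for e k r s
    by (simp add: quo_def right_diff_distrib hasse_diff poly_div_diff_left)
  \<comment> \<open>Replacing \<open>\<theta>0\<close> by X and \<open>f ^ c\<close> by \<alpha>
    changes no value at the points of interest but removes the high degree, so few coefficients have
    to be killed.\<close>
  define T where "T k RS = (\<Sum>j<J. (quo M k (coeff (fst RS) j) + smult \<alpha> (quo (M + c) k (coeff (snd RS) j))) * monom 1 j)"
    for k and RS :: "'a poly poly \<times> 'a poly poly"
  define PS where "PS = coeffs_in (small d :: 'a poly set) J"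
  have PS: "finite PS" "card PS = (q ^ d) ^ J"
    using card_coeffs_in[of "small d :: 'a poly set" J] by (simp_all add: PS_def card_small q_def)
  have PS_coeff: "coeff R j \<in> small d" if "R \<in> PS" for R j using that by (simp add: PS_def coeffs_in_def)
  define tgt where "tgt = Pi\<^sub>E {..<M} (\<lambda>k. small (d + k * m' + J) :: 'a poly set)"
  have fin_tgt: "finite tgt" unfolding tgt_def by (intro finite_PiE) auto
  have "card tgt = (\<Prod>k<M. q ^ (d + k * m' + J))"
    unfolding tgt_def by (subst card_PiE) (simp_all add: card_small q_def)
  also have "\<dots> = q ^ (\<Sum>k<M. d + k * m' + J)" by (rule power_sum[symmetric])
  \<comment> \<open>The pigeonhole inequality: more pairs than possible tuples.\<close>
  also have "\<dots> < q ^ (2 * (d * J))"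
    using stepanov_parameters[OF h J_def m' f(5) M(3)] Q d q_ge_3
    by (intro power_strict_increasing) auto
  also have "\<dots> = card (PS \<times> PS)"
    by (simp add: card_cartesian_product PS power_mult[symmetric] power_add[symmetric] mult_2)
  finally have card_lt: "card tgt < card (PS \<times> PS)" .
  define \<Phi> where "\<Phi> RS = restrict (\<lambda>k. T k RS) {..<M}" for RS
  have T_small: "T k (R, S) \<in> small (d + k * m' + J)" if "R \<in> PS" "S \<in> PS" "k < M" for R S k
  proof -
    have "(quo M k (coeff R j) + smult \<alpha> (quo (M + c) k (coeff S j))) * monom 1 j \<in> small (d + k * m' + J)"
      if "j < J" for j
    proof -
      have "quo M k (coeff R j) \<in> small (d + k * m')" "quo (M + c) k (coeff S j) \<in> small (d + k * m')"
        unfolding quo_def using \<open>R \<in> PS\<close> \<open>S \<in> PS\<close> \<open>k < M\<close> f0 f(3) m'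
        by (auto intro!: hasse_quotient_small PS_coeff)
      hence "quo M k (coeff R j) + smult \<alpha> (quo (M + c) k (coeff S j)) \<in> small (d + k * m')"
        by (intro small_add small_smult)
      moreover have "monom 1 j \<in> (small J :: 'a poly set)" using that by (simp add: small_iff degree_monom_eq)
      ultimately have "(quo M k (coeff R j) + smult \<alpha> (quo (M + c) k (coeff S j))) * monom 1 j
          \<in> small (d + k * m' + J - 1)" by (rule small_mult)
      thus ?thesis by (rule small_mono) simp
    qed
    thus ?thesis unfolding T_def by (intro small_sum) simp
  qed
  have "\<Phi> ` (PS \<times> PS) \<subseteq> tgt" using T_small by (auto simp: \<Phi>_def tgt_def intro!: PiE_I split: if_splits)
  hence "\<not> inj_on \<Phi> (PS \<times> PS)" using card_lt fin_tgt card_inj_on_le by (metis not_less)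
  then obtain R1 S1 R2 S2 where RS: "R1 \<in> PS" "S1 \<in> PS" "R2 \<in> PS" "S2 \<in> PS"
    "(R1, S1) \<noteq> (R2, S2)" "\<Phi> (R1, S1) = \<Phi> (R2, S2)" unfolding inj_on_def by blast
  define R where "R = R1 - R2"
  define S where "S = S1 - S2"
  have nz: "R \<noteq> 0 \<or> S \<noteq> 0" using RS(5) by (auto simp: R_def S_def)
  have mem: "R \<in> PS" "S \<in> PS"
    using RS by (auto simp: R_def S_def PS_def coeffs_in_def intro: small_diff[unfolded coeffs_in_def])
  have T0: "T k (R, S) = 0" if "k < M" for k
  proof -
    have "T k (R1, S1) = T k (R2, S2)" using fun_cong[OF RS(6), of k] that by (simp add: \<Phi>_def)
    moreover have "T k (R, S) = T k (R1, S1) - T k (R2, S2)"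
      unfolding T_def sum_subtractf[symmetric]
      by (intro sum.cong) (simp_all add: R_def S_def quo_diff smult_diff_right algebra_simps)
    ultimately show ?thesis by simp
  qed
  \<comment> \<open>The extra factor \<open>f ^ M\<close> leaves a positive power of
    \<open>f\<close> in every derivative of order below \<open>M\<close>; this makes the low-degree
    quotients \<open>quo\<close> possible and also covers the zeros of \<open>f\<close>.\<close>
  define H where "H = f ^ M * poly R \<theta>0 + f ^ (M + c) * poly S \<theta>0"
  have "poly R \<theta>0 + f ^ c * poly S \<theta>0 \<noteq> 0"
    unfolding \<theta>0_def
    using f(1,2) QN Q(2)[symmetric] _ d0 PS_coeff[OF mem(1)] PS_coeff[OF mem(2)] nz
    by (rule stepanov_nonzero) (use d(1) f(3) in simp)
  moreover have "H = f ^ M * (poly R \<theta>0 + f ^ c * poly S \<theta>0)"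
    by (simp add: H_def power_add algebra_simps)
  ultimately have H0: "H \<noteq> 0" using f0 by simp
  have comp: "poly U \<theta>0 = (\<Sum>j<J. coeff U j * \<theta>0 ^ j)" if "U \<in> PS" for U
    using that unfolding PS_def by (rule poly_comp_sum)
  have comp_small: "f ^ e * poly U \<theta>0 \<in> small (e * m + d + (J - 1) * Q)" if "U \<in> PS" for e U
  proof -
    have "poly U \<theta>0 \<in> small (d + (J - 1) * Q)" unfolding comp[OF that]
    proof (rule small_sum)
      fix j assume "j \<in> {..<J}"
      hence j: "j * Q \<le> (J - 1) * Q" by (intro mult_right_mono) auto
      have "\<theta>0 ^ j \<in> small (Suc (j * Q))"
        by (simp add: \<theta>0_def monom_power small_iff degree_monom_eq mult.commute)
      from small_mult[OF PS_coeff[OF that] this, of j]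
      show "coeff U j * \<theta>0 ^ j \<in> small (d + (J - 1) * Q)"
        by (rule small_mono) (use j in simp)
    qed
    moreover have "f ^ e \<in> small (Suc (e * m))" using f0 f(3) by (simp add: small_iff degree_power_eq)
    ultimately have "f ^ e * poly U \<theta>0 \<in> small (Suc (e * m) + (d + (J - 1) * Q) - 1)"
      by (intro small_mult)
    thus ?thesis by (simp add: add.assoc)
  qed
  have "f ^ M * poly R \<theta>0 \<in> small ((M + c) * m + d + (J - 1) * Q)"
    using comp_small[OF mem(1), of M] by (rule small_mono) (simp add: add_mult_distrib)
  hence "H \<in> small ((M + c) * m + d + (J - 1) * Q)"
    unfolding H_def using comp_small[OF mem(2), of "M + c"] by (rule small_add)
  hence degH: "degree H < (M + c) * m + d + (h + m + 1) * Q"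
    using H0 by (simp add: small_iff J_def m')
  have "ev (hasse k H) \<theta> = 0"
    if \<theta>: "\<theta> \<in> fixed (2 * t)" "ev f \<theta> = 0 \<or> ev f \<theta> ^ c = to_ac \<alpha>" "k < M" for \<theta> k
  proof -
    have \<theta>Q: "ev \<theta>0 \<theta> = \<theta>" using \<theta>(1) by (simp add: \<theta>0_def fixed_def QN)
    have k: "k < q ^ (2 * t)" using \<theta>(3) MQ QN by simp
    have hs: "hasse k (f ^ e * poly U \<theta>0) = (\<Sum>j<J. f ^ (e - k) * quo e k (coeff U j) * \<theta>0 ^ j)"
      if "U \<in> PS" for e U
    proof -
      have "f ^ e * poly U \<theta>0 = (\<Sum>j<J. (f ^ e * coeff U j) * \<theta>0 ^ j)"
        by (simp add: comp[OF that] sum_distrib_left mult.assoc)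
      hence "hasse k (f ^ e * poly U \<theta>0) = (\<Sum>j<J. hasse k (f ^ e * coeff U j) * \<theta>0 ^ j)"
        by (simp only: hasse_sum \<theta>0_def QN hasse_mult_monom_power[OF k])
      thus ?thesis by (simp only: quo)
    qed
    have "ev (hasse k H) \<theta> = (\<Sum>j<J. ev f \<theta> ^ (M - k) * ev (quo M k (coeff R j)) \<theta> * \<theta> ^ j)
        + (\<Sum>j<J. ev f \<theta> ^ (M + c - k) * ev (quo (M + c) k (coeff S j)) \<theta> * \<theta> ^ j)"
      by (simp add: H_def hasse_add hs[OF mem(1)] hs[OF mem(2)] ev_sum \<theta>Q)
    also have "\<dots> = ev f \<theta> ^ (M - k) * ev (T k (R, S)) \<theta>"
    proof (cases "ev f \<theta> = 0")
      case True
      thus ?thesis using \<theta>(3) by (simp add: power_0_left)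
    next
      case False
      hence "ev f \<theta> ^ (M + c - k) = ev f \<theta> ^ (M - k) * to_ac \<alpha>"
      proof -
        have "M + c - k = (M - k) + c" using \<theta>(3) by simp
        thus ?thesis using \<theta>(2) False by (simp only: power_add) simp
      qed
      thus ?thesis
        by (simp add: T_def ev_sum sum_distrib_left algebra_simps flip: sum.distrib)
    qed
    finally show ?thesis using T0[OF \<theta>(3)] by simp
  qed
  thus ?thesis using H0 degH by blast
qed

text \<open>All points are zeros of multiplicity \<open>M\<close> of one nonzero polynomial, so
  \<open>M\<close> times their number is at most its degree. The dominant term h Q of that degree is
  about M^3 / 2, which yields M^2 / 2 points; every other term contributes O(m M).\<close>

lemma stepanov_points:
  fixes f :: "'a poly" and \<alpha> :: 'a
  assumes f: "lead_coeff f = 1" "\<nexists>h. f = h\<^sup>2" "degree f = m" "1 \<le> m" "m \<le> M"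
    and M: "M = q ^ t" "t > 0" "M \<ge> 9" and \<alpha>: "\<alpha>\<^sup>2 = 1"
  shows "2 * card {\<theta> \<in> fixed (2 * t). ev f \<theta> = 0 \<or> ev f \<theta> ^ ((M\<^sup>2 - 1) div 2) = to_ac \<alpha>}
           \<le> M\<^sup>2 + 7 * m * M"
proof -
  define Q where "Q = M\<^sup>2"
  define c where "c = (Q - 1) div 2"
  have "odd M" using odd_q M by simp
  then obtain h where h: "M = 2 * h + 1" by (rule oddE)
  have "odd Q" using \<open>odd M\<close> by (simp add: Q_def)
  hence c: "Q = 2 * c + 1" by (auto simp: c_def elim!: oddE)
  \<comment> \<open>The largest value compatible with the degree condition of the nonvanishing
    step.\<close>
  define d where "d = (Q + 1 - m) div 2"
  have "9 * M \<le> Q" unfolding Q_def power2_eq_square using M(3) by (intro mult_right_mono) auto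
  hence mQ: "m \<le> Q" using f(5) by linarith
  have d: "m + 2 * d \<le> Q + 1" "Q \<le> 2 * d + m" using mQ by (auto simp: d_def)
  obtain H where H: "H \<noteq> 0" "degree H < (M + c) * m + d + (h + m + 1) * Q"
    "\<And>\<theta> k. \<theta> \<in> fixed (2 * t) \<Longrightarrow> ev f \<theta> = 0 \<or> ev f \<theta> ^ c = to_ac \<alpha> \<Longrightarrow> k < M \<Longrightarrow> ev (hasse k H) \<theta> = 0"
    using stepanov_polynomial[OF f M \<alpha> Q_def c d h] by blast
  define \<Theta> where "\<Theta> = {\<theta> \<in> fixed (2 * t). ev f \<theta> = 0 \<or> ev f \<theta> ^ c = to_ac \<alpha>}"
  have "finite \<Theta>" using finite_fixed[of "2 * t"] M(2) by (simp add: \<Theta>_def)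
  hence "M * card \<Theta> \<le> degree (map_poly to_ac H)"
    using H M(3) by (intro card_multiple_roots order_ge_of_hasse) (auto simp: \<Theta>_def)
  hence "M * card \<Theta> < (M + c) * m + d + (h + m + 1) * Q" using H(2) by simp
  hence "2 * (M * card \<Theta>) < 2 * M * m + (2 * c) * m + 2 * d + (2 * h + 2 * m + 2) * Q"
    by (simp add: algebra_simps)
  also have "\<dots> \<le> 2 * M * m + Q * m + Q + (M + 2 * m + 1) * Q"
  proof -
    have "(2 * c) * m \<le> Q * m" using c by (intro mult_right_mono) auto
    moreover have "2 * d \<le> Q" using d(1) f(4) by simp
    moreover have "(2 * h + 2 * m + 2) * Q = (M + 2 * m + 1) * Q" using h by simp
    ultimately show ?thesis by linarith
  qed
  also have "\<dots> = M * (2 * m + M * (3 * m + 2) + M\<^sup>2)"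
    by (simp add: Q_def power2_eq_square algebra_simps)
  finally have "M * (2 * card \<Theta>) < M * (2 * m + M * (3 * m + 2) + M\<^sup>2)"
    by (simp add: algebra_simps)
  hence "2 * card \<Theta> < 2 * m + M * (3 * m + 2) + M\<^sup>2" by simp
  also have "\<dots> \<le> M\<^sup>2 + 7 * m * M"
  proof -
    have "m \<le> m * M" "M \<le> m * M" using M(3) f(4) by auto
    hence "2 * m + 3 * (m * M) + 2 * M \<le> 7 * (m * M)" by linarith
    thus ?thesis by (simp add: algebra_simps)
  qed
  finally show ?thesis by (simp add: \<Theta>_def c_def Q_def)
qed

text \<open>Stepanov's method gives only upper bounds, but it applies to both signs, and the count
  of all irreducibles turns the bound for one sign into a lower bound for the other. The condition
  on \<open>degree f\<close> excludes the value 0. With the notation of the proof, N times the sum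
  is at most 7mM + 2M, hence at most 9NM because m < N. The condition \<open>t \<ge> 2\<close>
  provides M \<ge> 9.\<close>

theorem character_sum_bound:
  fixes f :: "'a poly"
  assumes f: "lead_coeff f = 1" "\<nexists>h. f = h\<^sup>2" "degree f < 2 * t" and t: "t \<ge> 2"
  shows "\<bar>\<Sum>P\<in>monic_irreducibles (2 * t). legendre_poly f P\<bar> \<le> 9 * q ^ t"
proof -
  define M where "M = q ^ t"
  define m where "m = degree f"
  define N where "N = 2 * t"
  let ?I = "monic_irreducibles N :: 'a poly set"
  have "q ^ 2 \<le> M" using t q_ge_3 unfolding M_def by (intro power_increasing) auto
  moreover have "3 ^ 2 \<le> q ^ 2" using q_ge_3 by (intro power_mono) auto
  ultimately have M9: "M \<ge> 9" by simp
  have "2 * t \<le> q ^ t"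
  proof -
    have "2 * k \<le> 3 ^ k" for k :: nat
    proof (induction k)
      case (Suc k)
      define x :: nat where "x = 3 ^ k"
      have "2 * k \<le> x" "1 \<le> x" using Suc by (simp_all add: x_def)
      thus ?case by (simp flip: x_def)
    qed simp
    moreover have "3 ^ t \<le> q ^ t" using q_ge_3 by (intro power_mono) auto
    ultimately show ?thesis using order.trans by blast
  qed
  hence mM: "m \<le> M" using f(3) by (simp add: m_def M_def)
  have m1: "1 \<le> m"
  proof (rule ccontr)
    assume "\<not> 1 \<le> m"
    hence "degree f = 0" by (simp add: m_def)
    then obtain c where "f = [:c:]" by (rule degree_eq_zeroE)
    with f(1) have "f = 1\<^sup>2" by simp
    thus False using f(2) by blast
  qed
  define A where "A s = {P \<in> ?I. legendre_poly f P = s}" for s :: int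
  have bound: "2 * (N * card (A s)) \<le> M\<^sup>2 + 7 * m * M" if s: "s = 1 \<or> s = -1" for s
  proof -
    have s2: "(of_int s :: 'a)\<^sup>2 = 1" using s by auto
    have "N * card (A s) = card (\<Union>P\<in>A s. {x. ev P x = 0})"
      by (rule card_ev_roots_UN[symmetric]) (auto simp: A_def)
    also have "\<dots> \<le> card {\<theta> \<in> fixed (2 * t). ev f \<theta> = 0 \<or> ev f \<theta> ^ ((M\<^sup>2 - 1) div 2) = to_ac (of_int s :: 'a)}"
    proof (rule card_mono)
      show "finite {\<theta> \<in> fixed (2 * t). ev f \<theta> = 0 \<or> ev f \<theta> ^ ((M\<^sup>2 - 1) div 2) = to_ac (of_int s)}"
        using finite_fixed[of "2 * t"] t by simp
      show "(\<Union>P\<in>A s. {x. ev P x = 0}) \<subseteq> {\<theta> \<in> fixed (2 * t). ev f \<theta> = 0 \<or> ev f \<theta> ^ ((M\<^sup>2 - 1) div 2) = to_ac (of_int s)}"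
      proof clarify
        fix P x assume P: "P \<in> A s" and x: "ev P x = 0"
        hence PI: "P \<in> monic_irreducibles N" and l: "legendre_poly f P = s" by (auto simp: A_def)
        note PD = monic_irreduciblesD[OF PI]
        have "x \<in> fixed N" using card_ev_roots_irreducible(2)[OF PI] x by auto
        moreover have "ev f x ^ ((M\<^sup>2 - 1) div 2) = of_int s"
          using euler_criterion[OF PD(1,2) x, of f] l PD(3) by (simp add: M_def N_def power_mult mult.commute)
        ultimately show "x \<in> fixed (2 * t) \<and> (ev f x = 0 \<or> ev f x ^ ((M\<^sup>2 - 1) div 2) = to_ac (of_int s))"
          by (simp add: N_def)
      qed
    qed
    finally show ?thesis
      using stepanov_points[OF f(1,2) m_def[symmetric] m1 mM M_def _ M9 s2] t by simp
  qed
  have ne0: "legendre_poly f P \<noteq> 0" if "P \<in> ?I" for P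
  proof
    assume "legendre_poly f P = 0"
    hence "P dvd f" by (simp add: legendre_eq_0_iff)
    moreover have "f \<noteq> 0" using f(1) by auto
    ultimately have "degree P \<le> degree f" by (rule dvd_imp_degree_le)
    thus False using monic_irreduciblesD(3)[OF that] f(3) by (simp add: N_def)
  qed
  have range: "legendre_poly f P = 1 \<or> legendre_poly f P = -1" if "P \<in> ?I" for P
    using ne0[OF that] legendre_range[of f P] by auto
  have un: "?I = A 1 \<union> A (-1)" "A 1 \<inter> A (-1) = {}" using range by (auto simp: A_def)
  have fin: "finite (A s)" for s by (simp add: A_def)
  have cardI: "card ?I = card (A 1) + card (A (-1))" using un fin by (metis card_Un_disjoint)
  have "(\<Sum>P\<in>?I. legendre_poly f P) = (\<Sum>P\<in>A 1. legendre_poly f P) + (\<Sum>P\<in>A (-1). legendre_poly f P)"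
    unfolding un(1) using fin un(2) by (intro sum.union_disjoint) auto
  also have "\<dots> = (\<Sum>P\<in>A 1. 1) + (\<Sum>P\<in>A (-1). -1)" by (simp add: A_def)
  finally have S: "(\<Sum>P\<in>?I. legendre_poly f P) = int (card (A 1)) - int (card (A (-1)))" by simp
  have "M\<^sup>2 \<le> N * card ?I + 2 * M"
    using card_monic_irreducibles_ge[of N] t by (simp add: N_def M_def power_mult mult.commute)
  hence low: "int M ^ 2 \<le> int N * int (card (A 1)) + int N * int (card (A (-1))) + 2 * int M"
    unfolding cardI by (simp flip: of_nat_mult of_nat_add of_nat_power add: distrib_left)
  have up: "2 * (int N * int (card (A s))) \<le> int M ^ 2 + 7 * int m * int M" if "s = 1 \<or> s = -1" for s
  proof -
    have "int (2 * (N * card (A s))) \<le> int (M\<^sup>2 + 7 * m * M)"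
      using bound[OF that] by (simp only: of_nat_le_iff)
    thus ?thesis by simp
  qed
  have mN: "int m * int M \<le> int N * int M" using f(3) by (intro mult_right_mono) (auto simp: m_def N_def)
  have M1: "int M \<le> int N * int M"
    using t mult_right_mono[of 1 "int N" "int M"] by (simp add: N_def)
  have "int N * (int (card (A 1)) - int (card (A (-1)))) \<le> int N * (9 * int M)"
    using low up[of 1] mN M1 by (simp add: right_diff_distrib)
  moreover have "int N * (int (card (A (-1))) - int (card (A 1))) \<le> int N * (9 * int M)"
    using low up[of "-1"] mN M1 by (simp add: right_diff_distrib)
  moreover have "int N > 0" using t by (simp add: N_def)
  ultimately have "\<bar>int (card (A 1)) - int (card (A (-1)))\<bar> \<le> 9 * int M" by (simp add: abs_le_iff)
  thus ?thesis using S by (simp add: M_def N_def)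
qed

end

section \<open>The functional equation\<close>

locale even_character = odd_finite_field field_type q
  for field_type :: "'a::finite_field itself" and q :: nat +
  fixes P :: "'a poly" and g N :: nat
  assumes P_mem: "P \<in> monic_irreducibles N" and N_def: "N = 2 * g + 2"
begin

lemmas P = monic_irreduciblesD[OF P_mem]

abbreviation chi :: "'a poly \<Rightarrow> int" where "chi f \<equiv> legendre_poly f P"

lemma chi_mult: "chi (f * h) = chi f * chi h"
  by (rule legendre_mult[OF P(1,2)])

lemma mod_P_small: "f mod P \<in> small N"
proof -
  have "P \<noteq> 0" using P(1) by auto
  thus ?thesis using P(3) degree_mod_less[of P f] by (auto simp: small_iff)
qed

lemma mod_P_eq: "f \<in> small N \<Longrightarrow> f mod P = f"
  using P by (auto simp: small_iff mod_poly_less)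

lemma bij_betw_small_N:
  assumes "\<And>x y. P dvd F x - F y \<Longrightarrow> P dvd x - y"
  shows "bij_betw (\<lambda>x. F x mod P) (small N) (small N)"
proof -
  have "inj_on (\<lambda>x. F x mod P) (small N)"
  proof (rule inj_onI)
    fix x y assume xy: "x \<in> small N" "y \<in> small N" "F x mod P = F y mod P"
    hence "x mod P = y mod P" using assms by (simp add: poly_mod_eq_iff)
    thus "x = y" using xy mod_P_eq by simp
  qed
  moreover have "(\<lambda>x. F x mod P) ` small N \<subseteq> small N" using mod_P_small by auto
  ultimately show ?thesis using endo_inj_surj[OF finite_small] by (simp add: bij_betw_def)
qed

lemma bij_mult:
  assumes "\<not> P dvd f"
  shows "bij_betw (\<lambda>h. (f * h) mod P) (small N) (small N)"
proof (rule bij_betw_small_N)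
  fix x y assume "P dvd f * x - f * y"
  hence "P dvd f * (x - y)" by (simp add: right_diff_distrib)
  thus "P dvd x - y"
    using assms prime_elem_dvd_mult_iff[OF field_poly_irreducible_imp_prime[OF P(1)]] by blast
qed

text \<open>Without a nonresidue, Euler's criterion would make all \<open>q ^ N - 1\<close> nonzero
  residues roots of an equation of half that degree.\<close>

lemma ex_nonresidue: "\<exists>f. chi f = -1"
proof (rule ccontr)
  assume no: "\<nexists>f. chi f = -1"
  obtain x where x: "ev P x = 0" using P ev_root_exists by blast
  define c where "c = (q ^ N - 1) div 2"
  have c: "c > 0" "2 * c = q ^ N - 1"
    using half_exponent_pos[OF P(4)] two_half_exponent[of N] by (simp_all add: c_def)
  have 1: "y ^ c = 1" if y: "y \<in> fixed N - {0}" for y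
  proof -
    obtain f where f: "y = ev f x" using residue_field(2)[OF P(1,2) x] y P(3) by blast
    hence "\<not> P dvd f" using y ev_irreducible_eq_0_iff[OF P(1) x] by auto
    hence "chi f = 1" using no legendre_range[of f P] legendre_eq_0_iff[of f P] by auto
    thus ?thesis using euler_criterion[OF P(1,2) x, of f] f P(3) by (simp add: c_def)
  qed
  have "card (fixed N - {0}) \<le> card {y :: 'a alg_closure. y ^ c = 1}"
    using 1 by (intro card_mono card_roots_of_unity c) auto
  also have "\<dots> \<le> c" by (rule card_roots_of_unity[OF c(1)])
  finally have "card (fixed N - {0}) \<le> c" .
  moreover have "0 \<in> fixed N" using q_ge_3 by (simp add: fixed_def)
  ultimately have "q ^ N - 1 \<le> c" using card_fixed[OF P(4)] by simp
  thus False using c by simp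
qed

lemma sum_chi_residues: "(\<Sum>h\<in>small N. chi h) = 0"
proof -
  obtain f where f: "chi f = -1" using ex_nonresidue by blast
  hence "\<not> P dvd f" using legendre_eq_0_iff[of f P] by simp
  hence "(\<Sum>h\<in>small N. chi h) = (\<Sum>h\<in>small N. chi ((f * h) mod P))"
    by (rule sum.reindex_bij_betw[OF bij_mult, symmetric])
  also have "\<dots> = - (\<Sum>h\<in>small N. chi h)"
    by (simp add: legendre_mod chi_mult f sum_negf)
  finally show ?thesis by simp
qed

text \<open>
  \<open>lam\<close> is the residue functional on \<open>A/P\<close>. As \<open>chi\<close> is trivial on constants, averaging the usual
  additive character over \<open>F\<^sub>q\<^sup>*\<close> replaces it by the integer-valued function \<open>phi\<close> in the Gauss sum.
\<close>

definition lam :: "'a poly \<Rightarrow> 'a" where "lam h = coeff (h mod P) (N - 1)"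

definition phi :: "'a poly \<Rightarrow> int" where "phi h = (if lam h = 0 then int q else 0) - 1"

definition gauss :: int where "gauss = (\<Sum>h\<in>small N. chi h * phi h)"

text \<open>All polynomials of degree below \<open>k\<close>, not just monic ones, because they form
  a vector space, on which orthogonality relations hold. Evenness of the character later reduces
  \<open>W\<close> to monic sums.\<close>

definition W :: "nat \<Rightarrow> int" where "W k = (\<Sum>f\<in>small k. chi f)"

lemma lam_small: "h \<in> small N \<Longrightarrow> lam h = coeff h (N - 1)"
  by (simp add: lam_def mod_P_eq)

lemma lam_add: "lam (f + h) = lam f + lam h"
  by (simp add: lam_def poly_mod_add_left)

lemma lam_diff: "lam (f - h) = lam f - lam h"
  by (simp add: lam_def poly_mod_diff_left)

lemma lam_smult: "lam (smult c f) = c * lam f"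
  by (simp add: lam_def mod_smult_left)

lemma gauss_twist: "(\<Sum>h\<in>small N. chi h * phi (f * h)) = chi f * gauss"
proof (cases "P dvd f")
  case True
  have "lam (f * h) = 0" for h
  proof -
    have "P dvd f * h" using True by simp
    hence "(f * h) mod P = 0" by (simp only: dvd_eq_mod_eq_0)
    thus ?thesis by (simp add: lam_def)
  qed
  hence "(\<Sum>h\<in>small N. chi h * phi (f * h)) = (\<Sum>h\<in>small N. chi h) * (int q - 1)"
    by (simp add: phi_def sum_distrib_right)
  thus ?thesis using True sum_chi_residues by (simp add: legendre_poly_def)
next
  case False
  have c2: "chi f * chi f = 1" using False legendre_range[of f P] legendre_eq_0_iff[of f P] by auto
  have "gauss = (\<Sum>h\<in>small N. chi ((f * h) mod P) * phi ((f * h) mod P))"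
    unfolding gauss_def using False by (rule sum.reindex_bij_betw[OF bij_mult, symmetric])
  also have "\<dots> = (\<Sum>h\<in>small N. chi f * (chi h * phi (f * h)))"
    by (simp add: legendre_mod chi_mult phi_def lam_def mult.assoc)
  finally have "chi f * gauss = chi f * chi f * (\<Sum>h\<in>small N. chi h * phi (f * h))"
    by (simp add: sum_distrib_left mult.assoc)
  thus ?thesis using c2 by simp
qed

text \<open>Under the pairing (f, h) to \<open>lam (f * h)\<close> the orthogonal complement of
  \<open>small k\<close> is \<open>small (N - k)\<close>. For \<open>h\<close> outside it, the
  linear functional on \<open>small k\<close> is onto, its fibres have equal size, and the values of
  \<open>phi\<close> cancel.\<close>

lemma sum_phi:
  assumes "k \<le> N" "h \<in> small N"
  shows "(\<Sum>f\<in>small k. phi (f * h)) = (if h \<in> small (N - k) then (int q - 1) * int q ^ k else 0)"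
proof (cases "h \<in> small (N - k)")
  case True
  have "lam (f * h) = 0" if "f \<in> small k" for f
  proof -
    have "f * h \<in> small (N - 1)" using small_mult[OF that True] assms(1) by simp
    moreover from this have "f * h \<in> small N" by (rule small_mono) simp
    ultimately show ?thesis by (simp add: lam_small) (auto simp: coeffs_in_def)
  qed
  hence "(\<Sum>f\<in>small k. phi (f * h)) = (\<Sum>f\<in>(small k :: 'a poly set). int q - 1)"
    by (intro sum.cong) (auto simp: phi_def)
  thus ?thesis using True by (simp add: card_small q_def)
next
  case False
  define e where "e = degree h"
  have h0: "h \<noteq> 0" and e: "N - k \<le> e" "e < N" using False assms(2) by (auto simp: small_iff e_def)
  \<comment> \<open>Chosen so that \<open>f0 * h\<close> is monic of degree \<open>N - 1\<close>,
    which makes the functional take the value 1.\<close>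
  define f0 where "f0 = monom (inverse (lead_coeff h)) (N - 1 - e)"
  have f0: "f0 \<in> small k" using e assms(1) h0 by (auto simp: f0_def small_iff degree_monom_eq)
  have "f0 * h \<in> small N"
    using h0 e by (simp add: f0_def small_iff degree_mult_eq degree_monom_eq e_def)
  moreover have "coeff (f0 * h) (N - 1) = 1"
    using h0 e by (simp add: f0_def coeff_monom_mult e_def)
  ultimately have lam0: "lam (f0 * h) = 1" by (simp add: lam_small)
  define Z where "Z c = {f \<in> small k. lam (f * h) = c}" for c
  have "card (Z c) = card (Z 0)" for c
  proof (rule bij_betw_same_card[OF bij_betw_byWitness[where f' = "\<lambda>f. f + smult c f0"]])
    show "(\<lambda>f. f + smult (- c) f0) ` Z c \<subseteq> Z 0" "(\<lambda>f. f + smult c f0) ` Z 0 \<subseteq> Z c"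
      using f0 lam0 by (auto simp: Z_def distrib_right left_diff_distrib lam_add lam_diff lam_smult intro!: small_add small_diff small_smult)
  qed auto
  moreover have "card (small k :: 'a poly set) = (\<Sum>c\<in>UNIV. card (Z c))"
  proof -
    have "(\<Union>c\<in>UNIV. Z c) = small k" by (auto simp: Z_def)
    moreover have "card (\<Union>c\<in>UNIV. Z c) = (\<Sum>c\<in>UNIV. card (Z c))"
      by (rule card_UN_disjoint) (auto simp: Z_def)
    ultimately show ?thesis by simp
  qed
  moreover from calculation(1) have "(\<Sum>c\<in>UNIV. card (Z c)) = (\<Sum>c\<in>(UNIV :: 'a set). card (Z 0))"
    by (intro sum.cong refl)
  ultimately have "q ^ k = q * card (Z 0)" by (simp add: card_small q_def)
  hence Z: "int q ^ k = int q * int (card (Z 0))" by (metis of_nat_mult of_nat_power)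
  have "(\<Sum>f\<in>small k. phi (f * h)) = (\<Sum>f\<in>small k. if lam (f * h) = 0 then int q else 0) - int (card (small k :: 'a poly set))"
    by (simp add: phi_def sum_subtractf)
  also have "(\<Sum>f\<in>small k. if lam (f * h) = 0 then int q else 0) = (\<Sum>f\<in>Z 0. int q)"
    unfolding Z_def by (simp add: sum.If_cases Int_def conj_commute)
  finally show ?thesis using False Z by (simp add: card_small q_def)
qed

text \<open>Poisson summation: expand the character by \<open>gauss_twist\<close>, exchange the
  sums, and use that \<open>small (N - k)\<close> is the annihilator of
  \<open>small k\<close>.\<close>

lemma gauss_duality:
  assumes "k \<le> N"
  shows "gauss * W k = (int q - 1) * int q ^ k * W (N - k)"
proof -
  have "gauss * W k = (\<Sum>f\<in>small k. \<Sum>h\<in>small N. chi h * phi (f * h))"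
    by (simp add: W_def sum_distrib_left gauss_twist mult.commute)
  also have "\<dots> = (\<Sum>h\<in>small N. \<Sum>f\<in>small k. chi h * phi (f * h))" by (rule sum.swap)
  also have "\<dots> = (\<Sum>h\<in>small N. if h \<in> small (N - k) then (int q - 1) * int q ^ k * chi h else 0)"
    by (intro sum.cong refl) (simp add: sum_phi[OF assms] flip: sum_distrib_left)
  also have "\<dots> = (\<Sum>h\<in>small (N - k). (int q - 1) * int q ^ k * chi h)"
  proof -
    have "{h \<in> small N. h \<in> small (N - k)} = (small (N - k) :: 'a poly set)"
      by (auto intro: small_mono)
    thus ?thesis by (simp flip: sum.inter_filter)
  qed
  finally show ?thesis by (simp add: W_def sum_distrib_left)
qed

lemma chi_smult: "c \<noteq> 0 \<Longrightarrow> chi (smult c f) = chi f"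
  using chi_mult[of "[:c:]" f] legendre_const[OF P(1,2), of c] P(3) by (simp add: N_def)

definition A :: "nat \<Rightarrow> int" where "A n = (\<Sum>f\<in>monic_polys n. chi f)"

lemma chi_0: "chi 0 = 0"
  by (simp add: legendre_poly_def)

lemma W_Suc: "W (Suc n) = W n + (int q - 1) * A n"
proof -
  let ?M = "(\<lambda>(c, f). smult c f) ` ((UNIV - {0}) \<times> monic_polys n) :: 'a poly set"
  have un: "small (Suc n) = small n \<union> ?M"
  proof
    show "small (Suc n) \<subseteq> small n \<union> ?M"
    proof
      fix f :: "'a poly" assume f: "f \<in> small (Suc n)"
      show "f \<in> small n \<union> ?M"
      proof (cases "f \<in> small n")
        case False
        hence "f \<noteq> 0" "degree f = n" using f by (auto simp: small_iff)
        hence "f = (\<lambda>(c, f). smult c f) (lead_coeff f, smult (inverse (lead_coeff f)) f)"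
          and "(lead_coeff f, smult (inverse (lead_coeff f)) f) \<in> (UNIV - {0}) \<times> monic_polys n"
          by (auto simp: monic_polys_def)
        thus ?thesis by blast
      qed simp
    qed
    show "small n \<union> ?M \<subseteq> small (Suc n)" by (auto simp: small_iff monic_polys_def)
  qed
  have disj: "small n \<inter> ?M = {}" by (auto simp: small_iff monic_polys_def split: if_splits)
  have inj: "inj_on (\<lambda>(c, f). smult c f) ((UNIV - {0 :: 'a}) \<times> monic_polys n)"
  proof (rule inj_onI)
    fix x y :: "'a \<times> 'a poly"
    assume xy: "x \<in> (UNIV - {0}) \<times> monic_polys n" "y \<in> (UNIV - {0}) \<times> monic_polys n"
      "(\<lambda>(c, f). smult c f) x = (\<lambda>(c, f). smult c f) y"
    obtain c f d h where cf: "x = (c, f)" "y = (d, h)" by (cases x, cases y)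
    have *: "c \<noteq> 0" "d \<noteq> 0" "f \<in> monic_polys n" "h \<in> monic_polys n" "smult c f = smult d h"
      using xy by (simp_all add: cf)
    have "c * coeff f n = d * coeff h n" using *(5) by (metis coeff_smult)
    moreover have "coeff f n = 1" "coeff h n = 1" using * by (auto simp: monic_polys_def)
    ultimately have "c = d" by simp
    moreover from this have "smult c (f - h) = 0" using *(5) by (simp add: smult_diff_right)
    ultimately show "x = y" using *(1) by (simp add: cf)
  qed
  have "W (Suc n) = W n + (\<Sum>f\<in>?M. chi f)"
    unfolding W_def un by (rule sum.union_disjoint) (auto simp: disj)
  also have "(\<Sum>f\<in>?M. chi f) = (\<Sum>(c, f)\<in>(UNIV - {0 :: 'a}) \<times> monic_polys n. chi (smult c f))"
    by (subst sum.reindex[OF inj]) (simp add: case_prod_unfold)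
  also have "\<dots> = (\<Sum>(c, f)\<in>(UNIV - {0 :: 'a}) \<times> monic_polys n. chi f)"
    by (intro sum.cong refl) (simp add: case_prod_unfold mem_Times_iff chi_smult)
  also have "\<dots> = int (card (UNIV - {0 :: 'a})) * A n"
    by (simp add: A_def sum.cartesian_product[symmetric])
  also have "int (card (UNIV - {0 :: 'a})) = int q - 1"
    using q_ge_3 by (simp add: q_def of_nat_diff)
  finally show ?thesis .
qed

text \<open>These are the coefficients of L(u)/(1 - u). Evenness of the character gives L a trivial
  zero at u = 1, which is \<open>a_top\<close>, and the functional equation is clean for the
  quotient.\<close>

definition a :: "nat \<Rightarrow> int" where "a n = (\<Sum>j\<le>n. A j)"

lemma W_Suc_eq: "W (Suc n) = (int q - 1) * a n"
proof (induction n)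
  case 0
  show ?case using W_Suc[of 0] by (simp add: W_def chi_0 a_def)
next
  case (Suc n)
  thus ?case using W_Suc[of "Suc n"] by (simp add: a_def distrib_left)
qed

lemma a_0: "a 0 = 1"
proof -
  have "monic_polys 0 = {1 :: 'a poly}"
    by (auto simp: monic_polys_def elim!: degree_eq_zeroE)
  thus ?thesis using legendre_1[OF P(1)] by (simp add: a_def A_def)
qed

text \<open>Duality applied twice returns to \<open>W 1\<close>, which equals \<open>q - 1\<close>
  and can be cancelled.\<close>

lemma gauss_square: "gauss\<^sup>2 = ((int q - 1) * int q ^ (g + 1))\<^sup>2"
proof -
  have "gauss\<^sup>2 * W 1 = gauss * ((int q - 1) * int q * W (N - 1))"
    using gauss_duality[of 1] P(4) by (simp add: power2_eq_square mult.assoc)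
  also have "\<dots> = (int q - 1) * int q * (gauss * W (N - 1))" by (simp add: ac_simps)
  also have "gauss * W (N - 1) = (int q - 1) * int q ^ (N - 1) * W 1"
    using gauss_duality[of "N - 1"] P(4) by simp
  also have "(int q - 1) * int q * ((int q - 1) * int q ^ (N - 1) * W 1) =
      ((int q - 1) * int q ^ (g + 1))\<^sup>2 * W 1"
  proof -
    have "N - 1 = g + g + 1" by (simp add: N_def)
    thus ?thesis by (simp add: power2_eq_square power_add ac_simps)
  qed
  finally show ?thesis using W_Suc_eq[of 0] a_0 q_ge_3 by simp
qed

text \<open>\<open>small k\<close> is invariant under translation by \<open>small N\<close>, a
  complete residue system, over which the character sums to 0.\<close>

lemma W_ge_N: "k \<ge> N \<Longrightarrow> W k = 0"
proof -
  assume k: "k \<ge> N"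
  have inner: "(\<Sum>s\<in>small N. chi (f + s)) = 0" for f
  proof -
    have "bij_betw (\<lambda>s. (f + s) mod P) (small N) (small N)" by (rule bij_betw_small_N) simp
    hence "(\<Sum>s\<in>small N. chi ((f + s) mod P)) = (\<Sum>s\<in>small N. chi s)" by (rule sum.reindex_bij_betw)
    thus ?thesis by (simp add: legendre_mod sum_chi_residues)
  qed
  have "(\<Sum>f\<in>small k. chi (f + s)) = W k" if "s \<in> small N" for s
  proof -
    have s: "s \<in> small k" using that k by (rule small_mono)
    show ?thesis unfolding W_def
      by (rule sum.reindex_bij_witness[of _ "\<lambda>f. f - s" "\<lambda>f. f + s"]) (auto intro: small_add small_diff s)
  qed
  hence "int (card (small N :: 'a poly set)) * W k = (\<Sum>s\<in>small N. \<Sum>f\<in>small k. chi (f + s))" by simp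
  also have "\<dots> = (\<Sum>f\<in>small k. \<Sum>s\<in>small N. chi (f + s))" by (rule sum.swap)
  also have "\<dots> = 0" by (simp add: inner)
  finally show ?thesis using q_ge_3 by (simp add: card_small q_def)
qed

lemma A_ge_N: "n \<ge> N \<Longrightarrow> A n = 0"
  using W_Suc[of n] W_ge_N[of n] W_ge_N[of "Suc n"] q_ge_3 by simp

lemma a_top: "a (2 * g + 1) = 0"
  using W_Suc_eq[of "2 * g + 1"] W_ge_N[of N] q_ge_3 by (simp add: N_def)

text \<open>Duality at k = n + 1 pairs \<open>a n\<close> with \<open>a (2 * g - n)\<close>, since N
  - (n + 1) = (2g - n) + 1. The sign \<epsilon> of the Gauss sum stays undetermined and disappears
  on squaring.\<close>

lemma functional_equation:
  obtains \<epsilon> :: int where "\<epsilon>\<^sup>2 = 1" "\<And>n. n \<le> 2 * g \<Longrightarrow> \<epsilon> * int q ^ g * a n = int q ^ n * a (2 * g - n)"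
proof -
  have "gauss = (int q - 1) * int q ^ (g + 1) \<or> gauss = - ((int q - 1) * int q ^ (g + 1))"
    using gauss_square by (simp only: power2_eq_iff)
  hence "\<exists>\<epsilon> :: int. \<epsilon>\<^sup>2 = 1 \<and> gauss = \<epsilon> * ((int q - 1) * int q ^ (g + 1))"
  proof
    assume "gauss = (int q - 1) * int q ^ (g + 1)"
    thus ?thesis by (intro exI[of _ 1]) simp
  next
    assume "gauss = - ((int q - 1) * int q ^ (g + 1))"
    thus ?thesis by (intro exI[of _ "-1"]) simp
  qed
  then obtain \<epsilon> :: int where \<epsilon>: "\<epsilon>\<^sup>2 = 1" "gauss = \<epsilon> * ((int q - 1) * int q ^ (g + 1))"
    by blast
  have "\<epsilon> * int q ^ g * a n = int q ^ n * a (2 * g - n)" if n: "n \<le> 2 * g" for n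
  proof -
    define c where "c = (int q - 1) * (int q - 1) * int q"
    have c: "c \<noteq> 0" using q_ge_3 by (simp add: c_def)
    have "N - Suc n = Suc (2 * g - n)" using n by (simp add: N_def)
    hence "gauss * ((int q - 1) * a n) = (int q - 1) * int q ^ Suc n * ((int q - 1) * a (2 * g - n))"
      using gauss_duality[of "Suc n"] n by (simp add: W_Suc_eq N_def)
    hence "c * (\<epsilon> * int q ^ g * a n) = c * (int q ^ n * a (2 * g - n))"
      by (simp add: \<epsilon>(2) c_def ac_simps)
    thus ?thesis using c by simp
  qed
  thus ?thesis using that \<epsilon>(1) by blast
qed

end

section \<open>Summation identities behind the formula for the square of L\<close>

lemma sum_partial_sums:
  fixes A :: "nat \<Rightarrow> real"
  shows "(\<Sum>n\<le>Suc m. A n * u ^ n) = (1 - u) * (\<Sum>n\<le>m. (\<Sum>j\<le>n. A j) * u ^ n) + (\<Sum>j\<le>Suc m. A j) * u ^ Suc m"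
  by (induction m) (simp_all add: algebra_simps)

text \<open>Partial sums arise by multiplying the generating function by 1/(1 - x), so the square of
  the result carries the factor 1/(1 - x)^2, with coefficients n + 1.\<close>

lemma convolution_partial_sums:
  fixes A :: "nat \<Rightarrow> real"
  shows "(\<Sum>i\<le>n. (\<Sum>j\<le>i. A j) * (\<Sum>j\<le>n - i. A j)) = (\<Sum>j\<le>n. real (n + 1 - j) * (\<Sum>i\<le>j. A i * A (j - i)))"
proof -
  define F E where "F = Abs_fps A" and "E = Abs_fps (\<lambda>_. 1 :: real)"
  have nth1: "fps_nth (F * E) n = (\<Sum>j\<le>n. A j)" for n
    by (simp add: F_def E_def fps_mult_nth atMost_atLeast0)
  have nth2: "fps_nth (E * E) n = real (n + 1)" for n
    by (simp add: E_def fps_mult_nth)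
  have "(\<Sum>i\<le>n. (\<Sum>j\<le>i. A j) * (\<Sum>j\<le>n - i. A j)) = fps_nth ((F * E) * (F * E)) n"
    by (simp only: fps_mult_nth[of "F * E"] nth1 atMost_atLeast0)
  also have "(F * E) * (F * E) = (F * F) * (E * E)" by (simp only: ac_simps)
  also have "fps_nth \<dots> n = (\<Sum>j\<le>n. fps_nth (F * F) j * real (n - j + 1))"
    by (simp only: fps_mult_nth[of "F * F"] nth2 atMost_atLeast0)
  also have "\<dots> = (\<Sum>j\<le>n. real (n + 1 - j) * (\<Sum>i\<le>j. A i * A (j - i)))"
    by (intro sum.cong refl) (simp add: F_def fps_mult_nth atMost_atLeast0 Suc_diff_le mult.commute)
  finally show ?thesis .
qed

text \<open>Multiplication by (1 - u)^2 undoes the double partial summation. The subtracted term is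
  (1 - u)^2 times the missing tail over n \<ge> m of (n + 1 - j) u^n.\<close>

lemma second_summation:
  fixes B :: "nat \<Rightarrow> real"
  shows "(1 - u)\<^sup>2 * (\<Sum>n<m. (\<Sum>j\<le>n. real (n + 1 - j) * B j) * u ^ n) =
         (\<Sum>j<m. B j * (u ^ j - u ^ m * (1 + (1 - u) * real (m - j))))"
proof (induction m)
  case (Suc m)
  have "(\<Sum>j<Suc m. B j * (u ^ j - u ^ Suc m * (1 + (1 - u) * real (Suc m - j))))
      - (\<Sum>j<Suc m. B j * (u ^ j - u ^ m * (1 + (1 - u) * real (m - j))))
      = (\<Sum>j<Suc m. (1 - u)\<^sup>2 * (real (m + 1 - j) * B j) * u ^ m)"
    unfolding sum_subtractf[symmetric]
  proof (intro sum.cong refl)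
    fix j assume "j \<in> {..<Suc m}"
    hence j: "j \<le> m" by simp
    define r where "r = real (m - j)"
    have "real (Suc m - j) = r + 1" "real (m + 1 - j) = r + 1" using j by (simp_all add: r_def Suc_diff_le)
    thus "B j * (u ^ j - u ^ Suc m * (1 + (1 - u) * real (Suc m - j))) - B j * (u ^ j - u ^ m * (1 + (1 - u) * real (m - j))) =
        (1 - u)\<^sup>2 * (real (m + 1 - j) * B j) * u ^ m"
      unfolding r_def[symmetric] by (simp add: power2_eq_square algebra_simps)
  qed
  also have "\<dots> = (1 - u)\<^sup>2 * ((\<Sum>j\<le>m. real (m + 1 - j) * B j) * u ^ m)"
    by (simp add: sum_distrib_left sum_distrib_right lessThan_Suc_atMost mult.assoc)
  finally have step: "(\<Sum>j<Suc m. B j * (u ^ j - u ^ Suc m * (1 + (1 - u) * real (Suc m - j))))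
      - (\<Sum>j<Suc m. B j * (u ^ j - u ^ m * (1 + (1 - u) * real (m - j))))
      = (1 - u)\<^sup>2 * ((\<Sum>j\<le>m. real (m + 1 - j) * B j) * u ^ m)" .
  have "(\<Sum>j<Suc m. B j * (u ^ j - u ^ m * (1 + (1 - u) * real (m - j))))
      = (\<Sum>j<m. B j * (u ^ j - u ^ m * (1 + (1 - u) * real (m - j))))" by simp
  with step Suc show ?case by (simp only: sum.lessThan_Suc[of "\<lambda>n. (\<Sum>j\<le>n. real (n + 1 - j) * B j) * u ^ n"] distrib_left)
qed simp

text \<open>The pairs with i + j > 2g are reflected by i to 2g - i, j to 2g - j onto those with i +
  j < 2g, at the cost of \<epsilon>^2 = 1. This is what halves the length of the square.\<close>

lemma square_of_reciprocal_sum: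
  fixes v :: "nat \<Rightarrow> real"
  assumes "\<epsilon>\<^sup>2 = 1" "\<And>n. n \<le> 2 * g \<Longrightarrow> v (2 * g - n) = \<epsilon> * v n"
  shows "(\<Sum>n\<le>2 * g. v n)\<^sup>2 =
    (\<Sum>n<2 * g + 1. \<Sum>i\<le>n. v i * v (n - i)) + (\<Sum>n<2 * g. \<Sum>i\<le>n. v i * v (n - i))"
proof -
  let ?S = "{..2 * g} \<times> {..2 * g}"
  let ?F = "\<lambda>(i, j). v i * v j"
  let ?L = "{(i, j). i + j \<le> 2 * g}" and ?H = "{(i, j). i \<le> 2 * g \<and> j \<le> 2 * g \<and> 2 * g < i + j}"
  have fin: "finite ?L" "finite ?H"
    by (rule finite_subset[of _ ?S]; auto)+
  have "?S = ?L \<union> ?H" by auto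
  moreover have "?L \<inter> ?H = {}" by auto
  moreover have "(\<Sum>n\<le>2 * g. v n)\<^sup>2 = (\<Sum>x\<in>?S. ?F x)"
    by (simp add: power2_eq_square sum_product sum.cartesian_product)
  ultimately have 1: "(\<Sum>n\<le>2 * g. v n)\<^sup>2 = sum ?F ?L + sum ?F ?H"
    using fin by (simp add: sum.union_disjoint)
  have "sum ?F ?H = sum ?F {(i, j). i + j < 2 * g}"
  proof (rule sum.reindex_bij_witness[where i = "\<lambda>(i, j). (2 * g - i, 2 * g - j)" and j = "\<lambda>(i, j). (2 * g - i, 2 * g - j)"])
    fix x assume "x \<in> ?H"
    then obtain i j where x: "x = (i, j)" "i \<le> 2 * g" "j \<le> 2 * g" "2 * g < i + j" by auto
    have "v (2 * g - i) * v (2 * g - j) = \<epsilon>\<^sup>2 * (v i * v j)"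
      using assms(2)[of i] assms(2)[of j] x by (simp add: power2_eq_square)
    thus "?F (case x of (i, j) \<Rightarrow> (2 * g - i, 2 * g - j)) = ?F x" using x assms(1) by simp
  qed auto
  moreover have "sum ?F ?L = (\<Sum>n\<le>2 * g. \<Sum>i\<le>n. v i * v (n - i))" by (rule sum.triangle_reindex_eq)
  moreover have "sum ?F {(i, j). i + j < 2 * g} = (\<Sum>n<2 * g. \<Sum>i\<le>n. v i * v (n - i))" by (rule sum.triangle_reindex)
  ultimately show ?thesis using 1 by (simp add: lessThan_Suc_atMost)
qed

context even_character
begin

definition B :: "nat \<Rightarrow> int" where "B n = (\<Sum>i\<le>n. A i * A (n - i))"

theorem L_square:
  fixes u :: real
  assumes u: "real q * u\<^sup>2 = 1"
  shows "(\<Sum>n<N. A n * u ^ n)\<^sup>2 =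
    (\<Sum>j<2 * g + 1. B j * (u ^ j - u ^ (2 * g + 1) * (1 + (1 - u) * real (2 * g + 1 - j))))
    + (\<Sum>j<2 * g. B j * (u ^ j - u ^ (2 * g) * (1 + (1 - u) * real (2 * g - j))))"
proof -
  obtain \<epsilon> :: int where \<epsilon>: "\<epsilon>\<^sup>2 = 1" "\<And>n. n \<le> 2 * g \<Longrightarrow> \<epsilon> * int q ^ g * a n = int q ^ n * a (2 * g - n)"
    using functional_equation by blast
  have a_eq: "real_of_int (a n) = (\<Sum>j\<le>n. real_of_int (A j))" for n by (simp add: a_def)
  define v where "v n = real_of_int (a n) * u ^ n" for n
  have v: "v (2 * g - n) = real_of_int \<epsilon> * v n" if n: "n \<le> 2 * g" for n
  proof -
    have "real_of_int (\<epsilon> * int q ^ g * a n) = real_of_int (int q ^ n * a (2 * g - n))"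
      using \<epsilon>(2)[OF n] by (simp only:)
    hence E: "\<epsilon> * real q ^ g * a n = real q ^ n * a (2 * g - n)" by simp
    have qu: "real q ^ k * u ^ (2 * k) = 1" for k
      using u by (simp add: power_mult power_mult_distrib[symmetric])
    have "v (2 * g - n) = (real q ^ n * u ^ (2 * n)) * (a (2 * g - n) * u ^ (2 * g - n))"
      by (simp add: v_def qu)
    also have "\<dots> = (real q ^ n * a (2 * g - n)) * (u ^ (2 * n) * u ^ (2 * g - n))" by simp
    also have "u ^ (2 * n) * u ^ (2 * g - n) = u ^ (2 * g) * u ^ n"
      using n by (simp add: add.commute flip: power_add)
    also have "(real q ^ n * a (2 * g - n)) * (u ^ (2 * g) * u ^ n) = (real q ^ g * u ^ (2 * g)) * (\<epsilon> * v n)"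
      by (simp add: v_def flip: E)
    finally show ?thesis by (simp add: qu)
  qed
  have \<epsilon>1: "(real_of_int \<epsilon>)\<^sup>2 = 1" using \<epsilon>(1) by (simp flip: of_int_power)
  have conv: "(\<Sum>i\<le>n. v i * v (n - i)) = (\<Sum>j\<le>n. real (n + 1 - j) * real_of_int (B j)) * u ^ n" for n
  proof -
    have "(\<Sum>i\<le>n. v i * v (n - i)) = (\<Sum>i\<le>n. (real_of_int (a i) * real_of_int (a (n - i))) * u ^ n)"
      by (intro sum.cong refl) (simp add: v_def flip: power_add)
    also have "\<dots> = (\<Sum>i\<le>n. (\<Sum>j\<le>i. real_of_int (A j)) * (\<Sum>j\<le>n - i. real_of_int (A j))) * u ^ n"
      by (simp add: a_eq sum_distrib_right)
    finally show ?thesis unfolding convolution_partial_sums by (simp add: B_def)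
  qed
  have "(\<Sum>n<N. A n * u ^ n) = (\<Sum>n\<le>Suc (2 * g). A n * u ^ n)"
    by (simp add: N_def flip: lessThan_Suc_atMost)
  also have "\<dots> = (1 - u) * (\<Sum>n\<le>2 * g. v n)"
    using a_top a_eq[of "2 * g + 1"] by (simp only: sum_partial_sums) (simp add: v_def a_eq)
  finally have "(\<Sum>n<N. A n * u ^ n)\<^sup>2 = (1 - u)\<^sup>2 * (\<Sum>n\<le>2 * g. v n)\<^sup>2"
    by (simp add: power_mult_distrib)
  also have "(\<Sum>n\<le>2 * g. v n)\<^sup>2 =
    (\<Sum>n<2 * g + 1. \<Sum>i\<le>n. v i * v (n - i)) + (\<Sum>n<2 * g. \<Sum>i\<le>n. v i * v (n - i))"
    using \<epsilon>1 v by (rule square_of_reciprocal_sum)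
  finally show ?thesis unfolding conv by (simp only: distrib_left second_summation)
qed

end

section \<open>Pairs of polynomials with square product\<close>

lemma monic_polys_iff: "f \<in> monic_polys n \<longleftrightarrow> lead_coeff f = 1 \<and> degree f = n"
  by (simp add: monic_polys_def)

lemma monic_mult: "lead_coeff f = 1 \<Longrightarrow> lead_coeff h = 1 \<Longrightarrow> lead_coeff (f * h) = 1" for f h :: "'a::field poly"
  by (simp add: lead_coeff_mult)

lemma monic_degree_mult:
  "lead_coeff f = 1 \<Longrightarrow> lead_coeff h = 1 \<Longrightarrow> degree (f * h) = degree f + degree h" for f h :: "'a::field poly"
  by (rule degree_mult_eq) auto

lemma monic_degree_0: "lead_coeff f = 1 \<Longrightarrow> degree f = 0 \<Longrightarrow> f = 1" for f :: "'a::field poly"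
  by (auto elim!: degree_eq_zeroE)

lemma monic_cofactor:
  fixes R f :: "'a::field poly"
  assumes "lead_coeff R = 1" "lead_coeff f = 1" "R dvd f"
  obtains h where "f = R * h" "lead_coeff h = 1"
proof -
  obtain h where h: "f = R * h" using assms(3) by auto
  hence "lead_coeff h = 1" using assms by (simp add: lead_coeff_mult)
  thus ?thesis using that h by blast
qed

definition sqfree :: "'a::field poly \<Rightarrow> bool" where
  "sqfree s \<longleftrightarrow> (\<forall>R. irreducible R \<longrightarrow> \<not> R\<^sup>2 dvd s)"

lemma sqfree_factor: "sqfree (a * b) \<Longrightarrow> sqfree b"
  by (auto simp: sqfree_def)

text \<open>An irreducible factor of \<open>s\<close> divides \<open>m\<close>, so its square
  divides the product; it occurs only once in \<open>s\<close>, hence it occurs in \<open>t\<close>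
  as well and can be removed from both.\<close>

lemma sqfree_product_square:
  fixes s t m :: "'a::field poly"
  assumes "lead_coeff s = 1" "lead_coeff t = 1" "sqfree s" "sqfree t" "s * t = m\<^sup>2"
  shows "s = t"
  using assms
proof (induction "degree s" arbitrary: s t m rule: less_induct)
  case less
  have pr: "R dvd m" if "irreducible R" "R dvd m\<^sup>2" for R
    using that field_poly_irreducible_imp_prime prime_elem_dvd_power by blast
  show ?case
  proof (cases "degree s = 0")
    case True
    hence s: "s = 1" using less.prems monic_degree_0 by blast
    have "degree t = 0"
    proof (rule ccontr)
      assume "degree t \<noteq> 0"
      then obtain R where R: "irreducible R" "R dvd t" using ex_monic_irreducible_dvd[of t] by blast
      hence "R dvd m" using pr less.prems(5) s by simp
      hence "R\<^sup>2 dvd t" using less.prems(5) s by (simp add: dvd_power_same)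
      thus False using less.prems(4) R(1) by (simp add: sqfree_def)
    qed
    thus ?thesis using s less.prems monic_degree_0 by metis
  next
    case False
    then obtain R where R: "irreducible R" "lead_coeff R = 1" "R dvd s"
      using ex_monic_irreducible_dvd[of s] by blast
    have p: "prime_elem R" using R(1) by (rule field_poly_irreducible_imp_prime)
    obtain s' where s': "s = R * s'" "lead_coeff s' = 1" using monic_cofactor R less.prems by blast
    have "R dvd m\<^sup>2" using R(3) less.prems(5) by (metis dvd_mult2)
    then obtain m' where m': "m = R * m'" using pr[OF R(1)] by blast
    have nz: "R \<noteq> 0" using R by auto
    have eq: "s' * t = R * m'\<^sup>2"
    proof -
      have "R * (s' * t) = R * (R * m'\<^sup>2)"
        using less.prems(5) by (simp add: s' m' power2_eq_square ac_simps)
      thus ?thesis using nz by simp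
    qed
    have "\<not> R dvd s'"
      using less.prems(3) R(1) s'(1) nz by (auto simp: sqfree_def power2_eq_square)
    hence "R dvd t" using eq p by (metis dvd_triv_left prime_elem_dvd_mult_iff)
    then obtain t' where t': "t = R * t'" "lead_coeff t' = 1" using monic_cofactor R less.prems by blast
    have "R * (s' * t') = R * m'\<^sup>2" using eq by (simp add: t' ac_simps)
    hence "s' * t' = m'\<^sup>2" using nz by simp
    moreover have "degree s' < degree s"
      using s' R irreducible_degree_pos[OF R(1)] by (simp add: monic_degree_mult)
    moreover have "sqfree s'" "sqfree t'" using less.prems(3,4) s' t' sqfree_factor by blast+
    ultimately have "s' = t'" using less.hyps s' t' by blast
    thus ?thesis by (simp add: s' t')
  qed
qed

lemma sqfree_decomposition:
  fixes f :: "'a::field poly"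
  assumes "lead_coeff f = 1"
  obtains s a where "f = s * a\<^sup>2" "lead_coeff s = 1" "lead_coeff a = 1" "sqfree s"
  using assms
proof (induction "degree f" arbitrary: f thesis rule: less_induct)
  case less
  show ?case
  proof (cases "sqfree f")
    case True
    thus ?thesis using less.prems(1)[of f 1] less.prems(2) by simp
  next
    case False
    then obtain R where R: "irreducible R" "R\<^sup>2 dvd f" by (auto simp: sqfree_def)
    define R' where "R' = smult (inverse (lead_coeff R)) R"
    have R0: "R \<noteq> 0" using R by auto
    have R': "lead_coeff R' = 1" "degree R' = degree R" using R0 by (simp_all add: R'_def)
    have "R'\<^sup>2 dvd f" using R(2) R0 by (simp add: R'_def smult_power smult_dvd_iff)
    moreover have "lead_coeff (R'\<^sup>2) = 1" by (simp only: lead_coeff_power R'(1) power_one)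
    ultimately obtain h where h: "f = R'\<^sup>2 * h" "lead_coeff h = 1" using monic_cofactor less.prems(2) by blast
    have "R' \<noteq> 0" "h \<noteq> 0" using R'(1) h(2) by auto
    hence "degree h < degree f"
      using h(1) R'(2) irreducible_degree_pos[OF R(1)] by (simp add: degree_mult_eq degree_power_eq)
    then obtain s a where sa: "h = s * a\<^sup>2" "lead_coeff s = 1" "lead_coeff a = 1" "sqfree s"
      using less.hyps[of h] h(2) by blast
    have "f = s * (R' * a)\<^sup>2" using h sa by (simp add: power_mult_distrib)
    thus ?thesis using less.prems(1)[of s "R' * a"] sa R' monic_mult by blast
  qed
qed

text \<open>The equation makes \<open>s * t\<close> a square up to a square factor, so
  \<open>s = t\<close>; then \<open>a\<close> and \<open>b\<close> agree up to sign, which monicity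
  and odd characteristic fix.\<close>

lemma sqfree_decomposition_unique:
  fixes s t a b :: "'a::field poly"
  assumes "s * a\<^sup>2 = t * b\<^sup>2" "lead_coeff s = 1" "lead_coeff a = 1" "sqfree s"
    "lead_coeff t = 1" "lead_coeff b = 1" "sqfree t" "(1 :: 'a) \<noteq> -1"
  shows "s = t" "a = b"
proof -
  have "(s * t) * b\<^sup>2 = (s * a)\<^sup>2"
    using assms(1) by (metis mult.assoc mult.left_commute power2_eq_square power_mult_distrib)
  moreover have "lead_coeff (s * t) = 1" using assms monic_mult by blast
  moreover have "b \<noteq> 0" using assms by auto
  ultimately obtain m where "s * t = m\<^sup>2" using monic_square_of_ratio by blast
  thus st: "s = t" using sqfree_product_square assms by blast
  have "s \<noteq> 0" using assms by auto
  hence "a\<^sup>2 = b\<^sup>2" using assms(1) st by simp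
  hence "a = b \<or> a = - b" by (simp add: power2_eq_iff)
  moreover have "a \<noteq> - b"
  proof
    assume "a = - b"
    hence "lead_coeff a = - lead_coeff b" by simp
    thus False using assms by simp
  qed
  ultimately show "a = b" by blast
qed

section \<open>Counting squarefree polynomials and pairs with square product\<close>

context odd_finite_field
begin

lemma card_monic_polys: "card (monic_polys n :: 'a poly set) = q ^ n"
proof -
  have "bij_betw (\<lambda>r. monom 1 n + r) (small n) (monic_polys n :: 'a poly set)"
  proof (rule bij_betw_byWitness[where f' = "\<lambda>f. f - monom 1 n"])
    have c: "coeff (monom 1 n + r) k = (if k = n then 1 else if k > n then 0 else coeff r k)"
      if "r \<in> small n" for r :: "'a poly" and k
      using that by (auto simp: coeffs_in_def)
    show "(\<lambda>r. monom 1 n + r) ` small n \<subseteq> (monic_polys n :: 'a poly set)"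
    proof clarify
      fix r :: "'a poly" assume r: "r \<in> small n"
      have "degree (monom 1 n + r) = n"
      proof (rule antisym)
        show "degree (monom 1 n + r) \<le> n"
          by (intro degree_le) (simp add: c[OF r] del: coeff_add)
        show "n \<le> degree (monom 1 n + r)"
          by (intro le_degree) (simp add: c[OF r] del: coeff_add)
      qed
      thus "monom 1 n + r \<in> monic_polys n"
        by (simp add: monic_polys_iff c[OF r] del: coeff_add)
    qed
    show "(\<lambda>f. f - monom 1 n) ` (monic_polys n :: 'a poly set) \<subseteq> small n"
      by (auto simp: monic_polys_iff coeffs_in_def coeff_eq_0 le_less)
  qed auto
  thus ?thesis using bij_betw_same_card by (metis card_small q_def)
qed

definition sqf :: "nat \<Rightarrow> 'a poly set" where
  "sqf n = {s \<in> monic_polys n. sqfree s}"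

lemma sqf_iff: "s \<in> sqf n \<longleftrightarrow> lead_coeff s = 1 \<and> degree s = n \<and> sqfree s"
  by (auto simp: sqf_def monic_polys_iff)

lemma finite_sqf [simp]: "finite (sqf n)"
  by (simp add: sqf_def)

lemma degree_sq: "lead_coeff a = 1 \<Longrightarrow> lead_coeff s = 1 \<Longrightarrow> degree (s * a\<^sup>2) = degree s + 2 * degree a"
  for s a :: "'a poly"
proof -
  assume "lead_coeff a = 1" "lead_coeff s = 1"
  hence "a \<noteq> 0" "s \<noteq> 0" by auto
  thus ?thesis by (simp add: degree_mult_eq degree_power_eq)
qed

lemma lead_coeff_sq: "lead_coeff a = 1 \<Longrightarrow> lead_coeff s = 1 \<Longrightarrow> lead_coeff (s * a\<^sup>2) = 1"
  for s a :: "'a poly"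
  unfolding power2_eq_square by (intro monic_mult)

lemma sq_monic_polys: "s \<in> sqf c \<Longrightarrow> a \<in> monic_polys k \<Longrightarrow> s * a\<^sup>2 \<in> monic_polys (c + 2 * k)"
  using lead_coeff_sq[of a s] degree_sq[of a s] unfolding sqf_iff monic_polys_iff by metis

text \<open>Counts monic polynomials through the unique factorisation into a squarefree part and a
  square.\<close>

lemma sqf_sum: "q ^ n = (\<Sum>k\<le>n div 2. card (sqf (n - 2 * k)) * q ^ k)"
proof -
  let ?D = "SIGMA k:{..n div 2}. sqf (n - 2 * k) \<times> (monic_polys k :: 'a poly set)"
  have "bij_betw (\<lambda>(k, s, a). s * a\<^sup>2) ?D (monic_polys n)"
  proof (rule bij_betwI')
    fix x y assume xy: "x \<in> ?D" "y \<in> ?D"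
    obtain k s a l t b where e: "x = (k, s, a)" "y = (l, t, b)" by (cases x, cases y)
    show "((case x of (k, s, a) \<Rightarrow> s * a\<^sup>2) = (case y of (k, s, a) \<Rightarrow> s * a\<^sup>2)) = (x = y)"
    proof
      assume "(case x of (k, s, a) \<Rightarrow> s * a\<^sup>2) = (case y of (k, s, a) \<Rightarrow> s * a\<^sup>2)"
      hence "s * a\<^sup>2 = t * b\<^sup>2" by (simp add: e)
      from sqfree_decomposition_unique[OF this] one_neq_minus_one xy
      have "s = t" "a = b" by (auto simp: e sqf_iff monic_polys_iff)
      thus "x = y" using xy by (auto simp: e monic_polys_iff)
    qed simp
  next
    fix x assume "x \<in> ?D"
    then obtain k s a where x: "x = (k, s, a)" "k \<le> n div 2" "s \<in> sqf (n - 2 * k)" "a \<in> monic_polys k" by auto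
    have "s * a\<^sup>2 \<in> monic_polys (n - 2 * k + 2 * k)" using x by (intro sq_monic_polys)
    thus "(case x of (k, s, a) \<Rightarrow> s * a\<^sup>2) \<in> monic_polys n" using x by simp
  next
    fix f :: "'a poly" assume f: "f \<in> monic_polys n"
    then obtain s a where sa: "f = s * a\<^sup>2" "lead_coeff s = 1" "lead_coeff a = 1" "sqfree s"
      using sqfree_decomposition by (metis monic_polys_iff)
    hence "n = degree s + 2 * degree a" using f degree_sq by (simp add: monic_polys_iff)
    hence "(degree a, s, a) \<in> ?D" using sa by (auto simp: sqf_iff monic_polys_iff)
    thus "\<exists>x\<in>?D. f = (case x of (k, s, a) \<Rightarrow> s * a\<^sup>2)" using sa(1) by force
  qed
  from bij_betw_same_card[OF this] have "card ?D = q ^ n" unfolding card_monic_polys .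
  thus ?thesis by (simp add: card_SigmaI card_cartesian_product card_monic_polys)
qed

text \<open>The terms with k > 0 of \<open>sqf_sum\<close> at n + 2 are \<open>q\<close> times the
  whole sum at \<open>n\<close>, so the recursion telescopes.\<close>

lemma card_sqf:
  "card (sqf 0) = 1" "card (sqf 1) = q" "card (sqf (Suc (Suc n))) + q ^ Suc n = q ^ Suc (Suc n)"
proof -
  show "card (sqf 0) = 1" using sqf_sum[of 0] by simp
  show "card (sqf 1) = q" using sqf_sum[of 1] by simp
  have "q ^ Suc (Suc n) = card (sqf (Suc (Suc n))) + (\<Sum>k\<le>n div 2. card (sqf (n - 2 * k)) * q ^ Suc k)"
    unfolding sqf_sum[of "Suc (Suc n)"] by (simp add: sum.atMost_Suc_shift del: sum.atMost_Suc)
  also have "(\<Sum>k\<le>n div 2. card (sqf (n - 2 * k)) * q ^ Suc k) = q * q ^ n"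
    unfolding sqf_sum[of n] by (simp add: sum_distrib_left ac_simps)
  finally show "card (sqf (Suc (Suc n))) + q ^ Suc n = q ^ Suc (Suc n)" by simp
qed

definition pairs :: "nat \<Rightarrow> ('a poly \<times> 'a poly) set" where
  "pairs n = (\<Union>i\<le>n. monic_polys i \<times> monic_polys (n - i))"

lemma pairs_iff: "(f, h) \<in> pairs n \<longleftrightarrow> lead_coeff f = 1 \<and> lead_coeff h = 1 \<and> degree f + degree h = n"
  by (auto simp: pairs_def monic_polys_iff)

lemma pairsI: "f \<in> monic_polys i \<Longrightarrow> h \<in> monic_polys j \<Longrightarrow> i + j = n \<Longrightarrow> (f, h) \<in> pairs n"
  unfolding pairs_def by (rule UN_I[of i]) auto

lemma finite_pairs [simp]: "finite (pairs n)"
  by (simp add: pairs_def)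

lemma sum_pairs: "(\<Sum>x\<in>pairs n. F x) = (\<Sum>i\<le>n. \<Sum>x\<in>monic_polys i \<times> monic_polys (n - i). F x)"
  unfolding pairs_def by (rule sum.UNION_disjoint) (auto simp: monic_polys_iff)

lemma card_pairs: "card (pairs n) = (n + 1) * q ^ n"
proof -
  have "card (pairs n) = (\<Sum>i\<le>n. card ((monic_polys i :: 'a poly set) \<times> (monic_polys (n - i) :: 'a poly set)))"
    unfolding pairs_def by (rule card_UN_disjoint) (auto simp: monic_polys_iff)
  also have "\<dots> = (\<Sum>i\<le>n. q ^ n)"
    by (intro sum.cong refl) (simp add: card_cartesian_product card_monic_polys flip: power_add)
  finally show ?thesis by simp
qed

definition square_pairs :: "nat \<Rightarrow> ('a poly \<times> 'a poly) set" where
  "square_pairs n = {x \<in> pairs n. \<exists>l. fst x * snd x = l\<^sup>2}"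

text \<open>A product is a square only if the squarefree parts of both factors agree; the total
  degree is then even.\<close>

lemma square_pairs_decomposition:
  assumes "(f, h) \<in> square_pairs n"
  obtains s a b where "f = s * a\<^sup>2" "h = s * b\<^sup>2" "lead_coeff s = 1" "lead_coeff a = 1" "lead_coeff b = 1"
    "sqfree s" "n = 2 * (degree s + degree a + degree b)"
proof -
  have m: "lead_coeff f = 1" "lead_coeff h = 1" "degree f + degree h = n"
    using assms by (auto simp: square_pairs_def pairs_iff)
  obtain l where l: "f * h = l\<^sup>2" using assms by (auto simp: square_pairs_def)
  obtain s a where sa: "f = s * a\<^sup>2" "lead_coeff s = 1" "lead_coeff a = 1" "sqfree s"
    using sqfree_decomposition m(1) by blast
  obtain t b where tb: "h = t * b\<^sup>2" "lead_coeff t = 1" "lead_coeff b = 1" "sqfree t"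
    using sqfree_decomposition m(2) by blast
  have "(s * t) * (a * b)\<^sup>2 = l\<^sup>2" using l sa tb by (simp add: power_mult_distrib ac_simps)
  moreover have "a * b \<noteq> 0" "lead_coeff (s * t) = 1" using sa tb monic_mult by auto
  ultimately obtain r where "s * t = r\<^sup>2" using monic_square_of_ratio by blast
  hence st: "s = t" using sqfree_product_square sa tb by blast
  have "n = 2 * (degree s + degree a + degree b)"
    using m(3) sa tb st by (simp add: degree_sq)
  thus ?thesis using that[of s a b] sa tb st by blast
qed

lemma square_pairs_odd: "odd n \<Longrightarrow> square_pairs n = {}"
proof (rule ccontr)
  assume "odd n" "square_pairs n \<noteq> {}"
  then obtain f h where fh: "(f, h) \<in> square_pairs n" by fast
  obtain s a b :: "'a poly" where "n = 2 * (degree s + degree a + degree b)"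
    by (rule square_pairs_decomposition[OF fh])
  thus False using \<open>odd n\<close> by simp
qed

lemma card_square_pairs_sum:
  "card (square_pairs (2 * i)) = (\<Sum>c\<le>i. card (sqf c) * ((i - c + 1) * q ^ (i - c)))"
proof -
  let ?D = "SIGMA c:{..i}. sqf c \<times> pairs (i - c)"
  have "bij_betw (\<lambda>(c, s, a, b). (s * a\<^sup>2, s * b\<^sup>2)) ?D (square_pairs (2 * i))"
  proof (rule bij_betwI')
    fix x y assume xy: "x \<in> ?D" "y \<in> ?D"
    obtain c s a b d t a' b' where e: "x = (c, s, a, b)" "y = (d, t, a', b')" by (cases x, cases y)
    show "((case x of (c, s, a, b) \<Rightarrow> (s * a\<^sup>2, s * b\<^sup>2)) = (case y of (c, s, a, b) \<Rightarrow> (s * a\<^sup>2, s * b\<^sup>2))) = (x = y)"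
    proof
      assume "(case x of (c, s, a, b) \<Rightarrow> (s * a\<^sup>2, s * b\<^sup>2)) = (case y of (c, s, a, b) \<Rightarrow> (s * a\<^sup>2, s * b\<^sup>2))"
      hence "s * a\<^sup>2 = t * a'\<^sup>2" "s * b\<^sup>2 = t * b'\<^sup>2" by (simp_all add: e)
      from this[THEN sqfree_decomposition_unique(1)] this[THEN sqfree_decomposition_unique(2)] one_neq_minus_one xy
      have "s = t" "a = a'" "b = b'" by (auto simp: e sqf_iff pairs_iff)
      thus "x = y" using xy by (auto simp: e sqf_iff)
    qed simp
  next
    fix x assume "x \<in> ?D"
    then obtain c s a b where x: "x = (c, s, a, b)" "c \<le> i" "s \<in> sqf c" "(a, b) \<in> pairs (i - c)" by auto
    have "(s * a\<^sup>2) * (s * b\<^sup>2) = (s * a * b)\<^sup>2" by (simp add: power2_eq_square ac_simps)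
    hence "\<exists>l. (s * a\<^sup>2) * (s * b\<^sup>2) = l\<^sup>2" by blast
    moreover have "a \<in> monic_polys (degree a)" "b \<in> monic_polys (degree b)"
      using x by (auto simp: monic_polys_iff pairs_iff)
    hence "s * a\<^sup>2 \<in> monic_polys (c + 2 * degree a)" "s * b\<^sup>2 \<in> monic_polys (c + 2 * degree b)"
      using x(3) by (auto intro: sq_monic_polys)
    moreover have "(c + 2 * degree a) + (c + 2 * degree b) = 2 * i" using x by (auto simp: pairs_iff)
    ultimately show "(case x of (c, s, a, b) \<Rightarrow> (s * a\<^sup>2, s * b\<^sup>2)) \<in> square_pairs (2 * i)"
      unfolding x square_pairs_def by (simp add: pairsI)
  next
    fix x assume x: "x \<in> square_pairs (2 * i)"
    obtain f h where fh: "x = (f, h)" by (cases x)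
    obtain s a b where sab: "f = s * a\<^sup>2" "h = s * b\<^sup>2" "lead_coeff s = 1" "lead_coeff a = 1"
      "lead_coeff b = 1" "sqfree s" "2 * i = 2 * (degree s + degree a + degree b)"
      using x unfolding fh by (rule square_pairs_decomposition)
    hence "(degree s, s, a, b) \<in> ?D" by (auto simp: sqf_iff pairs_iff)
    thus "\<exists>y\<in>?D. x = (case y of (c, s, a, b) \<Rightarrow> (s * a\<^sup>2, s * b\<^sup>2))" using sab fh by force
  qed
  hence "card ?D = card (square_pairs (2 * i))" by (rule bij_betw_same_card)
  hence "card (square_pairs (2 * i)) = card ?D" by (rule sym)
  thus ?thesis by (simp add: card_SigmaI card_cartesian_product card_pairs)
qed

text \<open>The common squarefree part of degree c has density 1 for c \<le> 1 and 1 - 1/q beyond,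
  and \<open>i - c + 1\<close> is the number of ways to split the remaining degree. The factor 1 -
  1/q of the quadratic term becomes 1/zeta_A(2) in the theorem.\<close>

lemma card_square_pairs:
  "real (card (square_pairs (2 * i))) = real q ^ i * (2 * real i + 1 + (1 - 1 / real q) * (real i * (real i - 1)) / 2)"
proof -
  define \<sigma> where "\<sigma> c = (if c \<le> 1 then 1 else 1 - 1 / real q)" for c :: nat
  have q0: "real q > 0" using q_ge_3 by simp
  have sqf: "real (card (sqf c)) = real q ^ c * \<sigma> c" for c
  proof -
    consider "c = 0" | "c = 1" | n where "c = Suc (Suc n)" by (metis One_nat_def not0_implies_Suc)
    thus ?thesis
    proof cases
      case 3
      have "real (card (sqf (Suc (Suc n)))) + real q ^ Suc n = real q ^ Suc (Suc n)"
        using card_sqf(3)[of n] by (metis of_nat_add of_nat_power)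
      thus ?thesis using 3 q0 by (simp add: \<sigma>_def field_simps)
    qed (use card_sqf in \<open>simp_all add: \<sigma>_def\<close>)
  qed
  have "real (card (square_pairs (2 * i))) = (\<Sum>c\<le>i. (real q ^ c * \<sigma> c) * (real (i - c + 1) * real q ^ (i - c)))"
    unfolding card_square_pairs_sum by (simp only: of_nat_sum of_nat_mult of_nat_power sqf)
  also have "\<dots> = (\<Sum>c\<le>i. real q ^ i * (\<sigma> c * real (i + 1 - c)))"
    by (intro sum.cong refl) (simp add: Suc_diff_le flip: power_add)
  also have "\<dots> = real q ^ i * (\<Sum>c\<le>i. \<sigma> c * real (i + 1 - c))" by (simp add: sum_distrib_left)
  also have "(\<Sum>c\<le>i. \<sigma> c * real (i + 1 - c)) = 2 * real i + 1 + (1 - 1 / real q) * (real i * (real i - 1)) / 2"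
  proof (induction i)
    case (Suc i)
    have S: "(\<Sum>c\<le>j. \<sigma> c) = (if j = 0 then 1 else 2 + (1 - 1 / q) * (real j - 1))" for j
      by (induction j) (auto simp: \<sigma>_def diff_divide_distrib algebra_simps)
    have "(\<Sum>c\<le>Suc i. \<sigma> c * real (Suc i + 1 - c)) = (\<Sum>c\<le>Suc i. \<sigma> c * real (i + 1 - c) + \<sigma> c)"
      by (intro sum.cong refl) (auto simp: Suc_diff_le algebra_simps)
    also have "\<dots> = (\<Sum>c\<le>i. \<sigma> c * real (i + 1 - c)) + (\<Sum>c\<le>Suc i. \<sigma> c)"
      by (simp add: sum.distrib)
    also have "\<dots> = 2 * real i + 1 + (1 - 1 / real q) * (real i * (real i - 1)) / 2 + (2 + (1 - 1 / q) * real i)"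
      using Suc S[of "Suc i"] by simp
    finally show ?case by (simp add: field_simps)
  qed (simp add: \<sigma>_def)
  finally show ?thesis .
qed

end

section \<open>Averaging over irreducible polynomials\<close>

lemma geometric_deriv_bound:
  fixes v :: real
  assumes v: "0 \<le> v" "v < 1" and S: "finite S"
  shows "(\<Sum>r\<in>S. (1 + 2 * real r) * v ^ r) \<le> 2 / (1 - v)\<^sup>2"
proof -
  have s: "(\<lambda>n. real (Suc n) * v ^ n) sums (1 / (1 - v)\<^sup>2)"
    using geometric_deriv_sums[of v] v by simp
  have "(\<Sum>r\<in>S. (1 + 2 * real r) * v ^ r) \<le> (\<Sum>r\<in>S. 2 * (real (Suc r) * v ^ r))"
    using v by (intro sum_mono) (simp add: algebra_simps)
  also have "\<dots> = 2 * (\<Sum>r\<in>S. real (Suc r) * v ^ r)" by (simp add: sum_distrib_left)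
  also have "(\<Sum>r\<in>S. real (Suc r) * v ^ r) \<le> 1 / (1 - v)\<^sup>2"
    unfolding sums_unique[OF s] using v S by (intro sum_le_suminf sums_summable[OF s]) auto
  finally show ?thesis by simp
qed

text \<open>\<open>G\<close> is the number of even indices below \<open>m\<close>; this treats the
  lengths 2g and 2g + 1 together.\<close>

lemma sum_even_support:
  fixes F :: "nat \<Rightarrow> real"
  assumes "\<And>j. odd j \<Longrightarrow> F j = 0" "m \<le> 2 * G" "2 * G \<le> m + 1"
  shows "(\<Sum>j<m. F j) = (\<Sum>i<G. F (2 * i))"
proof -
  have even: "(\<Sum>j<2 * G. F j) = (\<Sum>i<G. F (2 * i))" for G
    by (induction G) (simp_all add: assms(1))
  consider "m = 2 * G" | "2 * G = Suc m" using assms by linarith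
  thus ?thesis
  proof cases
    case 2
    hence "odd m" by (metis even_Suc even_mult_iff even_numeral)
    thus ?thesis using even[of G] assms(1) 2 by simp
  qed (use even in simp)
qed

lemma sum_quadratic:
  "(\<Sum>i<G. 2 * real i + 1 + c * (real i * (real i - 1)) / 2) =
    (real G)\<^sup>2 + c * (real G * (real G - 1) * (real G - 2)) / 6"
  by (induction G) (simp_all add: field_simps power2_eq_square)

context odd_finite_field
begin

definition Lsum :: "'a poly \<Rightarrow> nat \<Rightarrow> real \<Rightarrow> real" where
  "Lsum P N u = (\<Sum>n<N. (\<Sum>f\<in>monic_polys n. real_of_int (legendre_poly f P)) * u ^ n)"

definition Bsum :: "'a poly \<Rightarrow> nat \<Rightarrow> real" where
  "Bsum P n = (\<Sum>x\<in>pairs n. real_of_int (legendre_poly (fst x * snd x) P))"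

text \<open>The factor of \<open>B j\<close> produced by \<open>second_summation\<close>: the power
  u^j minus its truncation term.\<close>

definition weight :: "real \<Rightarrow> nat \<Rightarrow> nat \<Rightarrow> real" where
  "weight u m j = u ^ j - u ^ m * (1 + (1 - u) * real (m - j))"

lemma Lsum_square:
  assumes "P \<in> monic_irreducibles (2 * g + 2)" "real q * u\<^sup>2 = 1"
  shows "(Lsum P (2 * g + 2) u)\<^sup>2 =
    (\<Sum>j<2 * g + 1. Bsum P j * weight u (2 * g + 1) j) + (\<Sum>j<2 * g. Bsum P j * weight u (2 * g) j)"
proof -
  interpret even_character field_type q P g "2 * g + 2"
    by unfold_locales (use assms in auto)
  have "Lsum P (2 * g + 2) u = (\<Sum>n<2 * g + 2. A n * u ^ n)" by (simp add: Lsum_def A_def)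
  moreover have "Bsum P n = real_of_int (B n)" for n
  proof -
    have "B n = (\<Sum>x\<in>pairs n. chi (fst x * snd x))"
      unfolding sum_pairs B_def A_def sum_product sum.cartesian_product
      by (intro sum.cong refl) (auto simp: chi_mult)
    thus ?thesis by (simp add: Bsum_def)
  qed
  ultimately show ?thesis using L_square[OF assms(2)] by (simp add: weight_def)
qed

text \<open>A square product has lower degree than \<open>P\<close>, so it is prime to
  \<open>P\<close> and contributes 1 for every \<open>P\<close>. Every other pair falls under
  \<open>character_sum_bound\<close> with t = g + 1.\<close>

lemma Bsum_average:
  assumes g: "g \<ge> 1" and n: "n \<le> 2 * g"
  shows "\<bar>(\<Sum>P\<in>monic_irreducibles (2 * g + 2). Bsum P n)
           - real (card (monic_irreducibles (2 * g + 2) :: 'a poly set)) * real (card (square_pairs n))\<bar>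
         \<le> 9 * real q ^ (g + 1) * (real (n + 1) * real q ^ n)"
proof -
  let ?I = "monic_irreducibles (2 * g + 2) :: 'a poly set"
  define F where "F x = (\<Sum>P\<in>?I. real_of_int (legendre_poly (fst x * snd x) P))" for x
  have deg: "degree (fst x * snd x) = n \<and> lead_coeff (fst x * snd x) = 1" if "x \<in> pairs n" for x
  proof -
    have *: "lead_coeff (fst x) = 1" "lead_coeff (snd x) = 1" "degree (fst x) + degree (snd x) = n"
      using that pairs_iff[of "fst x" "snd x" n] by auto
    show ?thesis using monic_degree_mult[OF *(1,2)] monic_mult[OF *(1,2)] *(3) by simp
  qed
  have sq: "F x = real (card ?I)" if x: "x \<in> square_pairs n" for x
  proof -
    obtain l where l: "fst x * snd x = l\<^sup>2" and xp: "x \<in> pairs n" using x by (auto simp: square_pairs_def)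
    have "legendre_poly (fst x * snd x) P = 1" if P: "P \<in> ?I" for P
    proof -
      note PD = monic_irreduciblesD[OF P]
      have "\<not> P dvd l\<^sup>2"
      proof
        assume "P dvd l\<^sup>2"
        moreover have "l\<^sup>2 \<noteq> 0" using deg[OF xp] l by auto
        ultimately have "degree P \<le> degree (l\<^sup>2)" by (rule dvd_imp_degree_le)
        thus False using deg[OF xp] l PD(3) n by simp
      qed
      moreover have "\<exists>h. P dvd h\<^sup>2 - l\<^sup>2" by (rule exI[of _ l]) simp
      ultimately show ?thesis unfolding l by (simp add: legendre_poly_alt)
    qed
    thus ?thesis by (simp add: F_def)
  qed
  have nonsq: "\<bar>F x\<bar> \<le> 9 * real q ^ (g + 1)" if x: "x \<in> pairs n - square_pairs n" for x
  proof -
    have "\<bar>\<Sum>P\<in>monic_irreducibles (2 * (g + 1)). legendre_poly (fst x * snd x) P\<bar> \<le> 9 * q ^ (g + 1)"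
      using x deg[of x] n g by (intro character_sum_bound) (auto simp: square_pairs_def)
    hence "real_of_int \<bar>\<Sum>P\<in>?I. legendre_poly (fst x * snd x) P\<bar> \<le> real_of_int (9 * q ^ (g + 1))"
      by (simp only: of_int_le_iff) simp
    thus ?thesis by (simp add: F_def)
  qed
  have sub: "square_pairs n \<subseteq> pairs n" by (auto simp: square_pairs_def)
  hence fin: "finite (square_pairs n)" using finite_subset finite_pairs by blast
  have "(\<Sum>P\<in>?I. Bsum P n) = (\<Sum>x\<in>pairs n. F x)"
    unfolding Bsum_def F_def by (rule sum.swap)
  also have "\<dots> = (\<Sum>x\<in>pairs n - square_pairs n. F x) + (\<Sum>x\<in>square_pairs n. F x)"
    using sub by (intro sum.subset_diff) auto
  also have "(\<Sum>x\<in>square_pairs n. F x) = real (card ?I) * real (card (square_pairs n))"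
    by (simp add: sq)
  finally have "\<bar>(\<Sum>P\<in>?I. Bsum P n) - real (card ?I) * real (card (square_pairs n))\<bar>
      = \<bar>\<Sum>x\<in>pairs n - square_pairs n. F x\<bar>" by simp
  also have "\<dots> \<le> (\<Sum>x\<in>pairs n - square_pairs n. \<bar>F x\<bar>)" by (rule sum_abs)
  also have "\<dots> \<le> (\<Sum>x\<in>pairs n - square_pairs n. 9 * real q ^ (g + 1))" by (intro sum_mono nonsq)
  also have "\<dots> \<le> (\<Sum>x\<in>pairs n. 9 * real q ^ (g + 1))" by (intro sum_mono2) auto
  also have "\<dots> = 9 * real q ^ (g + 1) * real (card (pairs n))" by simp
  finally show ?thesis by (simp only: card_pairs of_nat_mult of_nat_power)
qed

text \<open>Off the diagonal, q^j |u|^j = z^j with z the square root of q, so the geometric sum is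
  of order q^g. On the diagonal, q^i u^(2i) = 1 for either sign of u, leaving the quadratic
  \<open>\<tau> i\<close>; the truncation terms decay geometrically in \<open>m - 2 * i\<close>, so
  altogether they cost only a multiple of (g + 1)^2.\<close>

lemma weighted_average:
  fixes u v z :: real
  assumes g: "g \<ge> 1" and u: "real q * u\<^sup>2 = 1" and v: "v = \<bar>u\<bar>" and z: "z = 1 / v"
    and mG: "m \<le> 2 * G" "2 * G \<le> m + 1" "m \<le> 2 * g + 1"
    and K: "K = 2 / (1 - v)\<^sup>2"
  shows "\<bar>(\<Sum>j<m. (\<Sum>P\<in>monic_irreducibles (2 * g + 2). Bsum P j) * weight u m j)
     - real (card (monic_irreducibles (2 * g + 2) :: 'a poly set)) *
       ((real G)\<^sup>2 + (1 - 1 / real q) * (real G * (real G - 1) * (real G - 2)) / 6)\<bar>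
    \<le> 9 * real q ^ (g + 1) * (1 + K) * (2 * real g + 1) * (z ^ (2 * g + 1) / (z - 1))
      + real (card (monic_irreducibles (2 * g + 2) :: 'a poly set)) * (2 * (real g + 1)\<^sup>2 * K)"
proof -
  define I where "I = (monic_irreducibles (2 * g + 2) :: 'a poly set)"
  define s where "s j = real (card (square_pairs j))" for j
  define D where "D j = (\<Sum>P\<in>I. Bsum P j) - real (card I) * s j" for j
  define \<tau> where "\<tau> i = 2 * real i + 1 + (1 - 1 / real q) * (real i * (real i - 1)) / 2" for i
  have q0: "real q > 0" using q_ge_3 by simp
  have qv: "real q * v\<^sup>2 = 1" using u by (simp add: v)
  have v2: "v\<^sup>2 = 1 / real q" using qv q0 by (simp add: field_simps)
  have v0: "v > 0" using qv unfolding v by (cases "u = 0") auto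
  have v1: "v < 1"
  proof (rule power_less_imp_less_base[of v 2 1])
    show "v\<^sup>2 < 1\<^sup>2" unfolding v2 using q_ge_3 by simp
  qed simp
  have z1: "z > 1" using v0 v1 by (simp add: z)
  have qz: "real q * v = z" using qv v0 by (simp add: z power2_eq_square field_simps)
  have K0: "K \<ge> 0" by (simp add: K)
  have tail: "\<bar>u ^ m * (1 + (1 - u) * real (m - j))\<bar> \<le> v ^ j * ((1 + 2 * real (m - j)) * v ^ (m - j))"
    if "j \<le> m" for j
  proof -
    have "\<bar>1 + (1 - u) * real (m - j)\<bar> \<le> 1 + \<bar>1 - u\<bar> * real (m - j)"
      by (rule order.trans[OF abs_triangle_ineq]) (simp add: abs_mult)
    also have "\<bar>1 - u\<bar> \<le> 2" using v1 v by linarith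
    hence "1 + \<bar>1 - u\<bar> * real (m - j) \<le> 1 + 2 * real (m - j)" by (intro add_left_mono mult_right_mono) auto
    finally have "\<bar>u ^ m * (1 + (1 - u) * real (m - j))\<bar> \<le> v ^ m * (1 + 2 * real (m - j))"
      unfolding abs_mult power_abs v by (intro mult_left_mono) auto
    also have "v ^ m = v ^ j * v ^ (m - j)" using that by (simp flip: power_add)
    finally show ?thesis by (simp add: ac_simps)
  qed
  \<comment> \<open>\<open>K\<close> bounds the whole series of nonnegative terms, hence each single
    term.\<close>
  have one_tail: "(1 + 2 * real r) * v ^ r \<le> K" for r
    using geometric_deriv_bound[of v "{r}"] v0 v1 K by simp
  have w: "\<bar>weight u m j\<bar> \<le> (1 + K) * v ^ j" if "j \<le> m" for j
  proof -
    have "\<bar>weight u m j\<bar> \<le> \<bar>u ^ j\<bar> + \<bar>u ^ m * (1 + (1 - u) * real (m - j))\<bar>"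
      unfolding weight_def by (rule abs_triangle_ineq4)
    also have "\<bar>u ^ m * (1 + (1 - u) * real (m - j))\<bar> \<le> v ^ j * K"
      using order.trans[OF tail[OF that]] one_tail v0 by (simp add: mult_left_mono)
    finally show ?thesis by (simp add: v power_abs algebra_simps)
  qed
  have off_diagonal: "\<bar>\<Sum>j<m. D j * weight u m j\<bar> \<le>
      9 * real q ^ (g + 1) * (1 + K) * (2 * real g + 1) * (z ^ (2 * g + 1) / (z - 1))"
  proof -
    have "\<bar>\<Sum>j<m. D j * weight u m j\<bar> \<le> (\<Sum>j<m. \<bar>D j\<bar> * \<bar>weight u m j\<bar>)"
      unfolding abs_mult[symmetric] by (rule sum_abs)
    also have "\<dots> \<le> (\<Sum>j<m. (9 * real q ^ (g + 1) * ((2 * real g + 1) * real q ^ j)) * ((1 + K) * v ^ j))"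
    proof (rule sum_mono)
      fix j assume "j \<in> {..<m}"
      hence j: "j \<le> 2 * g" "j \<le> m" using mG by auto
      have "\<bar>D j\<bar> \<le> 9 * real q ^ (g + 1) * (real (j + 1) * real q ^ j)"
        using Bsum_average[OF g j(1)] by (simp add: D_def I_def s_def)
      also have "\<dots> \<le> 9 * real q ^ (g + 1) * ((2 * real g + 1) * real q ^ j)"
        using j by (intro mult_left_mono mult_right_mono) auto
      finally show "\<bar>D j\<bar> * \<bar>weight u m j\<bar> \<le>
          (9 * real q ^ (g + 1) * ((2 * real g + 1) * real q ^ j)) * ((1 + K) * v ^ j)"
        using w[OF j(2)] by (intro mult_mono) auto
    qed
    also have "\<dots> = 9 * real q ^ (g + 1) * (1 + K) * (2 * real g + 1) * (\<Sum>j<m. z ^ j)"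
      unfolding sum_distrib_left by (intro sum.cong refl) (simp add: power_mult_distrib ac_simps flip: qz)
    also have "(\<Sum>j<m. z ^ j) \<le> z ^ (2 * g + 1) / (z - 1)"
    proof -
      have "(\<Sum>j<m. z ^ j) = (z ^ m - 1) / (z - 1)" using z1 by (simp add: geometric_sum)
      also have "\<dots> \<le> z ^ (2 * g + 1) / (z - 1)"
      proof (rule divide_right_mono)
        have "z ^ m \<le> z ^ (2 * g + 1)" using z1 mG(3) by (intro power_increasing) auto
        thus "z ^ m - 1 \<le> z ^ (2 * g + 1)" by simp
      qed (use z1 in simp)
      finally show ?thesis .
    qed
    finally show ?thesis using K0 by (simp add: mult_left_mono)
  qed
  have Gg: "G \<le> g + 1" using mG by linarith
  have diagonal: "\<bar>(\<Sum>j<m. s j * weight u m j) - (\<Sum>i<G. \<tau> i)\<bar> \<le> 2 * (real g + 1)\<^sup>2 * K"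
  proof -
    have "(\<Sum>j<m. s j * weight u m j) = (\<Sum>i<G. s (2 * i) * weight u m (2 * i))"
      using mG by (intro sum_even_support) (auto simp: s_def square_pairs_odd)
    hence "\<bar>(\<Sum>j<m. s j * weight u m j) - (\<Sum>i<G. \<tau> i)\<bar> = \<bar>\<Sum>i<G. s (2 * i) * weight u m (2 * i) - \<tau> i\<bar>"
      by (simp add: sum_subtractf)
    also have "\<dots> \<le> (\<Sum>i<G. \<bar>s (2 * i) * weight u m (2 * i) - \<tau> i\<bar>)" by (rule sum_abs)
    also have "\<dots> \<le> (\<Sum>i<G. 2 * (real g + 1)\<^sup>2 * ((1 + 2 * real (m - 2 * i)) * v ^ (m - 2 * i)))"
    proof (rule sum_mono)
      fix i assume "i \<in> {..<G}"
      hence i: "2 * i \<le> m" "i \<le> g" using mG Gg by auto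
      have qv_i: "real q ^ i * v ^ (2 * i) = 1"
        using qv by (simp add: power_mult flip: power_mult_distrib)
      have qu_i: "real q ^ i * u ^ (2 * i) = 1"
        using u by (simp add: power_mult flip: power_mult_distrib)
      have "s (2 * i) = real q ^ i * \<tau> i" by (simp add: s_def card_square_pairs \<tau>_def)
      hence "s (2 * i) * weight u m (2 * i) - \<tau> i =
          \<tau> i * (real q ^ i * u ^ (2 * i)) - \<tau> i - \<tau> i * (real q ^ i * (u ^ m * (1 + (1 - u) * real (m - 2 * i))))"
        by (simp add: weight_def right_diff_distrib mult.assoc mult.left_commute)
      hence "\<bar>s (2 * i) * weight u m (2 * i) - \<tau> i\<bar> = \<bar>\<tau> i\<bar> * (real q ^ i * \<bar>u ^ m * (1 + (1 - u) * real (m - 2 * i))\<bar>)"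
        using q0 by (simp add: qu_i abs_mult)
      also have "\<dots> \<le> (2 * (real g + 1)\<^sup>2) * (real q ^ i * (v ^ (2 * i) * ((1 + 2 * real (m - 2 * i)) * v ^ (m - 2 * i))))"
      proof (intro mult_mono)
        have c: "0 \<le> 1 - 1 / real q" "1 - 1 / real q \<le> 1" using q_ge_3 by auto
        define xx where "xx = real i * (real i - 1)"
        define yy where "yy = (1 - 1 / real q) * xx"
        have "0 \<le> xx" unfolding xx_def by (cases i) auto
        hence "yy \<le> 1 * xx" unfolding yy_def by (rule mult_right_mono[OF c(2)])
        moreover have "0 \<le> yy" unfolding yy_def by (rule mult_nonneg_nonneg[OF c(1) \<open>0 \<le> xx\<close>])
        moreover have "2 * real i + 1 + xx / 2 \<le> 2 * (real i + 1)\<^sup>2"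
          by (simp add: xx_def power2_eq_square field_simps)
        moreover have "(real i + 1)\<^sup>2 \<le> (real g + 1)\<^sup>2" using i by (intro power_mono) auto
        ultimately have "\<bar>2 * real i + 1 + yy / 2\<bar> \<le> 2 * (real g + 1)\<^sup>2" by linarith
        thus "\<bar>\<tau> i\<bar> \<le> 2 * (real g + 1)\<^sup>2" by (simp add: \<tau>_def yy_def xx_def)
      qed (use tail[OF i(1)] q0 in auto)
      also have "\<dots> = 2 * (real g + 1)\<^sup>2 * ((real q ^ i * v ^ (2 * i)) * ((1 + 2 * real (m - 2 * i)) * v ^ (m - 2 * i)))"
        by (simp only: ac_simps)
      finally show "\<bar>s (2 * i) * weight u m (2 * i) - \<tau> i\<bar> \<le>
          2 * (real g + 1)\<^sup>2 * ((1 + 2 * real (m - 2 * i)) * v ^ (m - 2 * i))"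
        by (simp add: qv_i)
    qed
    also have "\<dots> = 2 * (real g + 1)\<^sup>2 * (\<Sum>i<G. (1 + 2 * real (m - 2 * i)) * v ^ (m - 2 * i))"
      by (simp add: sum_distrib_left)
    also have "(\<Sum>i<G. (1 + 2 * real (m - 2 * i)) * v ^ (m - 2 * i)) \<le> K"
    proof -
      \<comment> \<open>The exponents \<open>m - 2 * i\<close> are distinct, so the sum is part of
        the series bounded by \<open>K\<close>.\<close>
      have "inj_on (\<lambda>i. m - 2 * i) {..<G}" using mG by (auto intro!: inj_onI)
      hence "(\<Sum>i<G. (1 + 2 * real (m - 2 * i)) * v ^ (m - 2 * i)) =
          (\<Sum>r\<in>(\<lambda>i. m - 2 * i) ` {..<G}. (1 + 2 * real r) * v ^ r)"
        by (simp add: sum.reindex)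
      also have "\<dots> \<le> K" unfolding K using v0 v1 by (intro geometric_deriv_bound) auto
      finally show ?thesis .
    qed
    finally show ?thesis by (simp add: mult_left_mono)
  qed
  have \<tau>_sum: "(\<Sum>i<G. \<tau> i) = (real G)\<^sup>2 + (1 - 1 / real q) * (real G * (real G - 1) * (real G - 2)) / 6"
    unfolding \<tau>_def by (rule sum_quadratic)
  have "(\<Sum>j<m. (\<Sum>P\<in>I. Bsum P j) * weight u m j) =
      (\<Sum>j<m. D j * weight u m j) + real (card I) * (\<Sum>j<m. s j * weight u m j)"
    by (simp add: D_def left_diff_distrib sum_subtractf sum_distrib_left mult.assoc)
  hence "(\<Sum>j<m. (\<Sum>P\<in>I. Bsum P j) * weight u m j) - real (card I) * (\<Sum>i<G. \<tau> i) =
      (\<Sum>j<m. D j * weight u m j) + real (card I) * ((\<Sum>j<m. s j * weight u m j) - (\<Sum>i<G. \<tau> i))"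
    by (simp add: right_diff_distrib)
  also have "\<bar>\<dots>\<bar> \<le> \<bar>\<Sum>j<m. D j * weight u m j\<bar> + real (card I) * \<bar>(\<Sum>j<m. s j * weight u m j) - (\<Sum>i<G. \<tau> i)\<bar>"
    by (rule order.trans[OF abs_triangle_ineq]) (simp add: abs_mult)
  also have "\<dots> \<le> 9 * real q ^ (g + 1) * (1 + K) * (2 * real g + 1) * (z ^ (2 * g + 1) / (z - 1))
      + real (card I) * (2 * (real g + 1)\<^sup>2 * K)"
    using off_diagonal diagonal by (intro add_mono mult_left_mono) auto
  finally show ?thesis unfolding \<tau>_sum I_def .
qed

text \<open>With y = g + 1 = N/2 the two diagonal sums amount to c y^3 / 3, and there are about q^N
  / (2y) irreducibles, whence c y^2 / 6 = c N^2 / 24. In \<open>C\<close> the first term stems from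
  the two off-diagonal errors, the second from truncation and the lower terms of the cubic, and 1/6
  from replacing the number of irreducibles by q^N / N.\<close>

lemma second_moment_bound:
  fixes u v z K C :: real
  assumes g: "g \<ge> 1" and u: "real q * u\<^sup>2 = 1" and v: "v = \<bar>u\<bar>" and z: "z = 1 / v"
    and K: "K = 2 / (1 - v)\<^sup>2" and C: "C = 18 * (1 + K) * (z / (z - 1)) + (4 * K + 5) / 4 + 1 / 6"
    and N: "N = 2 * g + 2"
  shows "\<bar>(\<Sum>P\<in>monic_irreducibles N. (Lsum P N u)\<^sup>2) - (1 - 1 / real q) / 24 * (real q ^ N * (real N)\<^sup>2)\<bar>
    \<le> C * (real q ^ N * real N)"
proof -
  define I where "I = (monic_irreducibles N :: 'a poly set)"
  define p where "p = real (card I)"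
  define y where "y = real g + 1"
  define c where "c = 1 - 1 / real q"
  define S where "S = (\<Sum>P\<in>I. (Lsum P N u)\<^sup>2)"
  define E where "E = 9 * real q ^ (g + 1) * (1 + K) * (2 * real g + 1) * (z ^ (2 * g + 1) / (z - 1))"
  define \<mu> where "\<mu> G = (real G)\<^sup>2 + c * (real G * (real G - 1) * (real G - 2)) / 6" for G
  define T where "T m = (\<Sum>j<m. (\<Sum>P\<in>I. Bsum P j) * weight u m j)" for m
  have y: "y \<ge> 1" "real N = 2 * y" "real g = y - 1" by (simp_all add: y_def N)
  have c: "0 \<le> c" "c \<le> 1" using q_ge_3 by (simp_all add: c_def)
  have p0: "0 \<le> p" by (simp add: p_def)
  have q0: "real q > 0" using q_ge_3 by simp
  have qv: "real q * v\<^sup>2 = 1" using u by (simp add: v)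
  have v2: "v\<^sup>2 = 1 / real q" using qv q0 by (simp add: field_simps)
  have v0: "v > 0" using qv unfolding v by (cases "u = 0") auto
  have v1: "v < 1"
  proof (rule power_less_imp_less_base[of v 2 1])
    show "v\<^sup>2 < 1\<^sup>2" unfolding v2 using q_ge_3 by simp
  qed simp
  have z1: "z > 1" using v0 v1 by (simp add: z)
  have z2: "z\<^sup>2 = real q" using v2 q0 by (simp add: z power_divide)
  have K0: "K \<ge> 0" by (simp add: K)
  have Q: "real q ^ N = real q ^ (g + 1) * real q ^ (g + 1)" by (simp add: N mult_2 flip: power_add)
  have E: "E \<le> 9 * (1 + K) * (z / (z - 1)) * (real q ^ N * real N)"
  proof -
    have zz: "z ^ (2 * g + 1) = real q ^ g * z" using z2 by (simp add: power_mult)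
    have "E = 9 * (1 + K) * (z / (z - 1)) * ((real q ^ (g + 1) * real q ^ g) * (2 * real g + 1))"
      unfolding E_def zz by (simp add: algebra_simps)
    also have "\<dots> \<le> 9 * (1 + K) * (z / (z - 1)) * (real q ^ N * real N)"
    proof (rule mult_left_mono[OF mult_mono])
      show "real q ^ (g + 1) * real q ^ g \<le> real q ^ N"
        unfolding Q using q_ge_3 by (intro mult_left_mono power_increasing) auto
    qed (use K0 z1 N in auto)
    finally show ?thesis .
  qed
  have T: "\<bar>T m - p * \<mu> G\<bar> \<le> E + p * (2 * y\<^sup>2 * K)"
    if "m \<le> 2 * G" "2 * G \<le> m + 1" "m \<le> 2 * g + 1" for m G
    using weighted_average[OF g u v z that K]
    by (simp add: T_def p_def \<mu>_def c_def E_def y_def I_def N)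
  have "S = (\<Sum>P\<in>I. (\<Sum>j<2 * g + 1. Bsum P j * weight u (2 * g + 1) j) + (\<Sum>j<2 * g. Bsum P j * weight u (2 * g) j))"
    unfolding S_def I_def N by (intro sum.cong refl Lsum_square u)
  also have "\<dots> = T (2 * g + 1) + T (2 * g)"
    unfolding T_def sum.distrib sum_distrib_right by (intro arg_cong2[where f = "(+)"] sum.swap)
  finally have S: "S = T (2 * g + 1) + T (2 * g)" .
  have "\<bar>S - p * (\<mu> (g + 1) + \<mu> g)\<bar> \<le> 2 * E + p * (4 * y\<^sup>2 * K)"
    using T[of "2 * g + 1" "g + 1"] T[of "2 * g" g] unfolding S by (simp add: distrib_left)
  moreover have "\<bar>\<mu> (g + 1) + \<mu> g - c * y ^ 3 / 3\<bar> \<le> 5 * y\<^sup>2"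
  proof -
    \<comment> \<open>The cubic parts add up to (y - 1)(y - 2)(2y - 3) / 6 = y^3 / 3 - t.\<close>
    define t where "t = (9 * y\<^sup>2 - 13 * y + 6) / 6"
    have aux: "\<bar>w\<bar> \<le> 5 * y2"
      if "w = y2 + s - r" "0 \<le> r" "6 * r \<le> 9 * y2 - 13 * y + 6" "1 \<le> y2" "s \<le> y2" "0 \<le> s"
      for w y2 s r :: real
      using that y(1) by linarith
    have t0: "0 \<le> t"
    proof -
      \<comment> \<open>Completing the square: 9y^2 - 13y + 6 exceeds this square by 47/36.\<close>
      have "0 \<le> (3 * y - 13 / 6)\<^sup>2" by simp
      thus ?thesis by (simp add: t_def power2_eq_square field_simps)
    qed
    show ?thesis
    proof (rule aux)
      show "\<mu> (g + 1) + \<mu> g - c * y ^ 3 / 3 = y\<^sup>2 + (y - 1)\<^sup>2 - c * t"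
        by (simp add: \<mu>_def y(3) t_def power2_eq_square power3_eq_cube field_simps)
      show "0 \<le> c * t" using c(1) t0 by (rule mult_nonneg_nonneg)
      show "6 * (c * t) \<le> 9 * y\<^sup>2 - 13 * y + 6"
        using mult_right_mono[OF c(2) t0] by (simp add: t_def)
      show "(y - 1)\<^sup>2 \<le> y\<^sup>2" using y(1) by (intro power_mono) auto
    qed (use y(1) in \<open>simp_all add: one_le_power\<close>)
  qed
  hence "p * \<bar>\<mu> (g + 1) + \<mu> g - c * y ^ 3 / 3\<bar> \<le> p * (5 * y\<^sup>2)"
    by (rule mult_left_mono[OF _ p0])
  hence "\<bar>p * (\<mu> (g + 1) + \<mu> g) - p * (c * y ^ 3 / 3)\<bar> \<le> p * (5 * y\<^sup>2)"
    by (simp only: right_diff_distrib[symmetric] abs_mult abs_of_nonneg[OF p0])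
  moreover have "p * (4 * y\<^sup>2 * K) + p * (5 * y\<^sup>2) \<le> (4 * K + 5) / 4 * (real q ^ N * real N)"
  proof -
    have "real (N * card I) \<le> real (q ^ N)"
      unfolding of_nat_le_iff I_def by (rule card_monic_irreducibles_le) (simp add: N)
    hence "2 * y * p \<le> real q ^ N" using y(2) by (simp add: p_def)
    hence "((4 * K + 5) / 2 * y) * (2 * y * p) \<le> ((4 * K + 5) / 2 * y) * real q ^ N"
      using K0 y(1) by (intro mult_left_mono) auto
    moreover have "((4 * K + 5) / 2 * y) * (2 * y * p) = p * (4 * y\<^sup>2 * K) + p * (5 * y\<^sup>2)"
      by (simp add: power2_eq_square algebra_simps)
    moreover have "((4 * K + 5) / 2 * y) * x = (4 * K + 5) / 4 * (x * real N)" for x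
      by (simp add: y(2))
    ultimately show ?thesis by metis
  qed
  moreover have "\<bar>p * (c * y ^ 3 / 3) - c / 24 * (real q ^ N * (real N)\<^sup>2)\<bar> \<le> 1 / 6 * (real q ^ N * real N)"
  proof -
    have up: "2 * y * p \<le> real q ^ N"
    proof -
      have "real (N * card I) \<le> real (q ^ N)"
        unfolding of_nat_le_iff I_def by (rule card_monic_irreducibles_le) (simp add: N)
      thus ?thesis using y(2) by (simp add: p_def)
    qed
    have low: "real q ^ N \<le> 2 * y * p + 2 * real q ^ (g + 1)"
    proof -
      have "N div 2 = g + 1" "N > 0" by (simp_all add: N)
      hence "q ^ N \<le> N * card I + 2 * q ^ (g + 1)"
        using card_monic_irreducibles_ge[of N] by (simp only: I_def)
      hence "real (q ^ N) \<le> real (N * card I + 2 * q ^ (g + 1))" by (simp only: of_nat_le_iff)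
      thus ?thesis using y(2) by (simp add: p_def)
    qed
    \<comment> \<open>Lets the error y q^(g+1) from the count of irreducibles be absorbed into
      q^N.\<close>
    have yq: "y \<le> real q ^ (g + 1)"
    proof -
      have "g + 1 < 2 ^ (g + 1)" by (rule less_exp)
      also have "(2::nat) ^ (g + 1) \<le> q ^ (g + 1)" using q_ge_3 by (intro power_mono) auto
      finally have "real (g + 1) \<le> real (q ^ (g + 1))" by (simp only: of_nat_le_iff less_imp_le)
      thus ?thesis by (simp add: y_def)
    qed
    have "p * (c * y ^ 3 / 3) - c / 24 * (real q ^ N * (real N)\<^sup>2) = - (c * (y\<^sup>2 / 6 * (real q ^ N - 2 * y * p)))"
      by (simp add: y(2) power2_eq_square power3_eq_cube field_simps)
    moreover have "0 \<le> c * (y\<^sup>2 / 6 * (real q ^ N - 2 * y * p))" using c up by simp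
    moreover have "c * (y\<^sup>2 / 6 * (real q ^ N - 2 * y * p)) \<le> 1 * (y\<^sup>2 / 6 * (2 * real q ^ (g + 1)))"
      using c up low by (intro mult_mono mult_left_mono) auto
    moreover have "1 * (y\<^sup>2 / 6 * (2 * real q ^ (g + 1))) = y / 3 * (y * real q ^ (g + 1))"
      by (simp add: power2_eq_square)
    moreover have "y / 3 * (y * real q ^ (g + 1)) \<le> y / 3 * (real q ^ N)"
      unfolding Q using yq y(1) by (intro mult_left_mono mult_right_mono) auto
    moreover have "y / 3 * (real q ^ N) = 1 / 6 * (real q ^ N * real N)" by (simp add: y(2))
    ultimately show ?thesis by linarith
  qed
  moreover have "2 * E + (4 * K + 5) / 4 * (real q ^ N * real N) + 1 / 6 * (real q ^ N * real N)
      \<le> C * (real q ^ N * real N)"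
  proof -
    have "(18 * a * b + d + e) * w = 2 * (9 * a * b * w) + d * w + e * w" for a b d e w :: real
      by (simp add: algebra_simps)
    hence "C * (real q ^ N * real N) = 2 * (9 * (1 + K) * (z / (z - 1)) * (real q ^ N * real N))
        + (4 * K + 5) / 4 * (real q ^ N * real N) + 1 / 6 * (real q ^ N * real N)"
      unfolding C by this
    thus ?thesis using E by (simp only: add_le_cancel_right mult_le_cancel_left_pos zero_less_numeral)
  qed
  ultimately have "\<bar>S - c / 24 * (real q ^ N * (real N)\<^sup>2)\<bar> \<le> C * (real q ^ N * real N)"
    by linarith
  thus ?thesis by (simp add: S_def I_def c_def)
qed

text \<open>The norm |f|^(-1/2) and the sign \<delta> combine into powers of u = \<delta> q^(-1/2).
  The inner sums vanish from degree 2g + 2 on, so the infinite sum is the value of a polynomial and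
  not a default.\<close>

lemma dirichlet_L_half:
  fixes D P :: "'a poly" and \<delta> :: real
  assumes P: "P \<in> monic_irreducibles (2 * g + 2)"
    and D: "\<And>f. lead_coeff f = 1 \<Longrightarrow> real_of_int (jacobi_poly D f) = \<delta> ^ degree f * real_of_int (legendre_poly f P)"
  shows "dirichlet_L (1 / 2) D = of_real (Lsum P (2 * g + 2) (\<delta> / sqrt (real q)))"
proof -
  interpret even_character field_type q P g "2 * g + 2"
    by unfold_locales (use P in auto)
  define u where "u = \<delta> / sqrt (real q)"
  have q0: "real q > 0" using q_ge_3 by simp
  have "(\<Sum>f\<in>monic_polys n. of_int (jacobi_poly D f) * of_real \<bar>f\<bar>\<^sub>A powr (- (1 / 2))) =
      complex_of_real ((\<Sum>f\<in>monic_polys n. real_of_int (legendre_poly f P)) * u ^ n)" for n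
  proof -
    have "of_int (jacobi_poly D f) * of_real \<bar>f\<bar>\<^sub>A powr (- (1 / 2)) =
        complex_of_real (real_of_int (legendre_poly f P) * u ^ n)" if f: "f \<in> monic_polys n" for f
    proof -
      have f': "lead_coeff f = 1" "degree f = n" "f \<noteq> 0" using f by (auto simp: monic_polys_iff)
      have "complex_of_real \<bar>f\<bar>\<^sub>A powr (- (1 / 2)) = complex_of_real (real q ^ n) powr complex_of_real (- (1 / 2))"
        using f' by (simp add: poly_abs_def q_def)
      also have "\<dots> = complex_of_real ((real q ^ n) powr (- (1 / 2)))"
        using q0 by (subst powr_of_real) auto
      also have "(real q ^ n) powr (- (1 / 2)) = (1 / sqrt (real q)) ^ n"
        using q0 by (simp add: powr_minus powr_half_sqrt real_sqrt_power power_one_over inverse_eq_divide)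
      finally have "complex_of_real \<bar>f\<bar>\<^sub>A powr (- (1 / 2)) = complex_of_real ((1 / sqrt (real q)) ^ n)" .
      moreover have "complex_of_int (jacobi_poly D f) = complex_of_real (\<delta> ^ n * real_of_int (legendre_poly f P))"
        using D[OF f'(1)] f'(2) by (metis of_real_of_int_eq)
      ultimately show ?thesis by (simp add: u_def power_divide)
    qed
    hence "(\<Sum>f\<in>monic_polys n. of_int (jacobi_poly D f) * of_real \<bar>f\<bar>\<^sub>A powr (- (1 / 2))) =
        (\<Sum>f\<in>monic_polys n. complex_of_real (real_of_int (legendre_poly f P) * u ^ n))"
      by (intro sum.cong refl)
    thus ?thesis by (simp add: sum_distrib_right)
  qed
  hence "dirichlet_L (1 / 2) D =
      (\<Sum>n. complex_of_real ((\<Sum>f\<in>monic_polys n. real_of_int (legendre_poly f P)) * u ^ n))"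
    unfolding dirichlet_L_def by simp
  also have "\<dots> = (\<Sum>n<2 * g + 2. complex_of_real ((\<Sum>f\<in>monic_polys n. real_of_int (legendre_poly f P)) * u ^ n))"
  proof (rule suminf_finite)
    fix n assume "n \<notin> {..<2 * g + 2}"
    hence "A n = 0" by (intro A_ge_N) simp
    hence "(\<Sum>f\<in>monic_polys n. real_of_int (legendre_poly f P)) = 0"
      unfolding A_def by (simp flip: of_int_sum)
    thus "complex_of_real ((\<Sum>f\<in>monic_polys n. real_of_int (legendre_poly f P)) * u ^ n) = 0" by simp
  qed simp
  finally show ?thesis by (simp add: Lsum_def u_def)
qed

text \<open>Both families are covered at once, since only u^2 = 1/q matters for the estimate:
  \<delta> = 1 for \<open>P\<close>, \<delta> = -1 for \<gamma>P. Here log_q |P| = N and 1/zeta_A(2)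
  = 1 - 1/q.\<close>

lemma second_moment_bigo:
  fixes D :: "'a poly \<Rightarrow> 'a poly" and \<delta> :: real
  assumes \<delta>: "\<delta>\<^sup>2 = 1"
    and D: "\<And>g P f. P \<in> monic_irreducibles (2 * g + 2) \<Longrightarrow> lead_coeff f = 1 \<Longrightarrow>
      real_of_int (jacobi_poly (D P) f) = \<delta> ^ degree f * real_of_int (legendre_poly f P)"
  shows "(\<lambda>g. (\<Sum>P\<in>(monic_irreducibles (2 * g + 2) :: 'a poly set). (dirichlet_L (1 / 2) (D P))\<^sup>2)
        - 1 / (24 * zeta_A q 2) *
            of_real (real q ^ (2 * g + 2) * (log (real q) (real q ^ (2 * g + 2)))\<^sup>2))
      \<in> O(\<lambda>g. of_real (real q ^ (2 * g + 2) * log (real q) (real q ^ (2 * g + 2))))"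
proof -
  define u where "u = \<delta> / sqrt (real q)"
  have q0: "real q > 1" using q_ge_3 by simp
  have u: "real q * u\<^sup>2 = 1" using \<delta> q0 by (simp add: u_def power_divide)
  have log: "log (real q) (real q ^ N) = real N" for N using q0 by (simp add: log_nat_power)
  have zeta: "1 / (24 * zeta_A q 2) = complex_of_real ((1 - 1 / real q) / 24)"
  proof -
    have "(of_nat q :: complex) powr (1 - 2) = 1 / of_nat q"
      using q0 by (simp add: powr_minus inverse_eq_divide)
    thus ?thesis by (simp add: zeta_A_def)
  qed
  define C where "C = 18 * (1 + 2 / (1 - \<bar>u\<bar>)\<^sup>2) * ((1 / \<bar>u\<bar>) / (1 / \<bar>u\<bar> - 1)) + (4 * (2 / (1 - \<bar>u\<bar>)\<^sup>2) + 5) / 4 + 1 / 6"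
  show ?thesis unfolding log zeta
  proof (rule bigoI[of _ C])
    show "\<forall>\<^sub>F g in sequentially.
        norm ((\<Sum>P\<in>(monic_irreducibles (2 * g + 2) :: 'a poly set). (dirichlet_L (1 / 2) (D P))\<^sup>2)
          - complex_of_real ((1 - 1 / real q) / 24) * of_real (real q ^ (2 * g + 2) * (real (2 * g + 2))\<^sup>2))
        \<le> C * norm (complex_of_real (real q ^ (2 * g + 2) * real (2 * g + 2)))"
      \<comment> \<open>The range g \<ge> 1 matches the condition t = g + 1 \<ge> 2 in
        \<open>character_sum_bound\<close>.\<close>
      using eventually_ge_at_top[of 1]
    proof eventually_elim
      case (elim g)
      define N where "N = 2 * g + 2"
      have "dirichlet_L (1 / 2) (D P) = of_real (Lsum P N u)" if "P \<in> monic_irreducibles N" for P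
        unfolding N_def u_def using that D by (intro dirichlet_L_half) (auto simp: N_def)
      hence "(\<Sum>P\<in>(monic_irreducibles N :: 'a poly set). (dirichlet_L (1 / 2) (D P))\<^sup>2) =
          (\<Sum>P\<in>monic_irreducibles N. of_real ((Lsum P N u)\<^sup>2))"
        by (intro sum.cong refl) simp
      hence "(\<Sum>P\<in>(monic_irreducibles N :: 'a poly set). (dirichlet_L (1 / 2) (D P))\<^sup>2)
          - complex_of_real ((1 - 1 / real q) / 24) * of_real (real q ^ N * (real N)\<^sup>2)
          = complex_of_real ((\<Sum>P\<in>monic_irreducibles N. (Lsum P N u)\<^sup>2) - (1 - 1 / real q) / 24 * (real q ^ N * (real N)\<^sup>2))"
        by simp
      moreover have "\<bar>(\<Sum>P\<in>monic_irreducibles N. (Lsum P N u)\<^sup>2) - (1 - 1 / real q) / 24 * (real q ^ N * (real N)\<^sup>2)\<bar>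
          \<le> C * (real q ^ N * real N)"
        by (rule second_moment_bound[OF elim u refl refl refl C_def N_def])
      ultimately show ?case unfolding N_def[symmetric] norm_of_real
        by (simp only: norm_of_real) (simp add: abs_mult)
    qed
  qed
qed

end

theorem theorem2p6:
  fixes q :: nat and \<gamma> :: "'a::finite_field"
  assumes "primepow q" and "odd q" and "CARD('a) = q"
    and "{\<gamma> ^ k | k :: nat. True} = UNIV - {0}"
  shows
    "(\<lambda>g. (\<Sum>P\<in>(monic_irreducibles (2 * g + 2) :: 'a poly set). (dirichlet_L (1 / 2) P)\<^sup>2)
        - 1 / (24 * zeta_A q 2) *
            of_real (real q ^ (2 * g + 2) * (log (real q) (real q ^ (2 * g + 2)))\<^sup>2))
      \<in> O(\<lambda>g. of_real (real q ^ (2 * g + 2) * log (real q) (real q ^ (2 * g + 2))))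
     \<and>
     (\<lambda>g. (\<Sum>P\<in>(monic_irreducibles (2 * g + 2) :: 'a poly set). (dirichlet_L (1 / 2) (smult \<gamma> P))\<^sup>2)
        - 1 / (24 * zeta_A q 2) *
            of_real (real q ^ (2 * g + 2) * (log (real q) (real q ^ (2 * g + 2)))\<^sup>2))
      \<in> O(\<lambda>g. of_real (real q ^ (2 * g + 2) * log (real q) (real q ^ (2 * g + 2))))"
proof -
  interpret odd_finite_field "TYPE('a)" q
    by unfold_locales (use assms in auto)
  show ?thesis
  proof (intro conjI second_moment_bigo[where \<delta> = 1 and D = "\<lambda>P. P"] second_moment_bigo[where \<delta> = "-1" and D = "smult \<gamma>"])
    fix g and P f :: "'a poly"
    assume P: "P \<in> monic_irreducibles (2 * g + 2)" and f: "lead_coeff f = 1"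
    note PD = monic_irreduciblesD[OF P]
    show "real_of_int (jacobi_poly P f) = 1 ^ degree f * real_of_int (legendre_poly f P)"
      using jacobi_irreducible[OF PD(1,2) _ f] PD(3) by simp
    show "real_of_int (jacobi_poly (smult \<gamma> P) f) = (- 1) ^ degree f * real_of_int (legendre_poly f P)"
      using jacobi_generator_irreducible[OF PD(1,2) _ f assms(4)] PD(3) by simp
  qed simp_all
qed

end
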